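(* Let $X$ be a Banach space over $\mathbb{K}=\mathbb{R}$ or $\mathbb{K}=\mathbb{C}$ such that $X^{(\infty)}$ has an infinite-dimensional centralizer, i.e. $Z(X^{(\infty)})$ is infinite-dimensional. Then $X$ has the USD2P.
   Context: Let $X$ be a Banach space over $\mathbb{K}\in\{\mathbb{R},\mathbb{C}\}$. Via the canonical isometric embeddings of a Banach space into its bidual, view $X\subseteq X^{**}\subseteq X^{(4)}\subseteq\cdots\subseteq X^{(2n)}\subseteq\cdots$, where $X^{(2n)}$ is the $2n$-th dual of $X$ ($X^{(0)}=X$). The vector space $\bigcup_{n\ge0}X^{(2n)}$ is normed by giving $x$ its norm in any $X^{(2n)}$ containing it, and $X^{(\infty)}$ denotes the completion of this normed space. For a Banach space $Y$, $\mathrm{ext}(B_{Y^*})$ is the set of extreme points of the closed unit ball of $Y^*$. A multiplier on $Y$ is a bounded linear operator $T:Y\to Y$ such that every $p\in\mathrm{ext}(B_{Y^*})$ is an eigenvector of $T^*$, i.e. there is a scalar $a_T(p)$ with $p\circ T=T^*(p)=a_T(p)p$. The centralizer $Z(Y)$ is the set of multipliers $T$ on $Y$ for which there is another multiplier $S$ with $a_T(p)=\overline{a_S(p)}$ for all $p\in\mathrm{ext}(B_{Y^*})$ (for real $Y$, $Z(Y)$ is the set of all multipliers). $B_X$ is the closed unit ball of $X$. A slice of $B_X$ is a set $S(B_X,f,\alpha)=\{x\in B_X: f(x)>\sup f(B_X)-\alpha\}$ with $f\in X^*$, $\alpha>0$ (for complex $X$, use real-linear continuous functionals, equivalently $\mathrm{Re}\,f$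 in place of $f$). A convex combination of slices of $B_X$ is a set $\sum_{i=1}^n\lambda_iS_i=\{\sum_{i=1}^n\lambda_i x_i: x_i\in S_i\}$ with $n\in\mathbb{N}$, $\lambda_i>0$, $\sum_{i=1}^n\lambda_i=1$ and each $S_i$ a slice of $B_X$. $X$ has the strong diameter two property (SD2P) if every convex combination of slices of $B_X$ has diameter $2$. For an ultrafilter $\mathcal{U}$ over $\mathbb{N}$, the ultrapower is $X_{\mathcal{U}}=\ell_\infty(\mathbb{N},X)/\{f\in\ell_\infty(\mathbb{N},X):\lim_{\mathcal{U}}\|f(n)\|=0\}$ with the quotient norm. $X$ has the uniform strong diameter two property (USD2P) if $X_{\mathcal{U}}$ has the SD2P for every free ultrafilter $\mathcal{U}$ over $\mathbb{N}$. *)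

theory Defs
  imports
    "HOL-Analysis.Analysis"
    "HOL-Library.Function_Algebras"
begin

section \<open>The scalar field\<close>

text \<open>
  The scalars are \<open>\<real>\<close> or \<open>\<complex>\<close>, together with conjugation.
  The axioms leave no other possibility; see \<open>scalar_cases\<close> below.
\<close>

class real_or_complex = real_normed_field +
  fixes scnj :: "'a \<Rightarrow> 'a"
  assumes scnj_add: "scnj (x + y) = scnj x + scnj y"
    and scnj_mult: "scnj (x * y) = scnj x * scnj y"
    and scnj_scnj: "scnj (scnj x) = x"
    and add_scnj_scaleR: "\<exists>r. x + scnj x = r *\<^sub>R 1"
    and mult_scnj_scaleR: "x * scnj x = (norm x)\<^sup>2 *\<^sub>R 1"

instantiation real :: real_or_complex
begin
definition scnj_real :: "real \<Rightarrow> real" where "scnj_real x = x"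
instance
  by standard (auto simp: scnj_real_def power2_eq_square)
end

instantiation complex :: real_or_complex
begin
definition scnj_complex :: "complex \<Rightarrow> complex" where "scnj_complex = cnj"
instance
proof
  fix x :: complex
  show "\<exists>r. x + scnj x = r *\<^sub>R 1"
    by (rule exI[of _ "2 * Re x"]) (simp add: scnj_complex_def complex_eq_iff)
  show "x * scnj x = (norm x)\<^sup>2 *\<^sub>R 1"
    unfolding scnj_complex_def complex_norm_square[symmetric] by (simp add: scaleR_conv_of_real)
qed (simp_all add: scnj_complex_def)
end

lemma add_scnj: "x + scnj x \<in> \<real>" for x :: "'k::real_or_complex"
  using add_scnj_scaleR[of x] by (auto simp: Reals_def of_real_def)

lemma mult_scnj: "x * scnj x = of_real ((norm x)\<^sup>2)" for x :: "'k::real_or_complex"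
  by (simp add: mult_scnj_scaleR of_real_def)

lemma scalar_cases:
  "(\<forall>x::'k::real_or_complex. x \<in> \<real> \<and> scnj x = x) \<or>
   (\<exists>i::'k. i * i = -1 \<and>
      (\<forall>x. \<exists>a b. x = of_real a + of_real b * i \<and> scnj x = of_real a - of_real b * i))"
proof -
  have fixed: "x \<in> \<real>" if "scnj x = x" for x :: 'k
  proof -
    have "x = (x + scnj x) / 2" using that by simp
    also have "\<dots> \<in> \<real>" by (intro Reals_divide add_scnj) simp
    finally show ?thesis .
  qed
  have neg: "scnj (- x) = - scnj x" for x :: 'k
    by (metis add.right_inverse add_cancel_right_left add_eq_0_iff scnj_add)
  have real: "scnj (of_real r) = (of_real r :: 'k)" for r :: real
    using mult_scnj[of "of_real r :: 'k"] neg[of 0]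
    by (cases "r = 0") (auto simp: power2_eq_square)
  show ?thesis
  proof (cases "\<forall>x::'k. scnj x = x")
    case True
    then show ?thesis using fixed by blast
  next
    case False
    then obtain z :: 'k where z: "scnj z \<noteq> z" by blast
    define w where "w = z - scnj z"
    have w: "w \<noteq> 0" using z by (simp add: w_def)
    have cw: "scnj w = - w"
      using scnj_add[of z "- scnj z"] by (simp add: w_def neg scnj_scnj)
    define i where "i = w * of_real (inverse (norm w))"
    have ci: "scnj i = - i" by (simp only: i_def scnj_mult cw real) simp
    have "norm i = 1" using w by (simp add: i_def norm_mult del: of_real_inverse)
    then have ii: "i * i = -1" using mult_scnj[of i] ci by (simp add: minus_equation_iff)
    have "\<exists>a b. x = of_real a + of_real b * i \<and> scnj x = of_real a - of_real b * i" for x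
    proof -
      have "(x + scnj x) / 2 \<in> \<real>" by (intro Reals_divide add_scnj) simp
      then obtain a where a: "(x + scnj x) / 2 = of_real a" by (auto elim: Reals_cases)
      define y where "y = (x - scnj x) * i * of_real (-1/2)"
      have "scnj y = (scnj x - x) * (- i) * of_real (-1/2)"
        using scnj_add[of x "- scnj x"] by (simp only: y_def scnj_mult real ci) (simp add: neg scnj_scnj)
      then have "scnj y = y" by (simp add: y_def algebra_simps)
      then obtain b where b: "y = of_real b" using fixed by (auto elim: Reals_cases)
      have "y * i = (x - scnj x) * (i * i) * of_real (-1/2)"
        by (simp only: y_def mult_ac)
      then have "y * i = (x - scnj x) / 2" by (simp add: ii field_simps)
      then have "(x - scnj x) / 2 = of_real b * i" using b by simp
      moreover have "x = (x + scnj x) / 2 + (x - scnj x) / 2"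
        "scnj x = (x + scnj x) / 2 - (x - scnj x) / 2"
        by (simp_all add: field_simps)
      ultimately show ?thesis using a by metis
    qed
    then show ?thesis using ii by blast
  qed
qed


section \<open>Banach spaces over the scalar field\<close>

text \<open>
  A Banach space over \<open>'k\<close> is a real Banach space whose real scalar multiplication is extended
  to a multiplication \<open>s\<close> by elements of \<open>'k\<close>.  (For \<open>'k = real\<close> this forces \<open>s = scaleR\<close>.)
\<close>

locale K_banach = vector_space s
  for s :: "'k::real_or_complex \<Rightarrow> 'a::banach \<Rightarrow> 'a" +
  assumes scale_of_real: "s (of_real r) x = r *\<^sub>R x"
    and norm_scale: "norm (s c x) = norm c * norm x"

text \<open>
  Dual spaces of subspaces and ultrapowers are not types, so they are treated as normed spaces
  with an explicit carrier.
\<close>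

record ('k, 'a) nspace =
  carr :: "'a set"
  vadd :: "'a \<Rightarrow> 'a \<Rightarrow> 'a"
  vzero :: 'a
  vscale :: "'k \<Rightarrow> 'a \<Rightarrow> 'a"
  vnorm :: "'a \<Rightarrow> real"

definition subsp :: "('k \<Rightarrow> 'a \<Rightarrow> 'a) \<Rightarrow> 'a set \<Rightarrow> ('k, 'a::real_normed_vector) nspace" where
  "subsp s E = \<lparr>carr = E, vadd = (+), vzero = 0, vscale = s, vnorm = norm\<rparr>"

abbreviation whole :: "('k \<Rightarrow> 'a \<Rightarrow> 'a) \<Rightarrow> ('k, 'a::real_normed_vector) nspace" where
  "whole s \<equiv> subsp s UNIV"

definition restrict_scalars :: "('k::real_normed_field, 'a) nspace \<Rightarrow> (real, 'a) nspace" where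
  "restrict_scalars V =
     \<lparr>carr = carr V, vadd = vadd V, vzero = vzero V,
      vscale = (\<lambda>r. vscale V (of_real r)), vnorm = vnorm V\<rparr>"

definition unit_ball :: "('k, 'a) nspace \<Rightarrow> 'a set" where
  "unit_ball V = {x \<in> carr V. vnorm V x \<le> 1}"

definition linear_map :: "('k, 'a) nspace \<Rightarrow> ('k, 'b) nspace \<Rightarrow> ('a \<Rightarrow> 'b) \<Rightarrow> bool" where
  "linear_map V W T \<longleftrightarrow>
     T ` carr V \<subseteq> carr W \<and>
     (\<forall>x\<in>carr V. \<forall>y\<in>carr V. T (vadd V x y) = vadd W (T x) (T y)) \<and>
     (\<forall>c. \<forall>x\<in>carr V. T (vscale V c x) = vscale W c (T x))"

definition isometric_iso :: "('k, 'a) nspace \<Rightarrow> ('k, 'b) nspace \<Rightarrow> ('a \<Rightarrow> 'b) \<Rightarrow> bool" where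
  "isometric_iso V W T \<longleftrightarrow>
     linear_map V W T \<and> T ` carr V = carr W \<and> (\<forall>x\<in>carr V. vnorm W (T x) = vnorm V x)"

text \<open>
  Functionals on \<open>V\<close> are represented by functions that are \<open>undefined\<close> outside \<open>carr V\<close>, so that
  equality of functionals is equality of functions.
\<close>

definition dual :: "('k::real_normed_field, 'a) nspace \<Rightarrow> ('k, 'a \<Rightarrow> 'k) nspace" where
  "dual V =
     \<lparr>carr = {f \<in> extensional (carr V).
        linear_map V (whole (*)) f \<and> (\<exists>B. \<forall>x\<in>carr V. norm (f x) \<le> B * vnorm V x)},
      vadd = (\<lambda>f g. \<lambda>x\<in>carr V. f x + g x),
      vzero = (\<lambda>x\<in>carr V. 0),
      vscale = (\<lambda>c f. \<lambda>x\<in>carr V. c * f x),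
      vnorm = (\<lambda>f. SUP x\<in>unit_ball V. norm (f x))\<rparr>"

definition canonical_embedding ::
    "('k::real_normed_field, 'a) nspace \<Rightarrow> 'a \<Rightarrow> ('a \<Rightarrow> 'k) \<Rightarrow> 'k" where
  "canonical_embedding V x = (\<lambda>f\<in>carr (dual V). f x)"


section \<open>The space \<open>X\<^sup>(\<^sup>\<infinity>\<^sup>)\<close>\<close>

text \<open>
  There is no HOL type operator producing the union of all \<open>X\<^sup>(\<^sup>2\<^sup>n\<^sup>)\<close> from the type of \<open>X\<close>: the
  types of the iterated duals are pairwise different, and in general they grow without bound.
  The completion of the union is therefore given by a realization.  The Banach space \<open>Y\<close> (with
  scalar multiplication \<open>sY\<close>) is \<open>X\<^sup>(\<^sup>\<infinity>\<^sup>)\<close> if it is the closure of the union of an increasing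
  sequence of subspaces \<open>E 0 \<subseteq> E 1 \<subseteq> \<dots>\<close>, where \<open>E 0\<close> is (a copy of) \<open>X\<close>, and
  \<open>E (n + 1)\<close> is (a copy of) the bidual of \<open>E n\<close> in such a way that the inclusion of \<open>E n\<close>
  into \<open>E (n + 1)\<close> is the canonical embedding into the bidual.  Thus \<open>E n\<close> is \<open>X\<^sup>(\<^sup>2\<^sup>n\<^sup>)\<close>, and
  these properties determine \<open>Y\<close> up to an isometric isomorphism that is the identity on \<open>X\<close>.
\<close>

definition is_X_infinity ::
    "('k::real_or_complex \<Rightarrow> 'a::banach \<Rightarrow> 'a) \<Rightarrow> ('k \<Rightarrow> 'b::banach \<Rightarrow> 'b) \<Rightarrow> bool" where
  "is_X_infinity sX sY \<longleftrightarrow>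
     (\<exists>(J :: 'a \<Rightarrow> 'b) (E :: nat \<Rightarrow> 'b set) (\<Phi> :: nat \<Rightarrow> 'b \<Rightarrow> ('b \<Rightarrow> 'k) \<Rightarrow> 'k).
        (\<forall>n. module.subspace sY (E n)) \<and>
        (\<forall>n. E n \<subseteq> E (Suc n)) \<and>
        isometric_iso (whole sX) (subsp sY (E 0)) J \<and>
        (\<forall>n. isometric_iso (subsp sY (E (Suc n))) (dual (dual (subsp sY (E n)))) (\<Phi> n)) \<and>
        (\<forall>n. \<forall>x\<in>E n. \<Phi> n x = canonical_embedding (subsp sY (E n)) x) \<and>
        closure (\<Union>n. E n) = UNIV)"


section \<open>Multipliers and the centralizer\<close>

definition ext_points :: "('k::real_normed_field, 'a) nspace \<Rightarrow> 'a set \<Rightarrow> 'a set" where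
  "ext_points V C =
     {x \<in> C. \<forall>a\<in>C. \<forall>b\<in>C. \<forall>t::real. 0 < t \<and> t < 1 \<and>
        x = vadd V (vscale V (of_real (1 - t)) a) (vscale V (of_real t) b) \<longrightarrow> a = b}"

abbreviation ext_dual_ball :: "('k::real_normed_field, 'a) nspace \<Rightarrow> ('a \<Rightarrow> 'k) set" where
  "ext_dual_ball V \<equiv> ext_points (dual V) (unit_ball (dual V))"

text \<open>\<open>p\<close> is an eigenvector of the adjoint of \<open>T\<close> with eigenvalue \<open>a\<close>, i.e.\ \<open>a = a\<^sub>T(p)\<close>.\<close>

definition adj_eigen :: "('b \<Rightarrow> 'b) \<Rightarrow> ('b \<Rightarrow> 'k::real_or_complex) \<Rightarrow> 'k \<Rightarrow> bool" where
  "adj_eigen T p a \<longleftrightarrow> p \<circ> T = (\<lambda>y. a * p y)"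

definition multiplier :: "('k::real_or_complex \<Rightarrow> 'b::banach \<Rightarrow> 'b) \<Rightarrow> ('b \<Rightarrow> 'b) \<Rightarrow> bool" where
  "multiplier s T \<longleftrightarrow>
     bounded_linear T \<and> (\<forall>c y. T (s c y) = s c (T y)) \<and>
     (\<forall>p\<in>ext_dual_ball (whole s). \<exists>a. adj_eigen T p a)"

definition centralizer :: "('k::real_or_complex \<Rightarrow> 'b::banach \<Rightarrow> 'b) \<Rightarrow> ('b \<Rightarrow> 'b) set" where
  "centralizer s =
     {T. multiplier s T \<and>
         (\<exists>S. multiplier s S \<and>
            (\<forall>p\<in>ext_dual_ball (whole s). \<exists>a. adj_eigen S p a \<and> adj_eigen T p (scnj a)))}"

definition infinite_dim_centralizer :: "('k::real_or_complex \<Rightarrow> 'b::banach \<Rightarrow> 'b) \<Rightarrow> bool" where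
  "infinite_dim_centralizer s \<longleftrightarrow>
     (\<nexists>B. finite B \<and> centralizer s \<subseteq> module.span (\<lambda>c T y. s c (T y)) B)"


section \<open>The strong diameter two property\<close>

definition slice :: "(real, 'a) nspace \<Rightarrow> ('a \<Rightarrow> real) \<Rightarrow> real \<Rightarrow> 'a set" where
  "slice V f \<alpha> = {x \<in> unit_ball V. f x > (SUP y\<in>unit_ball V. f y) - \<alpha>}"

primrec vsum :: "('k, 'a) nspace \<Rightarrow> (nat \<Rightarrow> 'a) \<Rightarrow> nat \<Rightarrow> 'a" where
  "vsum V x 0 = vzero V"
| "vsum V x (Suc n) = vadd V (vsum V x n) (x n)"

definition set_combination ::
    "(real, 'a) nspace \<Rightarrow> nat \<Rightarrow> (nat \<Rightarrow> real) \<Rightarrow> (nat \<Rightarrow> 'a set) \<Rightarrow> 'a set" where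
  "set_combination V n c S = {vsum V (\<lambda>i. vscale V (c i) (x i)) n | x. \<forall>i<n. x i \<in> S i}"

definition vdiameter :: "(real, 'a) nspace \<Rightarrow> 'a set \<Rightarrow> real" where
  "vdiameter V A = (SUP (x, y)\<in>A \<times> A. vnorm V (vadd V x (vscale V (-1) y)))"

definition SD2P :: "(real, 'a) nspace \<Rightarrow> bool" where
  "SD2P V \<longleftrightarrow>
     (\<forall>n c f \<alpha>.
        (\<forall>i<n. 0 < c i \<and> f i \<in> carr (dual V) \<and> 0 < \<alpha> i) \<and> (\<Sum>i<n. c i) = 1 \<longrightarrow>
        vdiameter V (set_combination V n c (\<lambda>i. slice V (f i) (\<alpha> i))) = 2)"


section \<open>Ultrapowers and the uniform strong diameter two property\<close>

definition free_ultrafilter :: "'i filter \<Rightarrow> bool" where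
  "free_ultrafilter U \<longleftrightarrow>
     U \<noteq> bot \<and>
     (\<forall>P. eventually P U \<or> eventually (\<lambda>i. \<not> P i) U) \<and>
     (\<forall>j. eventually (\<lambda>i. i \<noteq> j) U)"

text \<open>
  Since \<open>nat\<close> is discrete, the type \<open>nat \<Rightarrow>\<^sub>C 'a\<close> of bounded continuous functions with the supremum
  norm is \<open>\<ell>\<^sub>\<infinity>(\<nat>, X)\<close>.  The elements of the ultrapower are the classes of \<open>ultra_rel U\<close>.
\<close>

definition ultra_rel ::
    "nat filter \<Rightarrow> ((nat \<Rightarrow>\<^sub>C 'a::real_normed_vector) \<times> (nat \<Rightarrow>\<^sub>C 'a)) set" where
  "ultra_rel U = {(f, g). ((\<lambda>n. norm (apply_bcontfun (f - g) n)) \<longlongrightarrow> 0) U}"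

definition seq_scale ::
    "('k \<Rightarrow> 'a \<Rightarrow> 'a) \<Rightarrow> 'k \<Rightarrow> (nat \<Rightarrow>\<^sub>C 'a::real_normed_vector) \<Rightarrow> (nat \<Rightarrow>\<^sub>C 'a)" where
  "seq_scale s c f = Bcontfun (\<lambda>n. s c (apply_bcontfun f n))"

definition ultrapower ::
    "('k \<Rightarrow> 'a \<Rightarrow> 'a) \<Rightarrow> nat filter \<Rightarrow> ('k, (nat \<Rightarrow>\<^sub>C 'a::real_normed_vector) set) nspace" where
  "ultrapower s U =
     \<lparr>carr = UNIV // ultra_rel U,
      vadd = (\<lambda>A B. \<Union>f\<in>A. \<Union>g\<in>B. ultra_rel U `` {f + g}),
      vzero = ultra_rel U `` {0},
      vscale = (\<lambda>c A. \<Union>f\<in>A. ultra_rel U `` {seq_scale s c f}),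
      vnorm = (\<lambda>A. INF f\<in>A. norm f)\<rparr>"

definition USD2P :: "('k::real_or_complex \<Rightarrow> 'a::banach \<Rightarrow> 'a) \<Rightarrow> bool" where
  "USD2P s \<longleftrightarrow> (\<forall>U. free_ultrafilter U \<longrightarrow> SD2P (restrict_scalars (ultrapower s U)))"

end

theory Submission
  imports Defs
begin

text \<open>
  Write \<open>Y = X\<^sup>(\<^sup>\<infinity>\<^sup>)\<close>.  If the real multipliers on \<open>Y\<close> had at most \<open>N\<close> eigenvalues each, then
  all of them would be functions of one with the largest number of eigenvalues, and \<open>Z(Y)\<close> would
  be spanned by finitely many idempotents.  So some real multiplier \<open>T\<close> has \<open>N\<close> distinct
  eigenvalues at extreme points \<open>p\<^sub>j\<close>, and polynomials in \<open>T\<close> that approximate disjointly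
  supported tent functions give operators \<open>Q\<^sub>j\<close>, \<open>j < N\<close>, that behave like multiplication by
  almost disjoint functions with values in \<open>[0, 1]\<close>.  For \<open>x\<^sub>i\<close> of norm less than one and for \<open>u\<^sub>j\<close>
  in the open unit ball with \<open>p\<^sub>j u\<^sub>j\<close> close to one, all \<open>x\<^sub>i - Q\<^sub>j x\<^sub>i \<plusminus> Q\<^sub>j u\<^sub>j\<close> lie in the unit ball, \<open>Q\<^sub>j u\<^sub>j\<close> has norm close to one, and all
  signed sums over \<open>j\<close> of the \<open>Q\<^sub>j x\<^sub>i\<close> and of the \<open>Q\<^sub>j u\<^sub>j\<close> lie in the unit ball.

  For given \<open>x\<^sub>i\<close> in \<open>X\<close> these are finitely many strict norm inequalities.  They survive an
  approximation by elements of some \<open>X\<^sup>(\<^sup>2\<^sup>m\<^sup>)\<close>, and by a Helly-type separation argument (the part of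
  local reflexivity that is needed here) they can be solved in \<open>X\<^sup>(\<^sup>2\<^sup>m\<^sup>-\<^sup>2\<^sup>)\<close>, hence in \<open>X\<close>.  Solving
  them in every coordinate gives the same configuration in the ultrapower.  A functional is
  summable over \<open>j\<close> on each family of bounded signed sums, so for large \<open>N\<close> some index \<open>j\<close> changes
  none of the given functionals by much: both signs stay in the slices, and the two resulting
  convex combinations differ by \<open>2 Q\<^sub>j u\<^sub>j\<close>.
\<close>

section \<open>Dominated and extreme linear functionals\<close>

text \<open>The scalar multiplication \<open>m\<close> is a parameter because the notion is used on
  a Banach space and again on the functions \<open>'l \<Rightarrow> 'b\<close> of the separation
  argument. The inequality for r and for 1/r together gives positive homogeneity.\<close>

definition sublinear :: "(real \<Rightarrow> 'v::ab_group_add \<Rightarrow> 'v) \<Rightarrow> ('v \<Rightarrow> real) \<Rightarrow> bool" where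
  "sublinear m q \<longleftrightarrow> (\<forall>x y. q (x + y) \<le> q x + q y) \<and> (\<forall>r>0. \<forall>x. q (m r x) \<le> r * q x)"

definition linear_functional :: "(real \<Rightarrow> 'v::ab_group_add \<Rightarrow> 'v) \<Rightarrow> ('v \<Rightarrow> real) \<Rightarrow> bool" where
  "linear_functional m g \<longleftrightarrow> (\<forall>x y. g (x + y) = g x + g y) \<and> (\<forall>r x. g (m r x) = r * g x)"

lemma linear_functional_simps:
  assumes "linear_functional m g"
  shows "g 0 = 0" "g (x + y) = g x + g y" "g (m r x) = r * g x" "g (- x) = - g x"
    "g (x - y) = g x - g y"
proof -
  show a: "g (x + y) = g x + g y" for x y using assms by (simp add: linear_functional_def)
  show "g (m r x) = r * g x" using assms by (simp add: linear_functional_def)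
  show z: "g 0 = 0" using a[of 0 0] by simp
  show n: "g (- x) = - g x" for x using a[of x "- x"] z by simp
  show "g (x - y) = g x - g y" using a[of x "- y"] n by simp
qed

locale real_vector_space = vector_space m for m :: "real \<Rightarrow> 'v::ab_group_add \<Rightarrow> 'v"
begin

section \<open>Sublinear functionals over an explicit real vector space\<close>

lemma sublinear_zero:
  assumes "sublinear m q" shows "q 0 = 0"
proof -
  have "q 0 \<le> q 0 + q 0" using assms unfolding sublinear_def by (metis add.right_neutral)
  moreover have "q (m (1/2) 0) \<le> 1/2 * q 0"
    using assms unfolding sublinear_def by (meson half_gt_zero zero_less_one)
  ultimately show ?thesis by simp
qed

lemma sublinear_scale:
  assumes "sublinear m q" "0 \<le> r" shows "q (m r x) = r * q x"
proof (cases "r = 0")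
  case True
  then show ?thesis using sublinear_zero[OF assms(1)] by simp
next
  case False
  then have r: "r > 0" using assms by simp
  have "q (m (1/r) (m r x)) \<le> 1/r * q (m r x)"
    using assms(1)[unfolded sublinear_def, THEN conjunct2, rule_format, of "1/r" "m r x"] r by simp
  then have "r * q x \<le> q (m r x)" using r by (simp add: field_simps)
  moreover have "q (m r x) \<le> r * q x" using assms r unfolding sublinear_def by simp
  ultimately show ?thesis by simp
qed

lemma sublinear_minus_le:
  assumes "sublinear m q" shows "- q (- x) \<le> q x"
proof -
  have "q (x + - x) \<le> q x + q (- x)" using assms unfolding sublinear_def by blast
  then show ?thesis using sublinear_zero[OF assms] by simp
qed

text \<open>Subadditivity applied to x + y and - y gives, with oddness, the reverse of subadditivity
  at x and y.\<close>

lemma sublinear_odd_imp_linear: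
  assumes q: "sublinear m q" and odd: "\<And>x. q (- x) \<le> - q x"
  shows "linear_functional m q"
proof -
  have o: "q (- x) = - q x" for x using odd[of x] sublinear_minus_le[OF q, of x] by simp
  have "q (x + y) = q x + q y" for x y
  proof -
    have "q (x + y) \<le> q x + q y" using q unfolding sublinear_def by blast
    moreover have "q ((x + y) + - y) \<le> q (x + y) + q (- y)" using q unfolding sublinear_def by blast
    ultimately show ?thesis by (simp add: o)
  qed
  moreover have "q (m r x) = r * q x" for r x
  proof (cases "0 \<le> r")
    case True
    then show ?thesis using sublinear_scale[OF q] by simp
  next
    case False
    then have "q (m (- r) x) = - r * q x" using sublinear_scale[OF q, of "- r"] by simp
    then show ?thesis using o[of "m r x"] by simp
  qed
  ultimately show ?thesis by (simp add: linear_functional_def)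
qed

text \<open>The index k may depend on the given indices: a sum of parameters for tangents, the
  smaller member for chains, a sum of vectors for the distance to a subspace. All three are infima
  of this kind.\<close>

lemma sublinear_INF:
  assumes ne: "I \<noteq> {}"
    and bdd: "\<And>x. bdd_below ((\<lambda>i. Q i x) ` I)"
    and add: "\<And>i j x y. i \<in> I \<Longrightarrow> j \<in> I \<Longrightarrow> \<exists>k\<in>I. Q k (x + y) \<le> Q i x + Q j y"
    and scale: "\<And>i r x. i \<in> I \<Longrightarrow> 0 < r \<Longrightarrow> \<exists>k\<in>I. Q k (m r x) \<le> r * Q i x"
  shows "sublinear m (\<lambda>x. INF i\<in>I. Q i x)"
  unfolding sublinear_def
proof (intro conjI allI impI)
  fix x y
  have *: "(INF i\<in>I. Q i (x + y)) \<le> Q i x + Q j y" if "i \<in> I" "j \<in> I" for i j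
    using add[OF that, of x y] cINF_lower[OF bdd, of _ "x + y"] by (meson order_trans)
  have "(INF i\<in>I. Q i (x + y)) - Q j y \<le> (INF i\<in>I. Q i x)" if "j \<in> I" for j
    by (rule cINF_greatest[OF ne]) (use *[OF _ that] in \<open>simp add: algebra_simps\<close>)
  then have "(INF i\<in>I. Q i (x + y)) - (INF i\<in>I. Q i x) \<le> (INF i\<in>I. Q i y)"
    by (intro cINF_greatest[OF ne]) (simp add: algebra_simps)
  then show "(INF i\<in>I. Q i (x + y)) \<le> (INF i\<in>I. Q i x) + (INF i\<in>I. Q i y)" by simp
next
  fix r :: real and x assume r: "0 < r"
  have "(INF i\<in>I. Q i (m r x)) / r \<le> (INF i\<in>I. Q i x)"
  proof (rule cINF_greatest[OF ne])
    fix i assume "i \<in> I"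
    then obtain k where "k \<in> I" "Q k (m r x) \<le> r * Q i x" using scale r by blast
    then have "(INF i\<in>I. Q i (m r x)) \<le> r * Q i x"
      using cINF_lower[OF bdd, of k "m r x"] by linarith
    then show "(INF i\<in>I. Q i (m r x)) / r \<le> Q i x" using r by (simp add: field_simps)
  qed
  then show "(INF i\<in>I. Q i (m r x)) \<le> r * (INF i\<in>I. Q i x)" using r by (simp add: field_simps)
qed

text \<open>With t = 1/s this is the one-sided directional derivative of q at x0 in the direction x,
  the infimum of (q(x0 + s x) - q(x0))/s. The linear functionals below it are those below q that
  attain the value q x0 at x0.\<close>

definition tangent :: "('v \<Rightarrow> real) \<Rightarrow> 'v \<Rightarrow> 'v \<Rightarrow> real" where
  "tangent q x0 x = (INF t\<in>{0..}. q (x + m t x0) - t * q x0)"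

lemma tangent_bdd:
  assumes "sublinear m q"
  shows "bdd_below ((\<lambda>t. q (x + m t x0) - t * q x0) ` {0..})"
proof (rule bdd_belowI2[of _ "- q (- x)"])
  fix t :: real assume "t \<in> {0..}"
  then have "q (m t x0) = t * q x0" using sublinear_scale[OF assms] by simp
  moreover have "q ((x + m t x0) + - x) \<le> q (x + m t x0) + q (- x)"
    using assms unfolding sublinear_def by blast
  ultimately show "- q (- x) \<le> q (x + m t x0) - t * q x0" by simp
qed

lemma tangent_le:
  assumes "sublinear m q" "0 \<le> t"
  shows "tangent q x0 x \<le> q (x + m t x0) - t * q x0"
  unfolding tangent_def by (rule cINF_lower[OF tangent_bdd[OF assms(1)]]) (use assms in simp)

lemma tangent_le_self: "sublinear m q \<Longrightarrow> tangent q x0 x \<le> q x"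
  using tangent_le[of q 0 x0 x] by simp

lemma tangent_minus: "sublinear m q \<Longrightarrow> tangent q x0 (- x0) \<le> - q x0"
  using tangent_le[of q 1 x0 "- x0"] by (simp add: sublinear_zero)

lemma sublinear_tangent:
  assumes q: "sublinear m q" shows "sublinear m (tangent q x0)"
  unfolding tangent_def
proof (rule sublinear_INF)
  show "\<exists>k\<in>{0..}. q (x + y + m k x0) - k * q x0 \<le> q (x + m i x0) - i * q x0 + (q (y + m j x0) - j * q x0)"
    if "i \<in> {0..}" "j \<in> {0..}" for i j x y
  proof (rule bexI[of _ "i + j"])
    have "x + y + m (i + j) x0 = (x + m i x0) + (y + m j x0)"
      by (simp add: scale_left_distrib)
    moreover have "q ((x + m i x0) + (y + m j x0)) \<le> q (x + m i x0) + q (y + m j x0)"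
      using q unfolding sublinear_def by blast
    ultimately show "q (x + y + m (i + j) x0) - (i + j) * q x0 \<le> q (x + m i x0) - i * q x0 + (q (y + m j x0) - j * q x0)"
      by (simp add: algebra_simps)
  qed (use that in auto)
  show "\<exists>k\<in>{0..}. q (m r x + m k x0) - k * q x0 \<le> r * (q (x + m i x0) - i * q x0)"
    if "i \<in> {0..}" "0 < r" for i r x
  proof (rule bexI[of _ "r * i"])
    have "m r x + m (r * i) x0 = m r (x + m i x0)" by (simp add: scale_right_distrib)
    moreover have "q (m r (x + m i x0)) \<le> r * q (x + m i x0)"
      using q that unfolding sublinear_def by blast
    ultimately show "q (m r x + m (r * i) x0) - r * i * q x0 \<le> r * (q (x + m i x0) - i * q x0)"
      by (simp add: algebra_simps)
  qed (use that in auto)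
qed (use tangent_bdd[OF q] in auto)

text \<open>A sublinear q stands for the convex set of linear functionals that it dominates, as its
  support function. The condition says that this set is an extreme subset of the one belonging to
  p.\<close>

definition face :: "('v \<Rightarrow> real) \<Rightarrow> ('v \<Rightarrow> real) \<Rightarrow> bool" where
  "face p q \<longleftrightarrow> sublinear m q \<and> q \<le> p \<and>
     (\<forall>a b t. linear_functional m a \<and> linear_functional m b \<and> a \<le> p \<and> b \<le> p \<and> 0 < t \<and> t < 1 \<and>
        (\<forall>x. (1 - t) * a x + t * b x \<le> q x) \<longrightarrow> a \<le> q \<and> b \<le> q)"

text \<open>Passing to the tangent at x0 cuts out the functionals with the maximal value at x0, and
  maximizing a linear expression over an extreme subset gives an extreme subset again.\<close>

lemma face_tangent:
  assumes "face p q" shows "face p (tangent q x0)"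
proof -
  have q: "sublinear m q" "q \<le> p" using assms by (auto simp: face_def)
  have le: "tangent q x0 \<le> q" by (simp add: le_fun_def tangent_le_self q)
  have below: "a \<le> tangent q x0" if "linear_functional m a" "a \<le> q" "q x0 \<le> a x0" for a
  proof (rule le_funI)
    fix x
    have "a x \<le> q (x + m t x0) - t * q x0" if "t \<in> {0..}" for t
    proof -
      have "a (x + m t x0) \<le> q (x + m t x0)" using \<open>a \<le> q\<close> by (simp add: le_fun_def)
      moreover have "t * q x0 \<le> t * a x0" using \<open>q x0 \<le> a x0\<close> that by (simp add: mult_left_mono)
      ultimately show ?thesis using linear_functional_simps[OF \<open>linear_functional m a\<close>] by simp
    qed
    then show "a x \<le> tangent q x0 x" unfolding tangent_def by (intro cINF_greatest) auto
  qed
  show ?thesis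
    unfolding face_def
  proof (intro conjI allI impI)
    show "sublinear m (tangent q x0)" by (rule sublinear_tangent[OF q(1)])
    show "tangent q x0 \<le> p" using le q(2) by (rule order_trans)
  next
    fix a b :: "'v \<Rightarrow> real" and t :: real
    assume h: "linear_functional m a \<and> linear_functional m b \<and> a \<le> p \<and> b \<le> p \<and> 0 < t \<and> t < 1 \<and>
       (\<forall>x. (1 - t) * a x + t * b x \<le> tangent q x0 x)"
    have "\<forall>x. (1 - t) * a x + t * b x \<le> q x"
      using h le by (meson le_funD order_trans)
    then have ab: "a \<le> q" "b \<le> q" using assms h unfolding face_def by blast+
    \<comment> \<open>At - x0 the tangent is at most - q x0, so the convex combination reaches at
      least q x0 at x0. Neither a nor b exceeds q x0 there and both weights are positive, hence both
      reach it.\<close>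
    have "(1 - t) * a (- x0) + t * b (- x0) \<le> - q x0"
      using h tangent_minus[OF q(1), of x0] by (meson order_trans)
    then have *: "q x0 \<le> (1 - t) * a x0 + t * b x0"
      using h linear_functional_simps(4)[of m a x0] linear_functional_simps(4)[of m b x0] by simp
    have ax: "a x0 \<le> q x0" and bx: "b x0 \<le> q x0" using ab by (simp_all add: le_fun_def)
    have "t * b x0 \<le> t * q x0" using bx h by simp
    then have "(1 - t) * q x0 \<le> (1 - t) * a x0" using * by (simp add: algebra_simps)
    then have "q x0 \<le> a x0" using h by simp
    moreover have "(1 - t) * a x0 \<le> (1 - t) * q x0" using ax h by simp
    then have "t * q x0 \<le> t * b x0" using * by (simp add: algebra_simps)
    then have "q x0 \<le> b x0" using h by simp
    ultimately show "a \<le> tangent q x0" "b \<le> tangent q x0" using below ab h by blast+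
  qed
qed

lemma face_bdd:
  assumes "\<And>q. q \<in> C \<Longrightarrow> face p q"
  shows "bdd_below ((\<lambda>q. q x) ` C)"
proof (rule bdd_belowI2[of _ "- p (- x)"])
  fix q assume "q \<in> C"
  then have "sublinear m q" "q (- x) \<le> p (- x)" using assms by (auto simp: face_def le_fun_def)
  then show "- p (- x) \<le> q x" using sublinear_minus_le[of q x] by simp
qed

text \<open>This is the intersection of a chain of faces. The chain condition lets the smaller of
  two members serve in the subadditivity estimate, so the infimum is again sublinear.\<close>

lemma face_INF:
  assumes ne: "C \<noteq> {}" and f: "\<And>q. q \<in> C \<Longrightarrow> face p q"
    and chain: "\<And>q r. q \<in> C \<Longrightarrow> r \<in> C \<Longrightarrow> q \<le> r \<or> r \<le> q"
  shows "face p (\<lambda>x. INF q\<in>C. q x)"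
  unfolding face_def
proof (intro conjI allI impI)
  note bdd = face_bdd[OF f]
  note sub = f[unfolded face_def, THEN conjunct1, unfolded sublinear_def]
  show "sublinear m (\<lambda>x. INF q\<in>C. q x)"
  proof (rule sublinear_INF[OF ne bdd])
    fix q r :: "'v \<Rightarrow> real" and x y assume qr: "q \<in> C" "r \<in> C"
    consider "q \<le> r" | "r \<le> q" using chain qr by blast
    then show "\<exists>k\<in>C. k (x + y) \<le> q x + r y"
    proof cases
      case 1
      then have "q (x + y) \<le> q x + q y" "q y \<le> r y" using sub[OF qr(1)] by (auto simp: le_fun_def)
      then show ?thesis using qr by (intro bexI[of _ q]) auto
    next
      case 2
      then have "r (x + y) \<le> r x + r y" "r x \<le> q x" using sub[OF qr(2)] by (auto simp: le_fun_def)
      then show ?thesis using qr by (intro bexI[of _ r]) auto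
    qed
  qed (use sub in blast)+
  obtain q0 where q0: "q0 \<in> C" using ne by blast
  then show "(\<lambda>x. INF q\<in>C. q x) \<le> p"
    using f[OF q0] cINF_lower[OF bdd q0] by (force simp: face_def le_fun_def intro: order_trans)
  fix a b :: "'v \<Rightarrow> real" and t :: real
  assume h: "linear_functional m a \<and> linear_functional m b \<and> a \<le> p \<and> b \<le> p \<and> 0 < t \<and> t < 1 \<and>
     (\<forall>x. (1 - t) * a x + t * b x \<le> (INF q\<in>C. q x))"
  have "a \<le> q \<and> b \<le> q" if "q \<in> C" for q
  proof -
    have "\<forall>x. (1 - t) * a x + t * b x \<le> q x"
      using h cINF_lower[OF bdd that] by (meson order_trans)
    then show ?thesis using f[OF that] h unfolding face_def by blast
  qed
  then show "a \<le> (\<lambda>x. INF q\<in>C. q x)" "b \<le> (\<lambda>x. INF q\<in>C. q x)"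
    using ne by (auto simp: le_fun_def intro!: cINF_greatest)
qed

text \<open>Hahn-Banach and Krein-Milman in one application of Zorn's lemma. A minimal face is
  contained in its own tangent at every point, which makes its support function odd and therefore
  linear; the face is then a single point, and an extreme one.\<close>

theorem extreme_dominated_functional:
  assumes p: "sublinear m p"
  obtains g where "linear_functional m g" "g \<le> p" "g x0 = p x0"
    "\<And>a b t. linear_functional m a \<Longrightarrow> linear_functional m b \<Longrightarrow> a \<le> p \<Longrightarrow> b \<le> p \<Longrightarrow> 0 < t \<Longrightarrow> t < 1 \<Longrightarrow>
       (\<And>x. g x = (1 - t) * a x + t * b x) \<Longrightarrow> a = g \<and> b = g"
proof -
  have pp: "face p p" using p by (auto simp: face_def)
  \<comment> \<open>Starting below the tangent at x0, and not just below p, forces the value p x0 at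
    x0.\<close>
  define A where "A = {q. face p q \<and> q \<le> tangent p x0}"
  have A0: "tangent p x0 \<in> A" using face_tangent[OF pp] by (simp add: A_def)
  have "\<exists>g\<in>A. \<forall>q\<in>A. q \<le> g \<longrightarrow> q = g"
  proof (rule predicate_Zorn)
    show "partial_order_on A (relation_of (\<lambda>q r. r \<le> q) A)"
      by (rule partial_order_on_relation_ofI) auto
  next
    fix C assume "C \<in> Chains (relation_of (\<lambda>q r. r \<le> q) A)"
    then have C: "\<And>q. q \<in> C \<Longrightarrow> q \<in> A" "\<And>q r. q \<in> C \<Longrightarrow> r \<in> C \<Longrightarrow> q \<le> r \<or> r \<le> q"
      by (auto simp: Chains_def relation_of_def)
    show "\<exists>u\<in>A. \<forall>a\<in>C. u \<le> a"
    proof (cases "C = {}")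
      case True
      then show ?thesis using A0 by blast
    next
      case False
      then obtain q0 where q0: "q0 \<in> C" by blast
      have f: "face p q" if "q \<in> C" for q using C(1)[OF that] by (simp add: A_def)
      have low: "(\<lambda>x. INF q\<in>C. q x) \<le> q" if "q \<in> C" for q
        using cINF_lower[OF face_bdd[OF f] that] by (simp add: le_fun_def)
      have "face p (\<lambda>x. INF q\<in>C. q x)" by (rule face_INF[OF False f C(2)])
      moreover have "(\<lambda>x. INF q\<in>C. q x) \<le> tangent p x0"
        using low[OF q0] C(1)[OF q0] unfolding A_def by auto
      ultimately show ?thesis using low by (auto simp: A_def)
    qed
  qed
  then obtain g where gA: "g \<in> A" and min: "\<And>q. q \<in> A \<Longrightarrow> q \<le> g \<Longrightarrow> q = g" by blast
  have gf: "face p g" and gt: "g \<le> tangent p x0" using gA by (auto simp: A_def)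
  have gs: "sublinear m g" and gp: "g \<le> p" using gf by (auto simp: face_def)
  \<comment> \<open>Minimality makes every further tangent trivial, so g (- x) = tangent g x (- x)
    is at most - g x.\<close>
  have "tangent g x = g" for x
  proof (rule min)
    show le: "tangent g x \<le> g" by (simp add: le_fun_def tangent_le_self gs)
    show "tangent g x \<in> A" using face_tangent[OF gf] le gt by (auto simp: A_def)
  qed
  then have "g (- x) \<le> - g x" for x using tangent_minus[OF gs, of x] by simp
  then have lin: "linear_functional m g" by (rule sublinear_odd_imp_linear[OF gs])
  have "g (- x0) \<le> - p x0" using gt tangent_minus[OF p, of x0] by (meson le_funD order_trans)
  then have gx: "g x0 = p x0" using gp linear_functional_simps[OF lin] by (simp add: le_fun_def eq_iff)
  have eq: "a = g" if "linear_functional m a" "a \<le> g" for a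
  proof
    fix x
    have "a x \<le> g x" "a (- x) \<le> g (- x)" using that(2) by (auto simp: le_fun_def)
    then show "a x = g x" using linear_functional_simps[OF lin] linear_functional_simps[OF that(1)] by simp
  qed
  show ?thesis
  proof (rule that[OF lin gp gx])
    fix a b :: "'v \<Rightarrow> real" and t :: real
    assume h: "linear_functional m a" "linear_functional m b" "a \<le> p" "b \<le> p" "0 < t" "t < 1"
      "\<And>x. g x = (1 - t) * a x + t * b x"
    have "a \<le> g \<and> b \<le> g" using gf h unfolding face_def by (metis order_refl)
    then show "a = g \<and> b = g" using eq h by blast
  qed
qed

end

section \<open>Real parts of scalar-linear functionals\<close>

lemma scnj_of_real [simp]: "scnj (of_real r) = (of_real r :: 'k::real_or_complex)"
proof -
  have z: "scnj (0::'k) = 0" using scnj_add[of "0::'k" 0] by simp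
  show ?thesis
  proof (cases "r = 0")
    case False
    then show ?thesis using mult_scnj[of "of_real r :: 'k"] by (simp add: power2_eq_square)
  qed (use z in simp)
qed

lemma norm_scnj [simp]: "norm (scnj x) = norm (x :: 'k::real_or_complex)"
proof (cases "x = 0")
  case True
  then show ?thesis using scnj_of_real[of 0, where ?'k = 'k] by simp
next
  case False
  have "norm x * norm (scnj x) = (norm x)\<^sup>2"
    using arg_cong[OF mult_scnj[of x], of norm] by (simp add: norm_mult norm_power)
  then show ?thesis using False by (simp add: power2_eq_square)
qed

definition scre :: "'k::real_or_complex \<Rightarrow> real" where
  "scre x = (THE r. x + scnj x = of_real (2 * r))"

lemma scre_unique:
  fixes x :: "'k::real_or_complex"
  assumes "x + scnj x = of_real (2 * r)" shows "scre x = r"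
  unfolding scre_def
proof (rule the_equality)
  show "x + scnj x = of_real (2 * r)" by (rule assms)
next
  fix r' :: real assume "x + scnj x = of_real (2 * r')"
  then have "(of_real (2 * r') :: 'k) = of_real (2 * r)" using assms by simp
  then show "r' = r" unfolding of_real_eq_iff by simp
qed

lemma add_scnj_scre: "x + scnj x = of_real (2 * scre (x :: 'k::real_or_complex))"
proof -
  obtain t where "x + scnj x = of_real t" using add_scnj[of x] by (auto elim: Reals_cases)
  then have "x + scnj x = of_real (2 * (t / 2))" by simp
  then show ?thesis using scre_unique by metis
qed

lemma scre_of_real [simp]: "scre (of_real r :: 'k::real_or_complex) = r"
  by (rule scre_unique) simp

lemma scre_0 [simp]: "scre (0 :: 'k::real_or_complex) = 0"
  using scre_of_real[of 0, where ?'k = 'k] by simp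

lemma scre_add: "scre (x + y :: 'k::real_or_complex) = scre x + scre y"
proof (rule scre_unique)
  have "x + y + scnj (x + y) = (x + scnj x) + (y + scnj y)" by (simp add: scnj_add)
  then show "x + y + scnj (x + y) = of_real (2 * (scre x + scre y))"
    by (simp add: add_scnj_scre distrib_left)
qed

lemma scre_of_real_mult: "scre (of_real r * x :: 'k::real_or_complex) = r * scre x"
proof (rule scre_unique)
  have "of_real r * x + scnj (of_real r * x) = of_real r * (x + scnj x)"
    by (simp add: scnj_mult distrib_left)
  then show "of_real r * x + scnj (of_real r * x) = of_real (2 * (r * scre x))"
    by (simp add: add_scnj_scre mult_ac)
qed

lemma scre_minus: "scre (- x :: 'k::real_or_complex) = - scre x"
  using scre_of_real_mult[of "-1" x] by simp

lemma scre_diff: "scre (x - y :: 'k::real_or_complex) = scre x - scre y"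
  using scre_add[of x "- y"] by (simp add: scre_minus)

lemma abs_scre_le: "\<bar>scre x\<bar> \<le> norm (x :: 'k::real_or_complex)"
proof -
  have "2 * \<bar>scre x\<bar> = norm (x + scnj x)" by (simp add: add_scnj_scre norm_mult)
  also have "\<dots> \<le> norm x + norm x" using norm_triangle_ineq[of x "scnj x"] by simp
  finally show ?thesis by simp
qed

lemma unimodular_rotation:
  obtains c :: "'k::real_or_complex" where "norm c = 1" "c * z = of_real (norm z)"
proof (cases "z = 0")
  case False
  then show ?thesis
    by (intro that[of "of_real (norm z) / z"]) (simp_all add: norm_divide)
qed (use that[of 1] in simp)

definition real_linear_on :: "'b::real_normed_vector set \<Rightarrow> ('b \<Rightarrow> real) \<Rightarrow> bool" where
  "real_linear_on E g \<longleftrightarrow>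
     (\<forall>x\<in>E. \<forall>y\<in>E. g (x + y) = g x + g y) \<and> (\<forall>r. \<forall>x\<in>E. g (r *\<^sub>R x) = r * g x)"

section \<open>Scalar-linear functionals recovered from their real parts\<close>

context K_banach
begin

lemma subspace_scaleR: "subspace E \<Longrightarrow> x \<in> E \<Longrightarrow> r *\<^sub>R x \<in> E"
  using subspace_scale[of E x "of_real r"] by (simp add: scale_of_real)

text \<open>Scalar-linear functionals on a subspace, without the extensionality required by \<open>dual\<close>.\<close>

definition klinear_on :: "'a set \<Rightarrow> ('a \<Rightarrow> 'k) \<Rightarrow> bool" where
  "klinear_on E G \<longleftrightarrow>
     (\<forall>x\<in>E. \<forall>y\<in>E. G (x + y) = G x + G y) \<and> (\<forall>c. \<forall>x\<in>E. G (s c x) = c * G x)"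

lemma klinear_on_scaleR: "klinear_on E G \<Longrightarrow> x \<in> E \<Longrightarrow> G (r *\<^sub>R x) = of_real r * G x"
  unfolding klinear_on_def by (metis scale_of_real)

lemma real_linear_on_scre:
  assumes "klinear_on E G" shows "real_linear_on E (\<lambda>x. scre (G x))"
  using assms klinear_on_scaleR[OF assms]
  by (auto simp: real_linear_on_def klinear_on_def scre_add scre_of_real_mult)

text \<open>Multiplying x by a unimodular scalar turns the difference of the two values into its
  modulus, which the real parts already see.\<close>

lemma klinear_on_eqI:
  assumes G: "klinear_on E G" "klinear_on E G'" and E: "subspace E" and x: "x \<in> E"
    and eq: "\<And>x. x \<in> E \<Longrightarrow> scre (G x) = scre (G' x)"
  shows "G x = G' x"
proof -
  obtain c :: 'k where c: "norm c = 1" "c * (G x - G' x) = of_real (norm (G x - G' x))"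
    using unimodular_rotation .
  have "s c x \<in> E" using E x by (rule subspace_scale)
  have "scre (c * (G x - G' x)) = scre (G (s c x)) - scre (G' (s c x))"
    using G x by (simp add: klinear_on_def right_diff_distrib scre_diff)
  also have "\<dots> = 0" using eq[OF \<open>s c x \<in> E\<close>] by simp
  finally show ?thesis using c by simp
qed

lemma klinear_on_norm_le:
  assumes G: "klinear_on E G" and E: "subspace E" and x: "x \<in> E"
    and le: "\<And>x. x \<in> E \<Longrightarrow> scre (G x) \<le> C * norm x"
  shows "norm (G x) \<le> C * norm x"
proof -
  obtain c :: 'k where c: "norm c = 1" "c * G x = of_real (norm (G x))"
    using unimodular_rotation .
  have "s c x \<in> E" using E x by (rule subspace_scale)
  have "norm (G x) = scre (G (s c x))" using c G x by (simp add: klinear_on_def)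
  also have "\<dots> \<le> C * norm (s c x)" by (rule le[OF \<open>s c x \<in> E\<close>])
  finally show ?thesis by (simp add: norm_scale c)
qed

text \<open>Over the complex scalars the lift is G x = g x - i g(i x); over the reals it is g
  itself.\<close>

lemma klift_exists:
  assumes E: "subspace E" and g: "real_linear_on E g"
  shows "\<exists>G. klinear_on E G \<and> (\<forall>x\<in>E. scre (G x) = g x)"
proof -
  have add: "g (x + y) = g x + g y" if "x \<in> E" "y \<in> E" for x y
    using g that by (simp add: real_linear_on_def)
  have hom: "g (r *\<^sub>R x) = r * g x" if "x \<in> E" for r x
    using g that by (simp add: real_linear_on_def)
  have sE: "s c x \<in> E" if "x \<in> E" for c x using E that by (rule subspace_scale)
  note sR = subspace_scaleR[OF E]
  consider (real) "\<forall>x::'k. x \<in> \<real> \<and> scnj x = x" |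
    (cplx) i :: 'k where "i * i = -1"
      "\<And>x. \<exists>a b. x = of_real a + of_real b * i \<and> scnj x = of_real a - of_real b * i"
    using scalar_cases[where 'k = 'k] by blast
  then show ?thesis
  proof cases
    case real
    have "klinear_on E (\<lambda>x. of_real (g x))"
      unfolding klinear_on_def
    proof (intro conjI ballI allI)
      fix c :: 'k and x assume "x \<in> E"
      moreover obtain r where "c = of_real r" using real by (auto elim: Reals_cases)
      ultimately show "(of_real (g (s c x)) :: 'k) = c * of_real (g x)"
        by (simp add: scale_of_real hom)
    qed (simp add: add)
    then show ?thesis by (intro exI[of _ "\<lambda>x. of_real (g x)"]) simp
  next
    case cplx
    \<comment> \<open>The scalar i must have conjugate - i: its own representation p + q i forces q
      = 1 and p = 0, because i has square -1 and so is not real.\<close>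
    have re: "scre (of_real a + of_real b * i) = a" for a b
    proof -
      obtain p q where pq: "i = of_real p + of_real q * i" "scnj i = of_real p - of_real q * i"
        using cplx(2)[of i] by blast
      have nr: "i \<noteq> of_real t" for t
      proof
        assume "i = of_real t"
        then have "(of_real (t * t) :: 'k) = of_real (-1)" using cplx(1) by simp
        then have "t * t = -1" unfolding of_real_eq_iff .
        then show False by (smt (verit) zero_le_square)
      qed
      have "of_real (1 - q) * i = of_real p" using pq(1) by (simp add: algebra_simps)
      have "q = 1"
      proof (rule ccontr)
        assume "q \<noteq> 1"
        then have "i = of_real (p / (1 - q))"
          using \<open>of_real (1 - q) * i = of_real p\<close> by (simp add: field_simps)
        then show False using nr by blast
      qed
      then have "p = 0" using pq(1) by simp
      then have "scnj i = - i" using pq(2) \<open>q = 1\<close> by simp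
      then show ?thesis by (intro scre_unique) (simp add: scnj_add scnj_mult)
    qed
    define G :: "'a \<Rightarrow> 'k" where "G x = of_real (g x) - of_real (g (s i x)) * i" for x
    have sii: "s i (s i x) = - x" for x using cplx(1) by (simp add: scale_minus_left)
    have Gadd: "G (x + y) = G x + G y" if "x \<in> E" "y \<in> E" for x y
      using that by (simp add: G_def scale_right_distrib add sE algebra_simps)
    have GR: "G (r *\<^sub>R x) = of_real r * G x" if "x \<in> E" for r x
    proof -
      have "s i (r *\<^sub>R x) = r *\<^sub>R s i x"
        by (simp add: scale_of_real[symmetric] mult.commute)
      then show ?thesis using that by (simp add: G_def hom sE algebra_simps)
    qed
    have Gi: "G (s i x) = i * G x" if "x \<in> E" for x
    proof -
      have "g (- x) = - g x" using hom[OF that, of "-1"] by simp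
      then have "G (s i x) = of_real (g (s i x)) + of_real (g x) * i"
        by (simp add: G_def sii del: scale_scale)
      also have "\<dots> = i * G x"
      proof -
        have "i * G x = of_real (g x) * i - of_real (g (s i x)) * (i * i)"
          by (simp add: G_def algebra_simps)
        then show ?thesis by (simp add: cplx(1))
      qed
      finally show ?thesis .
    qed
    have "klinear_on E G"
      unfolding klinear_on_def
    proof (intro conjI ballI allI)
      fix c :: 'k and x assume x: "x \<in> E"
      obtain a b where c: "c = of_real a + of_real b * i" using cplx(2) by blast
      have "s c x = a *\<^sub>R x + b *\<^sub>R s i x"
        by (simp add: c scale_left_distrib scale_of_real[symmetric])
      then have "G (s c x) = of_real a * G x + of_real b * (i * G x)"
        using x by (simp add: Gadd GR sR sE Gi)
      then show "G (s c x) = c * G x" by (simp add: c algebra_simps)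
    qed (use Gadd in simp)
    moreover have "scre (G x) = g x" for x
      using re[of "g x" "- g (s i x)"] by (simp add: G_def)
    ultimately show ?thesis by blast
  qed
qed

text \<open>Values outside \<open>E\<close> are arbitrary, so for a proper subspace the lift has to
  be restricted before it is an element of \<open>dual\<close>.\<close>

definition klift :: "'a set \<Rightarrow> ('a \<Rightarrow> real) \<Rightarrow> 'a \<Rightarrow> 'k" where
  "klift E g = (SOME G. klinear_on E G \<and> (\<forall>x\<in>E. scre (G x) = g x))"

lemma klift:
  assumes "subspace E" "real_linear_on E g"
  shows klinear_on_klift: "klinear_on E (klift E g)"
    and scre_klift: "x \<in> E \<Longrightarrow> scre (klift E g x) = g x"
  using someI_ex[OF klift_exists[OF assms]] unfolding klift_def by blast+

lemma klift_eqI: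
  assumes "subspace E" "real_linear_on E g" "klinear_on E G" "x \<in> E"
    and "\<And>x. x \<in> E \<Longrightarrow> scre (G x) = g x"
  shows "klift E g x = G x"
  by (rule klinear_on_eqI[OF klinear_on_klift[OF assms(1,2)] assms(3,1,4)])
    (simp add: scre_klift assms)

end

section \<open>Extreme points of the dual ball\<close>

context K_banach
begin

section \<open>The unit ball of the dual of a subspace\<close>

lemma dual_carr:
  "f \<in> carr (dual (subsp s E)) \<longleftrightarrow>
     f \<in> extensional E \<and> klinear_on E f \<and> (\<exists>B. \<forall>x\<in>E. norm (f x) \<le> B * norm x)"
  by (auto simp: dual_def subsp_def linear_map_def klinear_on_def)

lemma vnorm_dual: "vnorm (dual (subsp s E)) f = (SUP x\<in>{x\<in>E. norm x \<le> 1}. norm (f x))"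
  by (simp add: dual_def subsp_def unit_ball_def)

lemma vnorm_dual_le:
  assumes "subspace E" "0 \<le> C" "\<And>x. x \<in> E \<Longrightarrow> norm (f x) \<le> C * norm x"
  shows "vnorm (dual (subsp s E)) f \<le> C"
  unfolding vnorm_dual
proof (rule cSUP_least)
  show "{x \<in> E. norm x \<le> 1} \<noteq> {}" using subspace_0[OF assms(1)] by force
  fix x assume "x \<in> {x \<in> E. norm x \<le> 1}"
  then have "norm (f x) \<le> C * norm x" "C * norm x \<le> C * 1"
    using assms mult_left_mono[of "norm x" 1 C] by auto
  then show "norm (f x) \<le> C" by simp
qed

lemma vnorm_dual_bdd:
  assumes "f \<in> carr (dual (subsp s E))"
  shows "bdd_above ((\<lambda>x. norm (f x)) ` {x\<in>E. norm x \<le> 1})"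
proof -
  obtain B where B: "\<And>x. x \<in> E \<Longrightarrow> norm (f x) \<le> B * norm x" using assms by (auto simp: dual_carr)
  have "norm (f x) \<le> \<bar>B\<bar>" if "x \<in> E" "norm x \<le> 1" for x
  proof -
    have "norm (f x) \<le> \<bar>B\<bar> * norm x" using B[OF that(1)] by (smt (verit) mult_right_mono norm_ge_zero)
    also have "\<dots> \<le> \<bar>B\<bar> * 1" using that by (intro mult_left_mono) auto
    finally show ?thesis by simp
  qed
  then show ?thesis by (intro bdd_aboveI2) auto
qed

lemma norm_le_vnorm_dual:
  assumes E: "subspace E" and f: "f \<in> carr (dual (subsp s E))" and x: "x \<in> E"
  shows "norm (f x) \<le> vnorm (dual (subsp s E)) f * norm x"
proof (cases "x = 0")
  case True
  have "klinear_on E f" using f by (simp add: dual_carr)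
  then have "f (0 *\<^sub>R x) = of_real 0 * f x" using klinear_on_scaleR x by blast
  then show ?thesis using True by simp
next
  case False
  have lin: "klinear_on E f" using f by (simp add: dual_carr)
  have "norm (f (inverse (norm x) *\<^sub>R x)) \<le> vnorm (dual (subsp s E)) f"
    unfolding vnorm_dual
    by (rule cSUP_upper[OF _ vnorm_dual_bdd[OF f]]) (use False x subspace_scaleR[OF E] in auto)
  also have "norm (f (inverse (norm x) *\<^sub>R x)) = norm (f x) / norm x"
    by (simp add: klinear_on_scaleR[OF lin x] norm_mult divide_inverse mult.commute norm_inverse)
  finally show ?thesis using False by (simp add: field_simps)
qed

lemma unit_ball_dual:
  assumes E: "subspace E"
  shows "f \<in> unit_ball (dual (subsp s E)) \<longleftrightarrow>
     f \<in> extensional E \<and> klinear_on E f \<and> (\<forall>x\<in>E. norm (f x) \<le> norm x)" (is "?l \<longleftrightarrow> ?r")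
proof
  assume l: ?l
  then have c: "f \<in> carr (dual (subsp s E))" "vnorm (dual (subsp s E)) f \<le> 1"
    by (auto simp: unit_ball_def)
  have "norm (f x) \<le> norm x" if "x \<in> E" for x
  proof -
    have "norm (f x) \<le> vnorm (dual (subsp s E)) f * norm x"
      by (rule norm_le_vnorm_dual[OF E c(1) that])
    also have "\<dots> \<le> 1 * norm x" using c(2) by (intro mult_right_mono) auto
    finally show ?thesis by simp
  qed
  then show ?r using c(1) by (auto simp: dual_carr)
next
  assume r: ?r
  then have "f \<in> carr (dual (subsp s E))" by (auto simp: dual_carr intro!: exI[of _ 1])
  moreover have "vnorm (dual (subsp s E)) f \<le> 1" by (rule vnorm_dual_le[OF E]) (use r in auto)
  ultimately show ?l by (simp add: unit_ball_def)
qed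

lemma unit_ball_dual_whole:
  "f \<in> unit_ball (dual (whole s)) \<longleftrightarrow> klinear_on UNIV f \<and> (\<forall>x. norm (f x) \<le> norm x)"
  by (simp add: unit_ball_dual)

lemma dual_whole_convex_combination:
  "vadd (dual (whole s)) (vscale (dual (whole s)) c a) (vscale (dual (whole s)) d b) =
     (\<lambda>x. c * a x + d * b x)"
  by (simp add: dual_def subsp_def restrict_def)

lemma real_linear_on_UNIV: "real_linear_on UNIV g \<longleftrightarrow> linear_functional (*\<^sub>R) g"
  by (auto simp: real_linear_on_def linear_functional_def)

text \<open>Take an extreme real functional g dominated by the norm with g y = norm y, and lift it.
  If the lift is an inner point of a segment in the dual ball, the real parts of the endpoints are
  dominated by the norm and average to g, so both equal g and the endpoints agree.\<close>

lemma extreme_norming_functional: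
  "\<exists>p\<in>ext_dual_ball (whole s). scre (p y) = norm y"
proof -
  interpret R: real_vector_space "(*\<^sub>R) :: real \<Rightarrow> 'a \<Rightarrow> 'a"
    by (simp add: real_vector_space_def real_vector.vector_space_axioms)
  have "sublinear (*\<^sub>R) (norm :: 'a \<Rightarrow> real)"
    by (simp add: sublinear_def norm_triangle_ineq)
  then obtain g where g: "linear_functional (*\<^sub>R) g" "g \<le> norm" "g y = norm y"
    and ext: "\<And>a b t. linear_functional (*\<^sub>R) a \<Longrightarrow> linear_functional (*\<^sub>R) b \<Longrightarrow> a \<le> norm \<Longrightarrow>
      b \<le> norm \<Longrightarrow> 0 < t \<Longrightarrow> t < 1 \<Longrightarrow> (\<And>x. g x = (1 - t) * a x + t * b x) \<Longrightarrow> a = g \<and> b = g"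
    using R.extreme_dominated_functional by blast
  have gl: "real_linear_on UNIV g" using g(1) by (simp add: real_linear_on_UNIV)
  define p where "p = klift UNIV g"
  have pl: "klinear_on UNIV p" and pre: "scre (p x) = g x" for x
    using klinear_on_klift[OF subspace_UNIV gl] scre_klift[OF subspace_UNIV gl] by (auto simp: p_def)
  have "norm (p x) \<le> 1 * norm x" for x
    by (rule klinear_on_norm_le[OF pl subspace_UNIV]) (use g(2) in \<open>auto simp: pre le_fun_def\<close>)
  then have pb: "p \<in> unit_ball (dual (whole s))" using pl by (simp add: unit_ball_dual_whole)
  have "p \<in> ext_dual_ball (whole s)"
    unfolding ext_points_def mem_Collect_eq dual_whole_convex_combination
  proof (intro conjI ballI allI impI pb)
    fix a b t
    assume a: "a \<in> unit_ball (dual (whole s))" and b: "b \<in> unit_ball (dual (whole s))"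
      and h: "0 < t \<and> t < 1 \<and> p = (\<lambda>x. of_real (1 - t) * a x + of_real t * b x)"
    have *: "linear_functional (*\<^sub>R) (\<lambda>x. scre (f x))" "(\<lambda>x. scre (f x)) \<le> norm"
      if "f \<in> unit_ball (dual (whole s))" for f
    proof -
      have f: "klinear_on UNIV f" "norm (f x) \<le> norm x" for x
        using that by (auto simp: unit_ball_dual_whole)
      show "linear_functional (*\<^sub>R) (\<lambda>x. scre (f x))"
        using real_linear_on_scre[OF f(1)] by (simp add: real_linear_on_UNIV)
      have "scre (f x) \<le> norm x" for x using abs_scre_le[of "f x"] f(2)[of x] by linarith
      then show "(\<lambda>x. scre (f x)) \<le> norm" by (simp add: le_fun_def)
    qed
    have "g x = (1 - t) * scre (a x) + t * scre (b x)" for x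
      using h pre[of x] by (simp only: scre_add scre_of_real_mult)
    then have "(\<lambda>x. scre (a x)) = g \<and> (\<lambda>x. scre (b x)) = g"
      using ext[OF *(1)[OF a] *(1)[OF b] *(2)[OF a] *(2)[OF b], of t] h by blast
    then have "scre (a x) = scre (b x)" for x by metis
    then show "a = b"
      using klinear_on_eqI[of UNIV a b] a b by (auto simp: unit_ball_dual_whole)
  qed
  then show ?thesis using pre[of y] g(3) by (intro bexI[of _ p]) simp_all
qed

text \<open>The zero functional is extreme exactly when the space is trivial; there it would
  have every scalar as an eigenvalue.\<close>

definition ext_fun :: "('a \<Rightarrow> 'k) set" where
  "ext_fun = {p \<in> ext_dual_ball (whole s). \<exists>y. p y \<noteq> 0}"

lemma
  assumes "p \<in> ext_fun"
  shows ext_fun_add: "p (x + y) = p x + p y"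
    and ext_fun_scale: "p (s c x) = c * p x"
    and ext_fun_scaleR: "p (r *\<^sub>R x) = of_real r * p x"
    and ext_fun_le: "norm (p x) \<le> norm x"
    and ext_fun_diff: "p (x - y) = p x - p y"
    and ext_fun_0: "p 0 = 0"
proof -
  have p: "klinear_on UNIV p" "\<And>x. norm (p x) \<le> norm x"
    using assms unit_ball_dual_whole by (auto simp: ext_fun_def ext_points_def)
  show add: "p (x + y) = p x + p y" for x y using p(1) by (simp add: klinear_on_def)
  show "p (s c x) = c * p x" using p(1) by (simp add: klinear_on_def)
  show sR: "p (r *\<^sub>R x) = of_real r * p x" for r x using klinear_on_scaleR[OF p(1)] by simp
  show "norm (p x) \<le> norm x" by (rule p(2))
  show "p (x - y) = p x - p y" using add[of x "-1 *\<^sub>R y"] sR[of "-1" y] by simp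
  show "p 0 = 0" using sR[of 0 0] by simp
qed

lemma ext_fun_sum:
  assumes "p \<in> ext_fun" shows "p (\<Sum>i\<in>I. f i) = (\<Sum>i\<in>I. p (f i))"
  by (induction I rule: infinite_finite_induct) (simp_all add: ext_fun_0 ext_fun_add assms)

text \<open>Norm estimates become scalar estimates at each extreme functional, where a multiplier is
  multiplication by a number.\<close>

lemma norm_le_ext_fun:
  assumes "0 \<le> C" "\<And>p. p \<in> ext_fun \<Longrightarrow> norm (p y) \<le> C"
  shows "norm y \<le> C"
proof (cases "y = 0")
  case False
  obtain p where p: "p \<in> ext_dual_ball (whole s)" "scre (p y) = norm y"
    using extreme_norming_functional by blast
  then have "p y \<noteq> 0" using False by auto
  then have "norm (p y) \<le> C" using p assms(2) by (auto simp: ext_fun_def)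
  then show ?thesis using p(2) abs_scre_le[of "p y"] by simp
qed (use assms in simp)

lemma ext_fun_eqI:
  assumes "\<And>p. p \<in> ext_fun \<Longrightarrow> p x = p y" shows "x = y"
  using norm_le_ext_fun[of 0 "x - y"] assms by (simp add: ext_fun_diff)

text \<open>A nonzero extreme functional has norm one: if its norm c were smaller, it would lie
  strictly between 0 and p / c.\<close>

lemma ext_fun_norm:
  assumes p: "p \<in> ext_fun" and e: "e < 1"
  obtains u where "norm u < 1" "e < norm (p u)"
proof -
  define c where "c = vnorm (dual (whole s)) p"
  have pb: "p \<in> unit_ball (dual (whole s))" using p by (simp add: ext_fun_def ext_points_def)
  then have pc: "p \<in> carr (dual (whole s))" and c1: "c \<le> 1" by (auto simp: unit_ball_def c_def)
  have pl: "klinear_on UNIV p" using pb by (simp add: unit_ball_dual_whole)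
  have pc_le: "norm (p x) \<le> c * norm x" for x
    using norm_le_vnorm_dual[OF subspace_UNIV pc] by (simp add: c_def)
  obtain y where y: "p y \<noteq> 0" using p by (auto simp: ext_fun_def)
  have c0: "c > 0" using pc_le[of y] y
    by (smt (verit) mult_nonneg_nonneg mult_nonpos_nonneg norm_ge_zero zero_less_norm_iff)
  have "c = 1"
  proof (rule ccontr)
    assume "c \<noteq> 1"
    then have "c < 1" using c1 by simp
    have z: "(\<lambda>_. 0) \<in> unit_ball (dual (whole s))"
      by (simp add: unit_ball_dual_whole klinear_on_def)
    have q: "(\<lambda>x. p x / of_real c) \<in> unit_ball (dual (whole s))"
      unfolding unit_ball_dual_whole
    proof (intro conjI allI)
      show "klinear_on UNIV (\<lambda>x. p x / of_real c)"
        using pl by (simp add: klinear_on_def add_divide_distrib)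
      show "norm (p x / of_real c) \<le> norm x" for x
        using pc_le[of x] c0 by (simp add: norm_divide divide_le_eq mult.commute)
    qed
    have "p = (\<lambda>x. of_real (1 - c) * 0 + of_real c * (p x / of_real c))" using c0 by simp
    then have "(\<lambda>_. 0) = (\<lambda>x. p x / of_real c)"
      using p z q c0 \<open>c < 1\<close> unfolding ext_fun_def ext_points_def mem_Collect_eq
        dual_whole_convex_combination by (elim conjE) (drule bspec[OF _ z], drule bspec[OF _ q], blast)
    then have "p y / of_real c = 0" by metis
    then show False using y c0 by simp
  qed
  \<comment> \<open>A vector v of the closed ball with \<open>e' < norm (p v)\<close> is shrunk by d
    / e' < 1 into the open ball and still has value above d. The maximum with 1/2 keeps the factor
    positive when e is negative.\<close>
  define e' where "e' = (1 + max e (1/2)) / 2"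
  define d where "d = max e (1/2)"
  have d: "0 < d" "d < e'" "e' < 1" "e \<le> d" using e by (auto simp: d_def e'_def max_def field_simps)
  have "e' < (SUP x\<in>{x \<in> UNIV. norm x \<le> 1}. norm (p x))"
    using \<open>c = 1\<close> d unfolding c_def vnorm_dual by simp
  moreover have "{x \<in> UNIV. norm (x :: 'a) \<le> 1} \<noteq> {}"
    using norm_zero[where 'a = 'a] by (metis (mono_tags, lifting) UNIV_I empty_Collect_eq zero_le_one)
  ultimately obtain v where v: "norm v \<le> 1" "e' < norm (p v)"
    using less_cSUP_iff[OF _ vnorm_dual_bdd[OF pc], of e'] by auto
  define u where "u = (d / e') *\<^sub>R v"
  have "norm u = d / e' * norm v" using d by (simp add: u_def)
  also have "\<dots> \<le> d / e' * 1" using d v by (intro mult_left_mono) auto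
  also have "\<dots> < 1" using d by simp
  finally have u1: "norm u < 1" .
  have "norm (p u) = d / e' * norm (p v)"
    using d by (simp add: u_def ext_fun_scaleR[OF p] norm_mult norm_divide)
  moreover have "d / e' * e' < d / e' * norm (p v)"
    using d v by (intro mult_strict_left_mono) auto
  ultimately have "e < norm (p u)" using d by simp
  with u1 show ?thesis by (rule that)
qed

end

section \<open>Real multipliers and almost partitions of unity\<close>

text \<open>Tents of height one whose radius is half the least distance between points have disjoint
  supports.\<close>

lemma partition_of_unity_at_points:
  assumes "finite (V :: real set)"
  obtains h :: "real \<Rightarrow> real \<Rightarrow> real" where
    "\<And>v. continuous_on UNIV (h v)" "\<And>v t. 0 \<le> h v t" "\<And>v. h v v = 1" "\<And>t. (\<Sum>v\<in>V. h v t) \<le> 1"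
proof -
  \<comment> \<open>The extra element 1 keeps the set nonempty when there are fewer than two
    points.\<close>
  define D where "D = insert 1 {\<bar>v - w\<bar> | v w. v \<in> V \<and> w \<in> V \<and> v \<noteq> w}"
  have "{\<bar>v - w\<bar> | v w. v \<in> V \<and> w \<in> V \<and> v \<noteq> w} \<subseteq> (\<lambda>(v, w). \<bar>v - w\<bar>) ` (V \<times> V)" by auto
  then have fin: "finite D"
    unfolding D_def using assms by (meson finite_SigmaI finite_imageI finite_insert finite_subset)
  define d where "d = Min D"
  have dpos: "0 < d" unfolding d_def using fin by (subst Min_gr_iff) (auto simp: D_def)
  have d: "d \<le> \<bar>v - w\<bar>" if "v \<in> V" "w \<in> V" "v \<noteq> w" for v w
    unfolding d_def using fin that by (intro Min_le) (auto simp: D_def)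
  define h where "h v t = max 0 (1 - \<bar>t - v\<bar> * (2 / d))" for v t :: real
  have h1: "h v t \<le> 1" for v t using dpos by (simp add: h_def)
  have near: "\<bar>t - v\<bar> < d / 2" if "0 < h v t" for v t
  proof -
    have "\<bar>t - v\<bar> * (2 / d) < 1" using that unfolding h_def less_max_iff_disj by simp
    then show ?thesis using dpos by (simp add: field_simps)
  qed
  have "(\<Sum>v\<in>V. h v t) \<le> 1" for t
  proof (cases "\<exists>v\<in>V. 0 < h v t")
    case True
    then obtain v where v: "v \<in> V" "0 < h v t" by blast
    have "h w t = 0" if "w \<in> V - {v}" for w
    proof (rule ccontr)
      assume "h w t \<noteq> 0"
      moreover have "0 \<le> h w t" by (simp add: h_def)
      ultimately have "0 < h w t" by simp
      then have "\<bar>v - w\<bar> < d" using near[OF v(2)] near[of w t] by linarith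
      then show False using d[of v w] v that by auto
    qed
    then have "(\<Sum>v\<in>V. h v t) = h v t" using assms v by (simp add: sum.remove)
    then show ?thesis using h1 by simp
  next
    case False
    then have "(\<Sum>v\<in>V. h v t) \<le> 0" by (intro sum_nonpos) auto
    then show ?thesis by simp
  qed
  moreover have "continuous_on UNIV (h v)" for v
    unfolding h_def by (intro continuous_intros)
  moreover have "0 \<le> h v t" "h v v = 1" for v t by (auto simp: h_def)
  ultimately show ?thesis using that[of h] by blast
qed

text \<open>Lagrange interpolation, one linear factor per point. Applied to an operator with
  finitely many eigenvalues it yields the spectral idempotents.\<close>

lemma polynomial_indicator:
  assumes "finite (V :: real set)" "v \<notin> V"
  shows "\<exists>q. real_polynomial_function q \<and> q v = 1 \<and> (\<forall>w\<in>V. q w = 0)"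
  using assms
proof (induction V)
  case empty
  show ?case by (intro exI[of _ "\<lambda>_. 1"]) auto
next
  case (insert w V)
  then obtain q where q: "real_polynomial_function q" "q v = 1" "\<forall>w\<in>V. q w = 0" by auto
  have "real_polynomial_function (\<lambda>t. (t + - w) * (1 / (v - w)))"
    by (intro real_polynomial_function.intros bounded_linear_ident)
  then have "real_polynomial_function (\<lambda>t. q t * ((t + - w) * (1 / (v - w))))"
    using q(1) by (rule real_polynomial_function.intros(4)[rotated])
  then show ?case using q insert.prems insert.hyps
    by (intro exI[of _ "\<lambda>t. q t * ((t + - w) * (1 / (v - w)))"]) auto
qed

lemma sum_fun_apply: "(\<Sum>i\<in>A. f i) x = (\<Sum>i\<in>A. f i x)"
  for f :: "'i \<Rightarrow> 'a \<Rightarrow> 'b::comm_monoid_add"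
  by (induction A rule: infinite_finite_induct) auto

section \<open>Operators that are diagonal on the extreme functionals\<close>

context K_banach
begin

text \<open>These are the multipliers with real eigenvalues, described through their action alone;
  by \<open>ext_fun_eqI\<close> the function a on \<open>ext_fun\<close> determines T.\<close>

definition acts_by :: "('a \<Rightarrow> 'a) \<Rightarrow> (('a \<Rightarrow> 'k) \<Rightarrow> real) \<Rightarrow> bool" where
  "acts_by T a \<longleftrightarrow> (\<forall>p\<in>ext_fun. \<forall>y. p (T y) = of_real (a p) * p y)"

text \<open>Polynomial functional calculus: sums of functions come from sums of operators, and
  products from compositions.\<close>

lemma acts_by_polynomial:
  assumes "acts_by T a" "real_polynomial_function q"
  shows "\<exists>Q. acts_by Q (\<lambda>p. q (a p))"
  using assms(2)
proof (induction q)
  case (linear f)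
  then obtain c where "f = (\<lambda>x. x * c)" using real_bounded_linear by blast
  then have "acts_by (\<lambda>y. c *\<^sub>R T y) (\<lambda>p. f (a p))"
    using assms(1) by (simp add: acts_by_def ext_fun_scaleR)
  then show ?case by blast
next
  case (const c)
  have "acts_by (\<lambda>y. c *\<^sub>R y) (\<lambda>p. c)" by (simp add: acts_by_def ext_fun_scaleR)
  then show ?case by blast
next
  case (add f g)
  then obtain F G where "acts_by F (\<lambda>p. f (a p))" "acts_by G (\<lambda>p. g (a p))" by blast
  then have "acts_by (\<lambda>y. F y + G y) (\<lambda>p. f (a p) + g (a p))"
    by (simp add: acts_by_def ext_fun_add distrib_right)
  then show ?case by blast
next
  case (mult f g)
  then obtain F G where "acts_by F (\<lambda>p. f (a p))" "acts_by G (\<lambda>p. g (a p))" by blast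
  then have "acts_by (\<lambda>y. F (G y)) (\<lambda>p. f (a p) * g (a p))"
    by (simp add: acts_by_def mult.assoc)
  then show ?case by blast
qed

text \<open>The bound confines the eigenvalues to a compact interval, on which continuous functions
  can be approximated by polynomials.\<close>

definition bounded_action :: "('a \<Rightarrow> 'a) \<Rightarrow> (('a \<Rightarrow> 'k) \<Rightarrow> real) \<Rightarrow> bool" where
  "bounded_action T a \<longleftrightarrow> acts_by T a \<and> (\<exists>R. \<forall>p\<in>ext_fun. \<bar>a p\<bar> \<le> R)"

lemma bounded_action_add_scaled:
  assumes "bounded_action T a" "bounded_action S b"
  shows "bounded_action (\<lambda>y. T y + r *\<^sub>R S y) (\<lambda>p. a p + r * b p)"
proof -
  obtain R R' where R: "\<And>p. p \<in> ext_fun \<Longrightarrow> \<bar>a p\<bar> \<le> R" "\<And>p. p \<in> ext_fun \<Longrightarrow> \<bar>b p\<bar> \<le> R'"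
    using assms by (auto simp: bounded_action_def)
  have "\<bar>a p + r * b p\<bar> \<le> R + \<bar>r\<bar> * R'" if "p \<in> ext_fun" for p
  proof -
    have "\<bar>r * b p\<bar> \<le> \<bar>r\<bar> * R'" using R(2)[OF that] by (simp add: abs_mult mult_left_mono)
    then show ?thesis using R(1)[OF that] by linarith
  qed
  moreover have "acts_by (\<lambda>y. T y + r *\<^sub>R S y) (\<lambda>p. a p + r * b p)"
    using assms by (simp add: bounded_action_def acts_by_def ext_fun_add ext_fun_scaleR distrib_right)
  ultimately show ?thesis by (auto simp: bounded_action_def)
qed

text \<open>If \<open>b\<close> separated two points with equal \<open>a\<close>-values, then \<open>a + r b\<close> would take more
  values than \<open>a\<close> for all but finitely many \<open>r\<close>.\<close>

lemma maximal_action_determines: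
  assumes T: "bounded_action T a" and fin: "finite (a ` ext_fun)"
    and max: "\<And>S b. bounded_action S b \<Longrightarrow> finite (b ` ext_fun) \<and> card (b ` ext_fun) \<le> card (a ` ext_fun)"
    and S: "bounded_action S b"
    and p: "p \<in> ext_fun" and q: "q \<in> ext_fun" and eq: "a p = a q"
  shows "b p = b q"
proof (rule ccontr)
  assume neq: "b p \<noteq> b q"
  \<comment> \<open>One point is chosen for each value of a, with p chosen for the value a p.
    Adjoining q, which shares this value but is separated from p by b, gives one point more than a
    has values.\<close>
  define rep where "rep v = (if v = a p then p else (SOME x. x \<in> ext_fun \<and> a x = v))" for v
  have rep: "rep v \<in> ext_fun" "a (rep v) = v" if "v \<in> a ` ext_fun" for v
  proof -
    have "\<exists>x. x \<in> ext_fun \<and> a x = v" using that by blast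
    then have "(SOME x. x \<in> ext_fun \<and> a x = v) \<in> ext_fun \<and> a (SOME x. x \<in> ext_fun \<and> a x = v) = v"
      by (rule someI_ex)
    then show "rep v \<in> ext_fun" "a (rep v) = v" using p by (auto simp: rep_def)
  qed
  define F where "F = insert q (rep ` a ` ext_fun)"
  have inj: "inj_on rep (a ` ext_fun)" using rep(2) by (metis inj_onI)
  have qn: "q \<notin> rep ` a ` ext_fun"
  proof
    assume "q \<in> rep ` a ` ext_fun"
    then obtain v where v: "v \<in> a ` ext_fun" "q = rep v" by blast
    then have "v = a p" using rep(2) eq by simp
    then have "q = p" using v by (simp add: rep_def)
    then show False using neq by simp
  qed
  have finF: "finite F" and cardF: "card F = Suc (card (a ` ext_fun))"
    using fin qn card_image[OF inj] by (auto simp: F_def)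
  have FS: "F \<subseteq> ext_fun" using rep q by (auto simp: F_def)
  have sep: "a x \<noteq> a y \<or> b x \<noteq> b y" if "x \<in> F" "y \<in> F" "x \<noteq> y" for x y
  proof -
    have one: "a q \<noteq> a (rep v) \<or> b q \<noteq> b (rep v)" if "v \<in> a ` ext_fun" for v
      using rep(2)[OF that] eq neq by (auto simp: rep_def)
    show ?thesis
    proof (cases "x = q \<or> y = q")
      case True
      then have "y \<in> rep ` a ` ext_fun \<and> x = q \<or> x \<in> rep ` a ` ext_fun \<and> y = q"
        using that unfolding F_def by (elim insertE) simp_all
      then show ?thesis
      proof (elim disjE conjE imageE[of _ rep])
        fix v assume "y = rep v" "v \<in> a ` ext_fun" "x = q"
        then show ?thesis using one[of v] by simp
      next
        fix v assume "x = rep v" "v \<in> a ` ext_fun" "y = q"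
        then show ?thesis using one[of v] by (metis (full_types))
      qed
    next
      case False
      then have "x \<in> rep ` a ` ext_fun" "y \<in> rep ` a ` ext_fun"
        using that unfolding F_def by simp_all
      then obtain v w where "x = rep v" "y = rep w" "v \<in> a ` ext_fun" "w \<in> a ` ext_fun"
        by (elim imageE[of _ rep])
      then show ?thesis using rep(2)[of v] rep(2)[of w] that(3) by auto
    qed
  qed
  \<comment> \<open>For points of F with different b-values, these quotients are the only r at which
    a + r b can coincide. Points with equal b-values have different a-values and stay apart for
    every r.\<close>
  define D where "D = (\<lambda>(x, y). (a y - a x) / (b x - b y)) ` (F \<times> F)"
  have "finite (insert 0 D)" using finF by (simp add: D_def)
  then obtain r where r: "r \<notin> insert 0 D" using ex_new_if_finite infinite_UNIV_char_0 by blast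
  define c where "c x = a x + r * b x" for x
  have "inj_on c F"
  proof (rule inj_onI, rule ccontr)
    fix x y assume xy: "x \<in> F" "y \<in> F" "c x = c y" "x \<noteq> y"
    have e: "r * (b x - b y) = a y - a x" using xy(3) by (simp add: c_def algebra_simps)
    show False
    proof (cases "b x = b y")
      case True
      then show False using e sep[OF xy(1,2,4)] by simp
    next
      case False
      then have "r = (a y - a x) / (b x - b y)" using e by (simp add: field_simps)
      then have "r \<in> D" using xy(1,2) by (auto simp: D_def)
      then show False using r by simp
    qed
  qed
  then have "card (c ` F) = Suc (card (a ` ext_fun))" using cardF by (simp add: card_image)
  moreover have "bounded_action (\<lambda>y. T y + r *\<^sub>R S y) c"
    using bounded_action_add_scaled[OF T S] by (simp add: c_def[abs_def])
  then have "finite (c ` ext_fun)" "card (c ` ext_fun) \<le> card (a ` ext_fun)" using max by blast+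
  ultimately show False using FS card_mono[of "c ` ext_fun" "c ` F"] by (simp add: image_mono)
qed

lemma operator_module: "module (\<lambda>c (T :: 'a \<Rightarrow> 'a) y. s c (T y))"
  by (rule module.intro) (auto simp: fun_eq_iff scale_right_distrib scale_left_distrib)

text \<open>Choose a real action a with the greatest number of values. By maximality every other
  bounded action is a function of a, so each operator of the centralizer is a combination of the
  idempotents belonging to the values of a.\<close>

lemma centralizer_subset_span:
  assumes bound: "\<And>T a. bounded_action T a \<Longrightarrow> finite (a ` ext_fun) \<and> card (a ` ext_fun) \<le> N"
  shows "\<exists>B. finite B \<and> centralizer s \<subseteq> module.span (\<lambda>c T y. s c (T y)) B"
proof -
  interpret O: module "\<lambda>c (T :: 'a \<Rightarrow> 'a) y. s c (T y)" by (rule operator_module)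
  let ?P = "\<lambda>(T, a). bounded_action T a"
  have "?P (\<lambda>y. y, \<lambda>_. 1)" by (auto simp: bounded_action_def acts_by_def intro: exI[of _ 1])
  moreover have "\<forall>Ta. ?P Ta \<longrightarrow> card (snd Ta ` ext_fun) < Suc N"
    using bound by (auto simp: less_Suc_eq_le)
  ultimately obtain Ta where Ta: "?P Ta" "\<forall>Sb. ?P Sb \<longrightarrow> card (snd Sb ` ext_fun) \<le> card (snd Ta ` ext_fun)"
    using Lattices_Big.ex_has_greatest_nat[of ?P _ "\<lambda>Ta. card (snd Ta ` ext_fun)" "Suc N"] by blast
  obtain T a where Ta_eq: "Ta = (T, a)" by (cases Ta)
  have T: "bounded_action T a" using Ta(1) by (simp add: Ta_eq)
  have fin: "finite (a ` ext_fun)" using bound[OF T] by simp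
  have max: "finite (b ` ext_fun) \<and> card (b ` ext_fun) \<le> card (a ` ext_fun)" if "bounded_action S b" for S b
    using Ta(2)[rule_format, of "(S, b)"] that bound[OF that] by (simp add: Ta_eq)
  have det: "b p = b q"
    if "bounded_action S b" "p \<in> ext_fun" "q \<in> ext_fun" "a p = a q" for S b p q
    using maximal_action_determines[OF T fin _ that] max by blast
  define V where "V = a ` ext_fun"
  have "\<exists>Q. \<forall>p\<in>ext_fun. \<forall>y. p (Q y) = of_real (if a p = v then 1 else 0) * p y" if v: "v \<in> V" for v
  proof -
    obtain q where q: "real_polynomial_function q" "q v = 1" "\<forall>w\<in>V - {v}. q w = 0"
      using polynomial_indicator[of "V - {v}" v] fin by (auto simp: V_def)
    obtain Q where Q: "acts_by Q (\<lambda>p. q (a p))"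
      using acts_by_polynomial[OF _ q(1)] T unfolding bounded_action_def by blast
    have "q (a p) = (if a p = v then 1 else 0)" if "p \<in> ext_fun" for p
      using q that by (auto simp: V_def)
    then show ?thesis using Q by (intro exI[of _ Q]) (simp add: acts_by_def)
  qed
  then obtain e where e: "\<And>v p y. v \<in> V \<Longrightarrow> p \<in> ext_fun \<Longrightarrow>
      p (e v y) = of_real (if a p = v then 1 else 0) * p y" by metis
  have "T' \<in> module.span (\<lambda>c T y. s c (T y)) (e ` V)" if T': "T' \<in> centralizer s" for T'
  proof -
    obtain S' where T'm: "multiplier s T'" and S'm: "multiplier s S'"
      and ev: "\<And>p. p \<in> ext_dual_ball (whole s) \<Longrightarrow> \<exists>a. adj_eigen S' p a \<and> adj_eigen T' p (scnj a)"
      using T' by (auto simp: centralizer_def)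
    have "\<exists>\<beta>. \<forall>y. p (S' y) = \<beta> * p y \<and> p (T' y) = scnj \<beta> * p y" if "p \<in> ext_fun" for p
      using ev[of p] that by (auto simp: ext_fun_def adj_eigen_def fun_eq_iff)
    then obtain \<beta> where \<beta>: "\<And>p y. p \<in> ext_fun \<Longrightarrow> p (S' y) = \<beta> p * p y"
      "\<And>p y. p \<in> ext_fun \<Longrightarrow> p (T' y) = scnj (\<beta> p) * p y"
      by metis
    obtain M where M: "\<And>y. norm (S' y) \<le> M * norm y"
      using S'm bounded_linear.bounded by (metis multiplier_def mult.commute)
    have \<beta>_le: "norm (\<beta> p) \<le> 2 * \<bar>M\<bar>" if p: "p \<in> ext_fun" for p
    proof -
      \<comment> \<open>Testing the eigenvalue on a ball vector with value above 1/2 is the source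
        of the factor 2 in the bound.\<close>
      obtain u where u: "norm u < 1" "1/2 < norm (p u)" using ext_fun_norm[OF p, of "1/2"] by auto
      have "norm (\<beta> p) * (1/2) \<le> norm (\<beta> p) * norm (p u)" using u by (intro mult_left_mono) auto
      also have "\<dots> = norm (p (S' u))" by (simp add: \<beta>(1)[OF p] norm_mult)
      also have "\<dots> \<le> norm (S' u)" by (rule ext_fun_le[OF p])
      also have "\<dots> \<le> \<bar>M\<bar> * norm u" using M[of u] by (smt (verit) mult_right_mono norm_ge_zero)
      also have "\<dots> \<le> \<bar>M\<bar> * 1" using u by (intro mult_left_mono) auto
      finally show ?thesis by simp
    qed
    \<comment> \<open>S' and T' have conjugate eigenvalues, so this symmetric combination has the
      real eigenvalue Re(c \<beta>). Thus the maximality argument for real actions applies also to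
      complex eigenvalues.\<close>
    have act: "bounded_action (\<lambda>y. (1/2) *\<^sub>R (s c (S' y) + s (scnj c) (T' y))) (\<lambda>p. scre (c * \<beta> p))" for c
      unfolding bounded_action_def
    proof (intro conjI exI ballI)
      show "acts_by (\<lambda>y. (1/2) *\<^sub>R (s c (S' y) + s (scnj c) (T' y))) (\<lambda>p. scre (c * \<beta> p))"
        unfolding acts_by_def
      proof (intro ballI allI)
        fix p y assume p: "p \<in> ext_fun"
        have "p ((1/2) *\<^sub>R (s c (S' y) + s (scnj c) (T' y)))
            = of_real (1/2) * (c * \<beta> p + scnj (c * \<beta> p)) * p y"
          using p by (simp only: ext_fun_scaleR ext_fun_add ext_fun_scale \<beta> scnj_mult)
            (simp add: algebra_simps)
        also have "\<dots> = of_real (scre (c * \<beta> p)) * p y"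
          by (simp add: add_scnj_scre)
        finally show "p ((1/2) *\<^sub>R (s c (S' y) + s (scnj c) (T' y))) = of_real (scre (c * \<beta> p)) * p y" .
      qed
      fix p assume p: "p \<in> ext_fun"
      show "\<bar>scre (c * \<beta> p)\<bar> \<le> norm c * (2 * \<bar>M\<bar>)"
        using abs_scre_le[of "c * \<beta> p"] mult_left_mono[OF \<beta>_le[OF p], of "norm c"]
        by (simp add: norm_mult)
    qed
    have const: "\<beta> p = \<beta> q" if "p \<in> ext_fun" "q \<in> ext_fun" "a p = a q" for p q
    proof -
      \<comment> \<open>With this c a single real action decides whether the two eigenvalues are
        equal.\<close>
      obtain c where c: "norm c = 1" "c * (\<beta> p - \<beta> q) = of_real (norm (\<beta> p - \<beta> q))"
        using unimodular_rotation .
      have "scre (c * \<beta> p) = scre (c * \<beta> q)" using det[OF act that] .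
      then have "scre (c * (\<beta> p - \<beta> q)) = 0" by (simp add: right_diff_distrib scre_diff)
      then show ?thesis using c(2) by simp
    qed
    have "\<exists>g. \<forall>p\<in>ext_fun. a p = v \<longrightarrow> scnj (\<beta> p) = g" for v using const by metis
    then obtain g where g: "\<And>p. p \<in> ext_fun \<Longrightarrow> scnj (\<beta> p) = g (a p)" by metis
    have "T' y = (\<Sum>v\<in>V. s (g v) (e v y))" for y
    proof (rule ext_fun_eqI)
      fix p assume p: "p \<in> ext_fun"
      have "p (\<Sum>v\<in>V. s (g v) (e v y)) = (\<Sum>v\<in>V. if v = a p then g v * p y else 0)"
        unfolding ext_fun_sum[OF p] ext_fun_scale[OF p]
        by (rule sum.cong) (auto simp: e p)
      also have "\<dots> = g (a p) * p y" using fin p by (simp add: V_def)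
      finally show "p (T' y) = p (\<Sum>v\<in>V. s (g v) (e v y))" using \<beta>(2)[OF p] g[OF p] by simp
    qed
    then have "T' = (\<Sum>v\<in>V. (\<lambda>y. s (g v) (e v y)))" by (simp add: fun_eq_iff sum_fun_apply)
    also have "\<dots> \<in> O.span (e ` V)"
      by (intro O.span_sum O.span_scale O.span_base) simp
    finally show ?thesis .
  qed
  then show ?thesis using fin by (intro exI[of _ "e ` V"]) (auto simp: V_def)
qed

text \<open>Tents at N eigenvalues of one real multiplier are replaced by polynomials within
  \<delta>, since only polynomials can be applied to the operator. The approximants may leave [0, 1]
  slightly, so the bounds are stated for absolute values.\<close>

lemma almost_partition_of_unity:
  fixes N :: nat and \<delta> :: real
  assumes inf: "infinite_dim_centralizer s" and \<delta>: "0 < \<delta>"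
  obtains Q b p where
    "\<And>j. j < N \<Longrightarrow> acts_by (Q j) (b j)" "\<And>j. j < N \<Longrightarrow> p j \<in> ext_fun"
    "\<And>j. j < N \<Longrightarrow> 1 - \<delta> \<le> b j (p j)"
    "\<And>\<omega>. \<omega> \<in> ext_fun \<Longrightarrow> (\<Sum>j<N. \<bar>b j \<omega>\<bar>) \<le> 1 + N * \<delta>"
    "\<And>j \<omega>. j < N \<Longrightarrow> \<omega> \<in> ext_fun \<Longrightarrow> \<bar>1 - b j \<omega>\<bar> + \<bar>b j \<omega>\<bar> \<le> 1 + 2 * \<delta>"
proof -
  \<comment> \<open>If no bounded action took more than N values, the centralizer would be contained
    in a finite span.\<close>
  obtain T a where T: "bounded_action T a" and big: "infinite (a ` ext_fun) \<or> N < card (a ` ext_fun)"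
  proof -
    have "\<not> (\<forall>T a. bounded_action T a \<longrightarrow> finite (a ` ext_fun) \<and> card (a ` ext_fun) \<le> N)"
      using inf centralizer_subset_span[of N] unfolding infinite_dim_centralizer_def by blast
    then show ?thesis using that by (auto simp: not_le)
  qed
  obtain V where V: "V \<subseteq> a ` ext_fun" "finite V" "card V = N"
  proof (cases "finite (a ` ext_fun)")
    case True
    then have "N \<le> card (a ` ext_fun)" using big by simp
    then show ?thesis by (rule obtain_subset_with_card_n) (rule that)
  next
    case False
    then show ?thesis using that infinite_arbitrarily_large[OF False, of N] by blast
  qed
  obtain v where v: "bij_betw v {..<N} V" using V ex_bij_betw_nat_finite[of V] by (auto simp: atLeast0LessThan)
  have vV: "v j \<in> V" if "j < N" for j using v that by (auto simp: bij_betw_def)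
  define p where "p j = (SOME \<omega>. \<omega> \<in> ext_fun \<and> a \<omega> = v j)" for j
  have "p j \<in> ext_fun \<and> a (p j) = v j" if "j < N" for j
  proof -
    have "v j \<in> a ` ext_fun" using V(1) vV[OF that] by (rule subsetD)
    then have "\<exists>\<omega>. \<omega> \<in> ext_fun \<and> a \<omega> = v j" by (elim imageE) (simp add: exI)
    then show ?thesis unfolding p_def by (rule someI_ex)
  qed
  then have p: "\<And>j. j < N \<Longrightarrow> p j \<in> ext_fun" "\<And>j. j < N \<Longrightarrow> a (p j) = v j" by blast+
  obtain h :: "real \<Rightarrow> real \<Rightarrow> real" where h: "\<And>v. continuous_on UNIV (h v)" "\<And>v t. 0 \<le> h v t"
    "\<And>v. h v v = 1" "\<And>t. (\<Sum>v\<in>V. h v t) \<le> 1"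
    by (rule partition_of_unity_at_points[OF V(2)]) (rule that)
  have h1: "h (v j) t \<le> 1" if "j < N" for j t
  proof -
    have "h (v j) t \<le> (\<Sum>v\<in>V. h v t)" using V(2) vV[OF that] h(2) by (intro member_le_sum) auto
    then show ?thesis using h(4)[of t] by linarith
  qed
  obtain R where R: "\<And>\<omega>. \<omega> \<in> ext_fun \<Longrightarrow> \<bar>a \<omega>\<bar> \<le> R"
    using T unfolding bounded_action_def by blast
  have "\<exists>q. real_polynomial_function q \<and> (\<forall>t\<in>{-R..R}. \<bar>h v t - q t\<bar> < \<delta>)" for v
    by (rule Stone_Weierstrass_real_polynomial_function
        [OF compact_Icc continuous_on_subset[OF h(1) subset_UNIV] \<delta>, of "-R" R v]) blast
  then obtain q where q: "\<And>v. real_polynomial_function (q v)"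
    "\<And>v t. t \<in> {-R..R} \<Longrightarrow> \<bar>h v t - q v t\<bar> < \<delta>" by metis
  have "\<exists>Q. acts_by Q (\<lambda>\<omega>. q v (a \<omega>))" for v
    using acts_by_polynomial[OF _ q(1)] T unfolding bounded_action_def by blast
  then obtain Q where Q: "\<And>v. acts_by (Q v) (\<lambda>\<omega>. q v (a \<omega>))" by metis
  have close: "\<bar>h v (a \<omega>) - q v (a \<omega>)\<bar> < \<delta>" if "\<omega> \<in> ext_fun" for v \<omega>
    using q(2) R[OF that] by (auto simp: abs_le_iff)
  show ?thesis
  proof (rule that[of "\<lambda>j. Q (v j)" "\<lambda>j \<omega>. q (v j) (a \<omega>)" p])
    fix j assume j: "j < N"
    show "acts_by (Q (v j)) (\<lambda>\<omega>. q (v j) (a \<omega>))" by (rule Q)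
    show "p j \<in> ext_fun" by (rule p(1)[OF j])
    show "1 - \<delta> \<le> q (v j) (a (p j))"
      using close[OF p(1)[OF j], of "v j"] h(3)[of "v j"] by (simp add: p(2)[OF j])
    fix \<omega> assume \<omega>: "\<omega> \<in> ext_fun"
    show "\<bar>1 - q (v j) (a \<omega>)\<bar> + \<bar>q (v j) (a \<omega>)\<bar> \<le> 1 + 2 * \<delta>"
      using close[OF \<omega>, of "v j"] h1[OF j, of "a \<omega>"] h(2)[of "v j" "a \<omega>"] by linarith
  next
    fix \<omega> assume \<omega>: "\<omega> \<in> ext_fun"
    have "(\<Sum>j<N. \<bar>q (v j) (a \<omega>)\<bar>) \<le> (\<Sum>j<N. h (v j) (a \<omega>) + \<delta>)"
    proof (rule sum_mono)
      fix j
      show "\<bar>q (v j) (a \<omega>)\<bar> \<le> h (v j) (a \<omega>) + \<delta>"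
        using close[OF \<omega>, of "v j"] h(2)[of "v j" "a \<omega>"] by linarith
    qed
    also have "\<dots> = (\<Sum>v\<in>V. h v (a \<omega>)) + N * \<delta>"
      by (simp add: sum.distrib sum.reindex_bij_betw[OF v, of "\<lambda>v. h v (a \<omega>)"])
    finally show "(\<Sum>j<N. \<bar>q (v j) (a \<omega>)\<bar>) \<le> 1 + N * \<delta>" using h(4)[of "a \<omega>"] by linarith
  qed
qed

end

section \<open>Descent from the bidual\<close>

text \<open>A row of \<open>L\<close> holds the coefficients and the constant of one affine
  expression in the unknowns; \<open>W\<close> lists the unknowns with a lower norm bound. This
  common form is what can be passed from the completion to some \<open>E m\<close> and then down
  from a bidual.\<close>

definition solvable :: "'b::real_normed_vector set \<Rightarrow> 'i set \<Rightarrow> (('i \<Rightarrow> real) \<times> 'b) set \<Rightarrow> 'i set \<Rightarrow> real \<Rightarrow> bool" where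
  "solvable E I L W r \<longleftrightarrow>
     (\<exists>y. (\<forall>j\<in>I. y j \<in> E) \<and> (\<forall>(a, x)\<in>L. norm (x + (\<Sum>j\<in>I. a j *\<^sub>R y j)) < 1) \<and> (\<forall>j\<in>W. r < norm (y j)))"

text \<open>Finitely many strict inequalities survive a small change of finitely many unknowns, and
  finitely many approximants from an increasing union lie in one common member.\<close>

lemma solvable_dense:
  assumes fin: "finite I" "finite L" "finite W" and WI: "W \<subseteq> I"
    and mono: "\<And>n. E n \<subseteq> E (Suc n)" and dense: "closure (\<Union>n. E n) = UNIV"
    and sol: "solvable UNIV I L W r"
  shows "\<exists>m. solvable (E m) I L W r"
proof -
  obtain y where y: "\<And>a x. (a, x) \<in> L \<Longrightarrow> norm (x + (\<Sum>j\<in>I. a j *\<^sub>R y j)) < 1"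
    "\<And>j. j \<in> W \<Longrightarrow> r < norm (y j)"
    using sol by (auto simp: solvable_def)
  have "\<exists>f. (\<forall>n. f n \<in> (\<Union>n. E n)) \<and> f \<longlonglongrightarrow> y j" for j
    using dense closure_sequential[of "y j" "\<Union>n. E n"] by auto
  then obtain f where f: "\<And>j n. f j n \<in> (\<Union>n. E n)" "\<And>j. f j \<longlonglongrightarrow> y j" by metis
  have "\<forall>\<^sub>F n in sequentially. \<forall>l\<in>L. norm (snd l + (\<Sum>j\<in>I. fst l j *\<^sub>R f j n)) < 1"
  proof (intro eventually_ball_finite fin ballI)
    fix l assume l: "l \<in> L"
    have "(\<lambda>n. norm (snd l + (\<Sum>j\<in>I. fst l j *\<^sub>R f j n))) \<longlonglongrightarrow> norm (snd l + (\<Sum>j\<in>I. fst l j *\<^sub>R y j))"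
      by (intro tendsto_intros f)
    then show "\<forall>\<^sub>F n in sequentially. norm (snd l + (\<Sum>j\<in>I. fst l j *\<^sub>R f j n)) < 1"
      using y(1)[of "fst l" "snd l"] l by (intro order_tendstoD) auto
  qed
  moreover have "\<forall>\<^sub>F n in sequentially. \<forall>j\<in>W. r < norm (f j n)"
    by (intro eventually_ball_finite fin ballI order_tendstoD(1)[OF tendsto_norm[OF f(2)]] y(2))
  ultimately have "\<forall>\<^sub>F n in sequentially. (\<forall>l\<in>L. norm (snd l + (\<Sum>j\<in>I. fst l j *\<^sub>R f j n)) < 1) \<and>
      (\<forall>j\<in>W. r < norm (f j n))"
    by (rule eventually_conj)
  then obtain n where n: "\<forall>l\<in>L. norm (snd l + (\<Sum>j\<in>I. fst l j *\<^sub>R f j n)) < 1"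
      "\<forall>j\<in>W. r < norm (f j n)"
    using eventually_happens' sequentially_bot by blast
  have "\<forall>j. \<exists>m. f j n \<in> E m" using f(1) by blast
  then obtain m where m: "\<And>j. f j n \<in> E (m j)" by metis
  have "f j n \<in> E (Max (m ` I))" if "j \<in> I" for j
  proof -
    have "m j \<le> Max (m ` I)" using fin that by simp
    then show ?thesis using m[of j] lift_Suc_mono_le[of E, OF mono] by blast
  qed
  then have "solvable (E (Max (m ` I))) I L W r"
    unfolding solvable_def using n by (intro exI[of _ "\<lambda>j. f j n"]) auto
  then show ?thesis by blast
qed

section \<open>Separation in a finite product with the maximum norm\<close>

definition slot :: "'l \<Rightarrow> 'b::zero \<Rightarrow> 'l \<Rightarrow> 'b" where
  "slot l b = (\<lambda>l'. if l' = l then b else 0)"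

text \<open>By \<open>sep\<close> the point c has distance at least one from M in the maximum norm
  over \<open>L\<close>. A functional dominated by this distance and attaining it at c kills M; it
  splits into coordinate functionals whose norms add up to at most one, the dual of a maximum norm
  being a sum norm.\<close>

lemma helly_separation:
  fixes M :: "('l \<Rightarrow> 'b::real_normed_vector) set"
  assumes L: "finite L" and M0: "0 \<in> M" and Madd: "\<And>v w. v \<in> M \<Longrightarrow> w \<in> M \<Longrightarrow> v + w \<in> M"
    and Mscale: "\<And>r v. v \<in> M \<Longrightarrow> (\<lambda>l. r *\<^sub>R v l) \<in> M"
    and sep: "\<And>v. v \<in> M \<Longrightarrow> \<exists>l\<in>L. 1 \<le> norm (c l + v l)"
  obtains g :: "'l \<Rightarrow> 'b \<Rightarrow> real" and C :: "'l \<Rightarrow> real"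
  where "\<And>l. linear (g l)" "\<And>l b. \<bar>g l b\<bar> \<le> C l * norm b" "\<And>l. 0 \<le> C l" "(\<Sum>l\<in>L. C l) \<le> 1"
    "\<And>v. v \<in> M \<Longrightarrow> (\<Sum>l\<in>L. g l (v l)) = 0" "1 \<le> (\<Sum>l\<in>L. g l (c l))"
proof -
  define m :: "real \<Rightarrow> ('l \<Rightarrow> 'b) \<Rightarrow> 'l \<Rightarrow> 'b" where "m r v = (\<lambda>l. r *\<^sub>R v l)" for r v
  interpret V: real_vector_space m
    by unfold_locales (auto simp: m_def fun_eq_iff scaleR_add_right scaleR_add_left)
  \<comment> \<open>A seminorm only, since coordinates outside \<open>L\<close> are ignored;
    inserting 0 covers empty \<open>L\<close>.\<close>
  define \<rho> where "\<rho> v = Max (insert 0 ((\<lambda>l. norm (v l)) ` L))" for v :: "'l \<Rightarrow> 'b"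
  have fin: "finite (insert 0 ((\<lambda>l. norm (v l)) ` L))" for v :: "'l \<Rightarrow> 'b" using L by simp
  have \<rho>_le: "\<rho> v \<le> t \<longleftrightarrow> 0 \<le> t \<and> (\<forall>l\<in>L. norm (v l) \<le> t)" for v t
    unfolding \<rho>_def using Max_le_iff[OF fin] by auto
  have \<rho>_ge: "norm (v l) \<le> \<rho> v" if "l \<in> L" for v l using \<rho>_le[of v "\<rho> v"] that by blast
  have \<rho>_0: "0 \<le> \<rho> v" for v using \<rho>_le[of v "\<rho> v"] by blast
  \<comment> \<open>The distance to M in the seminorm \<rho>.\<close>
  define P where "P v = (INF w\<in>M. \<rho> (v + w))" for v
  have bdd: "bdd_below ((\<lambda>w. \<rho> (v + w)) ` M)" for v by (rule bdd_belowI2[of _ 0]) (rule \<rho>_0)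
  have P: "sublinear m P"
    unfolding P_def
  proof (rule V.sublinear_INF)
    show "M \<noteq> {}" using M0 by blast
    show "bdd_below ((\<lambda>w. \<rho> (v + w)) ` M)" for v by (rule bdd)
    show "\<exists>k\<in>M. \<rho> (v + w + k) \<le> \<rho> (v + i) + \<rho> (w + j)" if "i \<in> M" "j \<in> M" for i j v w
    proof (rule bexI[of _ "i + j"])
      show "\<rho> (v + w + (i + j)) \<le> \<rho> (v + i) + \<rho> (w + j)"
        unfolding \<rho>_le
      proof (intro conjI ballI)
        show "0 \<le> \<rho> (v + i) + \<rho> (w + j)" using \<rho>_0 by (simp add: add_nonneg_nonneg)
        fix l assume l: "l \<in> L"
        have "(v + w + (i + j)) l = (v + i) l + (w + j) l" by simp
        then show "norm ((v + w + (i + j)) l) \<le> \<rho> (v + i) + \<rho> (w + j)"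
          by (metis add_mono norm_triangle_le \<rho>_ge[OF l])
      qed
    qed (use that Madd in blast)
    show "\<exists>k\<in>M. \<rho> (m r v + k) \<le> r * \<rho> (v + i)" if "i \<in> M" "0 < r" for i r v
    proof (rule bexI[of _ "m r i"])
      show "\<rho> (m r v + m r i) \<le> r * \<rho> (v + i)"
        unfolding \<rho>_le
      proof (intro conjI ballI)
        show "0 \<le> r * \<rho> (v + i)" using \<rho>_0 that by simp
        fix l assume l: "l \<in> L"
        have "norm ((m r v + m r i) l) = r * norm ((v + i) l)"
          using that by (simp add: m_def scaleR_add_right[symmetric])
        then show "norm ((m r v + m r i) l) \<le> r * \<rho> (v + i)"
          using \<rho>_ge[OF l, of "v + i"] that by simp
      qed
    qed (use that Mscale in \<open>simp add: m_def\<close>)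
  qed
  have P_le: "P v \<le> \<rho> (v + w)" if "w \<in> M" for v w
    unfolding P_def by (rule cINF_lower[OF bdd that])
  have Pc: "1 \<le> P c"
    unfolding P_def
  proof (rule cINF_greatest)
    fix w assume "w \<in> M"
    then obtain l where "l \<in> L" "1 \<le> norm (c l + w l)" using sep by blast
    then show "1 \<le> \<rho> (c + w)" using \<rho>_ge[of l "c + w"] by simp
  qed (use M0 in blast)
  obtain G where G: "linear_functional m G" "G \<le> P" "G c = P c"
    by (rule V.extreme_dominated_functional[OF P, of c]) (rule that)
  note lin = linear_functional_simps[OF G(1)]
  have G_le: "G v \<le> \<rho> (v + w)" if "w \<in> M" for v w
    by (rule order_trans[OF le_funD[OF G(2)] P_le[OF that]])
  have G\<rho>: "G v \<le> \<rho> v" for v using G_le[OF M0, of v] by simp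
  have GM: "G v = 0" if v: "v \<in> M" for v
  proof -
    have "m (-1) v \<in> M" using Mscale[OF v, of "-1"] by (simp add: m_def)
    then have "G v \<le> \<rho> (v + m (-1) v)" by (rule G_le)
    moreover have "G (- v) \<le> \<rho> (- v + v)" by (rule G_le[OF v])
    moreover have "\<rho> (v + m (-1) v) \<le> 0" "\<rho> (- v + v) \<le> 0" by (simp_all add: \<rho>_le m_def)
    ultimately show ?thesis using lin by simp
  qed
  define g where "g l b = G (slot l b)" for l b
  have slot_add: "slot l (b + b') = slot l b + slot l b'" for l :: 'l and b b' :: 'b
    by (auto simp: slot_def fun_eq_iff)
  have slot_scale: "slot l (r *\<^sub>R b) = m r (slot l b)" for l :: 'l and r and b :: 'b
    by (auto simp: slot_def fun_eq_iff m_def)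
  have g_lin: "linear (g l)" for l
    by (rule linearI) (simp_all add: g_def slot_add slot_scale lin)
  have G_eq: "G v = (\<Sum>l\<in>L. g l (v l))" for v
  proof -
    have sumG: "G (\<Sum>l\<in>A. f l) = (\<Sum>l\<in>A. G (f l))" for A :: "'l set" and f
      by (rule Modules.additive.sum[of G, OF Modules.additive.intro[of G, OF linear_functional_simps(2)[OF G(1)]]])
    define d where "d = v - (\<Sum>l\<in>L. slot l (v l))"
    have "d l = 0" if "l \<in> L" for l
      using L that by (simp add: d_def sum_fun_apply slot_def)
    then have "\<rho> d \<le> 0" "\<rho> (- d) \<le> 0" by (simp_all add: \<rho>_le)
    then have "G d = 0" using G\<rho>[of d] G\<rho>[of "- d"] lin by simp
    then show ?thesis by (simp add: d_def lin sumG g_def)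
  qed
  have g_le: "g l b \<le> norm b" for l b
  proof -
    have "\<rho> (slot l b) \<le> norm b" by (auto simp: \<rho>_le slot_def)
    then show ?thesis using G\<rho>[of "slot l b"] by (simp add: g_def)
  qed
  define C where "C l = (SUP b\<in>cball 0 1. g l b)" for l
  have Cbdd: "bdd_above (g l ` cball 0 1)" for l
    by (rule bdd_aboveI2[of _ _ 1]) (use g_le in \<open>auto intro: order_trans\<close>)
  have C_ge: "g l b \<le> C l" if "norm b \<le> 1" for l b
    unfolding C_def by (rule cSUP_upper[OF _ Cbdd]) (use that in simp)
  have C0: "0 \<le> C l" for l using C_ge[of 0 l] linear_0[OF g_lin] by simp
  have gC1: "g l b \<le> C l * norm b" for l b
  proof (cases "b = 0")
    case False
    then have "g l (inverse (norm b) *\<^sub>R b) \<le> C l" by (intro C_ge) simp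
    then show ?thesis using False by (simp add: linear_cmul[OF g_lin] field_simps)
  qed (simp add: linear_0[OF g_lin])
  have gC: "\<bar>g l b\<bar> \<le> C l * norm b" for l b
    using gC1[of l b] gC1[of l "- b"] by (simp add: linear_neg[OF g_lin])
  have sumC: "(\<Sum>l\<in>L. C l) \<le> 1"
  proof (rule field_le_epsilon)
    fix e :: real assume e: "0 < e"
    \<comment> \<open>Almost norming vectors for all coordinates are collected into one b with
      \<rho> b at most 1. Then G b nearly equals the sum of the norms, the total loss being at most
      \<open>card L * e'\<close>.\<close>
    define e' where "e' = e / (1 + card L)"
    have e': "0 < e'" "card L * e' \<le> e" using e by (auto simp: e'_def field_simps)
    have "\<exists>b. norm b \<le> 1 \<and> C l - e' < g l b" for l
    proof -
      have "C l - e' < (SUP b\<in>cball 0 1. g l b)" using e' by (simp add: C_def)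
      then show ?thesis using less_cSUP_iff[OF _ Cbdd, of "C l - e'" l] by auto
    qed
    then obtain b where b: "\<And>l. norm (b l) \<le> 1" "\<And>l. C l - e' < g l (b l)" by metis
    have "(\<Sum>l\<in>L. C l) \<le> (\<Sum>l\<in>L. g l (b l) + e')"
      by (rule sum_mono) (use b(2) in \<open>smt (verit)\<close>)
    also have "\<dots> = G b + card L * e'" by (simp add: G_eq sum.distrib)
    also have "G b \<le> 1" using G\<rho>[of b] \<rho>_le[of b 1] b(1) by auto
    finally show "(\<Sum>l\<in>L. C l) \<le> 1 + e" using e' by simp
  qed
  show ?thesis
    by (rule that[OF g_lin gC C0 sumC]) (use GM G(3) Pc in \<open>simp_all add: G_eq\<close>)
qed

section \<open>Real duals of subspaces and descent through a bidual pairing\<close>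

definition real_dual :: "'b::real_normed_vector set \<Rightarrow> ('b \<Rightarrow> real) set" where
  "real_dual E = {g. real_linear_on E g \<and> (\<exists>C. \<forall>x\<in>E. \<bar>g x\<bar> \<le> C * norm x)}"

lemma real_dualI: "real_linear_on E g \<Longrightarrow> (\<And>x. x \<in> E \<Longrightarrow> \<bar>g x\<bar> \<le> C * norm x) \<Longrightarrow> g \<in> real_dual E"
  by (auto simp: real_dual_def)

lemma real_dual_zero: "(\<lambda>_. 0) \<in> real_dual E"
  by (rule real_dualI[of _ _ 0]) (simp_all add: real_linear_on_def)

lemma real_dual_add:
  assumes "g \<in> real_dual E" "h \<in> real_dual E"
  shows "(\<lambda>x. g x + h x) \<in> real_dual E"
proof -
  obtain C D where C: "\<And>x. x \<in> E \<Longrightarrow> \<bar>g x\<bar> \<le> C * norm x" "\<And>x. x \<in> E \<Longrightarrow> \<bar>h x\<bar> \<le> D * norm x"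
    using assms by (auto simp: real_dual_def)
  have "\<bar>g x + h x\<bar> \<le> (C + D) * norm x" if "x \<in> E" for x
    using C[OF that] by (simp add: distrib_right)
  moreover have "real_linear_on E (\<lambda>x. g x + h x)"
    using assms by (simp add: real_dual_def real_linear_on_def algebra_simps)
  ultimately show ?thesis by (rule real_dualI[rotated])
qed

lemma real_dual_scale:
  assumes "g \<in> real_dual E"
  shows "(\<lambda>x. r * g x) \<in> real_dual E"
proof -
  obtain C where C: "\<And>x. x \<in> E \<Longrightarrow> \<bar>g x\<bar> \<le> C * norm x"
    using assms by (auto simp: real_dual_def)
  have "\<bar>r * g x\<bar> \<le> (\<bar>r\<bar> * C) * norm x" if "x \<in> E" for x
    using C[OF that] by (simp add: abs_mult mult_left_mono mult.assoc)
  moreover have "real_linear_on E (\<lambda>x. r * g x)"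
    using assms by (simp add: real_dual_def real_linear_on_def algebra_simps)
  ultimately show ?thesis by (rule real_dualI[rotated])
qed

lemma real_dual_sum:
  assumes "\<And>i. i \<in> A \<Longrightarrow> g i \<in> real_dual E"
  shows "(\<lambda>x. \<Sum>i\<in>A. g i x) \<in> real_dual E"
  using assms
proof (induction A rule: infinite_finite_induct)
  case (insert i A)
  then show ?case using real_dual_add[of "g i" E "\<lambda>x. \<Sum>i\<in>A. g i x"] by simp
qed (simp_all add: real_dual_zero)

text \<open>\<open>F\<close> plays the role of the bidual of \<open>E\<close> and \<open>B y g\<close> that of the value of \<open>y\<close> at \<open>g\<close>.  Elements
  of \<open>real_dual E\<close> have arbitrary values outside \<open>E\<close>.\<close>

locale bidual_pairing =
  fixes E F :: "'b::real_normed_vector set" and B :: "'b \<Rightarrow> ('b \<Rightarrow> real) \<Rightarrow> real"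
  assumes E: "subspace E" and F: "subspace F" and EF: "E \<subseteq> F"
    and pair_linear: "g \<in> real_dual E \<Longrightarrow> real_linear_on F (\<lambda>y. B y g)"
    and pair_add: "y \<in> F \<Longrightarrow> g \<in> real_dual E \<Longrightarrow> h \<in> real_dual E \<Longrightarrow> B y (\<lambda>x. g x + h x) = B y g + B y h"
    and pair_scale: "y \<in> F \<Longrightarrow> g \<in> real_dual E \<Longrightarrow> B y (\<lambda>x. r * g x) = r * B y g"
    and pair_eval: "x \<in> E \<Longrightarrow> g \<in> real_dual E \<Longrightarrow> B x g = g x"
    and pair_le: "y \<in> F \<Longrightarrow> g \<in> real_dual E \<Longrightarrow> 0 \<le> C \<Longrightarrow> (\<And>x. x \<in> E \<Longrightarrow> \<bar>g x\<bar> \<le> C * norm x) \<Longrightarrow> B y g \<le> C * norm y"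
    and pair_norming: "y \<in> F \<Longrightarrow> r < norm y \<Longrightarrow> \<exists>g\<in>real_dual E. (\<forall>x\<in>E. \<bar>g x\<bar> \<le> norm x) \<and> r < B y g"
begin

text \<open>The bound \<open>pair_le\<close> with constant 0, applied to g and to - g. It shows that
  the pairing sees only the restriction of g to \<open>E\<close>.\<close>

lemma pair_vanishing:
  assumes "y \<in> F" "g \<in> real_dual E" "\<And>x. x \<in> E \<Longrightarrow> g x = 0"
  shows "B y g = 0"
proof -
  have "B y g \<le> 0 * norm y" using assms by (intro pair_le) auto
  moreover have "B y (\<lambda>x. -1 * g x) \<le> 0 * norm y"
    using assms real_dual_scale[OF assms(2), of "-1"] by (intro pair_le) auto
  moreover have "B y (\<lambda>x. -1 * g x) = -1 * B y g" using assms by (intro pair_scale)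
  ultimately show ?thesis by simp
qed

lemma pair_sum:
  assumes y: "y \<in> F" and g: "\<And>i. i \<in> A \<Longrightarrow> g i \<in> real_dual E"
  shows "B y (\<lambda>x. \<Sum>i\<in>A. g i x) = (\<Sum>i\<in>A. B y (g i))"
  using g
proof (induction A rule: infinite_finite_induct)
  case (insert i A)
  then show ?case
    using pair_add[OF y, of "g i" "\<lambda>x. \<Sum>i\<in>A. g i x"] real_dual_sum[of A g E] by simp
qed (use pair_vanishing[OF y real_dual_zero] in simp_all)

lemma pair_combination:
  assumes g: "g \<in> real_dual E" and y: "\<And>j. j \<in> I \<Longrightarrow> y j \<in> F" and x: "x \<in> F"
  shows "x + (\<Sum>j\<in>I. a j *\<^sub>R y j) \<in> F \<and> B (x + (\<Sum>j\<in>I. a j *\<^sub>R y j)) g = B x g + (\<Sum>j\<in>I. a j * B (y j) g)"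
  using y
proof (induction I rule: infinite_finite_induct)
  case (insert i I)
  have l: "B (u + v) g = B u g + B v g" "B (r *\<^sub>R u) g = r * B u g" if "u \<in> F" "v \<in> F" for u v r
    using pair_linear[OF g] that by (auto simp: real_linear_on_def)
  have yi: "a i *\<^sub>R y i \<in> F" using insert.prems F by (simp add: subspace_scale)
  have IH: "x + (\<Sum>j\<in>I. a j *\<^sub>R y j) \<in> F"
    "B (x + (\<Sum>j\<in>I. a j *\<^sub>R y j)) g = B x g + (\<Sum>j\<in>I. a j * B (y j) g)"
    using insert.IH insert.prems by auto
  have eq: "x + (\<Sum>j\<in>insert i I. a j *\<^sub>R y j) = a i *\<^sub>R y i + (x + (\<Sum>j\<in>I. a j *\<^sub>R y j))"
    using insert.hyps by (simp add: algebra_simps)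
  show ?case unfolding eq using l(1)[OF yi IH(1)] l(2)[of "y i" "y i"] insert.prems insert.hyps IH yi F
    by (simp add: subspace_add)
qed (use x in simp_all)

text \<open>If the system has no solution in \<open>E\<close>, separation yields functionals whose
  combination annihilates every choice of unknowns in \<open>E\<close>. The pairing carries this
  relation over to the unknowns y in \<open>F\<close>, where it contradicts that all rows have norm
  below one. Lower norm bounds are first replaced by scalar conditions on norming
  functionals.\<close>

lemma solvable_descend:
  fixes I :: "'i set"
  assumes fin: "finite I" "finite L" and WI: "W \<subseteq> I" and L: "\<And>a x. (a, x) \<in> L \<Longrightarrow> x \<in> E" and r: "0 \<le> r"
    and sol: "solvable F I L W r"
  shows "solvable E I L W r"
proof (rule ccontr)
  assume nsol: "\<not> solvable E I L W r"
  obtain y where yF: "\<And>j. j \<in> I \<Longrightarrow> y j \<in> F"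
    and yL: "\<And>l. l \<in> L \<Longrightarrow> norm (snd l + (\<Sum>j\<in>I. fst l j *\<^sub>R y j)) < 1"
    and yW: "\<And>j. j \<in> W \<Longrightarrow> r < norm (y j)"
    using sol by (fastforce simp: solvable_def)
  \<comment> \<open>A unit vector e lets scalar conditions be written as norm conditions in
    \<open>'b\<close>. If \<open>W\<close> is nonempty, some y j is nonzero because r is
    nonnegative.\<close>
  obtain e :: 'b where e: "W \<noteq> {} \<Longrightarrow> norm e = 1"
  proof (cases "W = {}")
    case False
    then obtain j where "j \<in> W" by blast
    then have "norm (y j) \<noteq> 0" using yW[of j] r by auto
    then have "norm (inverse (norm (y j)) *\<^sub>R y j) = 1" by simp
    then show ?thesis using that by blast
  qed (use that in blast)
  have "\<exists>g. g \<in> real_dual E \<and> (\<forall>x\<in>E. \<bar>g x\<bar> \<le> norm x) \<and> r < B (y j) g" if "j \<in> W" for j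
    using pair_norming[OF yF yW[OF that]] WI that by blast
  then obtain \<psi> where \<psi>: "\<And>j. j \<in> W \<Longrightarrow> \<psi> j \<in> real_dual E"
    "\<And>j x. j \<in> W \<Longrightarrow> x \<in> E \<Longrightarrow> \<bar>\<psi> j x\<bar> \<le> norm x" "\<And>j. j \<in> W \<Longrightarrow> r < B (y j) (\<psi> j)"
    by metis
  have finW: "finite W" using WI fin(1) by (rule finite_subset)
  \<comment> \<open>The bound r < norm (z j) is enforced through |\<psi> j (z j) - \<beta> j| <
    \<eta> j: it puts \<psi> j (z j) above r, while \<psi> j is dominated by the norm.\<close>
  define \<beta> where "\<beta> j = B (y j) (\<psi> j)" for j
  define \<eta> where "\<eta> j = \<beta> j - r" for j
  have \<eta>: "0 < \<eta> j" if "j \<in> W" for j using \<psi>(3)[OF that] by (simp add: \<eta>_def \<beta>_def)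
  have \<psi>add: "\<psi> j (x + x') = \<psi> j x + \<psi> j x'" if "j \<in> W" "x \<in> E" "x' \<in> E" for j x x'
    using \<psi>(1)[OF that(1)] that by (auto simp: real_dual_def real_linear_on_def)
  have \<psi>scale: "\<psi> j (t *\<^sub>R x) = t * \<psi> j x" if "j \<in> W" "x \<in> E" for j x t
    using \<psi>(1)[OF that(1)] that by (auto simp: real_dual_def real_linear_on_def)
  have \<psi>0: "\<psi> j 0 = 0" if "j \<in> W" for j using \<psi>(2)[OF that, of 0] subspace_0[OF E] by simp
  define S where "S = {z. \<forall>j\<in>I. z j \<in> E}"
  \<comment> \<open>The linear part of the enlarged system and, in c, its constants. Left
    coordinates are the rows of \<open>L\<close>; right coordinates are the scalar conditions
    divided by their margins, so that every requirement reads norm < 1.\<close>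
  define \<Lambda> where "\<Lambda> z l = (case l of Inl l \<Rightarrow> \<Sum>j\<in>I. fst l j *\<^sub>R z j
    | Inr j \<Rightarrow> if j \<in> W then (\<psi> j (z j) / \<eta> j) *\<^sub>R e else 0)"
    for z :: "'i \<Rightarrow> 'b" and l :: "(('i \<Rightarrow> real) \<times> 'b) + 'i"
  define c where "c l = (case l of Inl l \<Rightarrow> snd l | Inr j \<Rightarrow> - (\<beta> j / \<eta> j) *\<^sub>R e)"
    for l :: "(('i \<Rightarrow> real) \<times> 'b) + 'i"
  have WE: "z j \<in> E" if "z \<in> S" "j \<in> W" for z j using that WI by (auto simp: S_def)
  obtain g C where g: "\<And>l. linear (g l)" "\<And>l b. \<bar>g l b\<bar> \<le> C l * norm b" "\<And>l. 0 \<le> C l"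
      "(\<Sum>l\<in>L <+> W. C l) \<le> 1" "\<And>v. v \<in> \<Lambda> ` S \<Longrightarrow> (\<Sum>l\<in>L <+> W. g l (v l)) = 0"
      "1 \<le> (\<Sum>l\<in>L <+> W. g l (c l))"
  proof (rule helly_separation[of "L <+> W" "\<Lambda> ` S" c])
    show "finite (L <+> W)" by (rule finite_Plus[OF fin(2) finW])
    have "\<Lambda> (\<lambda>_. 0) = 0" by (auto simp: \<Lambda>_def fun_eq_iff \<psi>0 split: sum.splits)
    moreover have "(\<lambda>_. 0) \<in> S" using subspace_0[OF E] by (simp add: S_def)
    ultimately show "0 \<in> \<Lambda> ` S" by (metis image_eqI)
    show "v + w \<in> \<Lambda> ` S" if v: "v \<in> \<Lambda> ` S" and w: "w \<in> \<Lambda> ` S" for v w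
    proof -
      obtain z z' where z: "z \<in> S" "v = \<Lambda> z" "z' \<in> S" "w = \<Lambda> z'" using v w by auto
      have "v + w = \<Lambda> (\<lambda>j. z j + z' j)"
        using z WE by (auto simp: \<Lambda>_def fun_eq_iff \<psi>add scaleR_add_right scaleR_add_left sum.distrib
            add_divide_distrib split: sum.splits)
      moreover have "(\<lambda>j. z j + z' j) \<in> S" using z E by (simp add: S_def subspace_add)
      ultimately show ?thesis by blast
    qed
    show "(\<lambda>l. t *\<^sub>R v l) \<in> \<Lambda> ` S" if v: "v \<in> \<Lambda> ` S" for v t
    proof -
      obtain z where z: "z \<in> S" "v = \<Lambda> z" using v by auto
      have "(\<lambda>l. t *\<^sub>R v l) = \<Lambda> (\<lambda>j. t *\<^sub>R z j)"
        using z WE by (auto simp: \<Lambda>_def fun_eq_iff \<psi>scale scaleR_sum_right mult.commute split: sum.splits)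
      moreover have "(\<lambda>j. t *\<^sub>R z j) \<in> S" using z E by (simp add: S_def subspace_scale)
      ultimately show ?thesis by blast
    qed
    show "\<exists>l\<in>L <+> W. 1 \<le> norm (c l + v l)" if v: "v \<in> \<Lambda> ` S" for v
    proof (rule ccontr)
      assume n: "\<not> (\<exists>l\<in>L <+> W. 1 \<le> norm (c l + v l))"
      obtain z where z: "z \<in> S" "v = \<Lambda> z" using v by auto
      have "norm (snd l + (\<Sum>j\<in>I. fst l j *\<^sub>R z j)) < 1" if "l \<in> L" for l
        using n[simplified, rule_format, of "Inl l"] that z by (simp add: c_def \<Lambda>_def InlI not_le)
      moreover have "r < norm (z j)" if j: "j \<in> W" for j
      proof -
        have "norm (c (Inr j) + v (Inr j)) < 1" using n j by (auto simp: not_le)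
        also have "c (Inr j) + v (Inr j) = ((\<psi> j (z j) - \<beta> j) / \<eta> j) *\<^sub>R e"
          using j z by (simp add: c_def \<Lambda>_def diff_divide_distrib algebra_simps)
        also have "norm \<dots> = \<bar>\<psi> j (z j) - \<beta> j\<bar> / \<eta> j"
          using e j \<eta>[OF j] by auto
        finally have "\<bar>\<psi> j (z j) - \<beta> j\<bar> < \<eta> j" using \<eta>[OF j] by simp
        then have "r < \<psi> j (z j)" by (simp add: \<eta>_def)
        then show ?thesis using \<psi>(2)[OF j WE[OF z(1) j]] by simp
      qed
      ultimately have "solvable E I L W r"
        using z by (auto simp: solvable_def S_def intro!: exI[of _ z])
      then show False using nsol by simp
    qed
  qed (rule that)
  have gE: "g l \<in> real_dual E" for l
    using g(1)[of l] g(2)[of l] by (auto simp: real_dual_def real_linear_on_def linear_add linear_cmul intro!: exI[of _ "C l"])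
  define \<tau> where "\<tau> j = g (Inr j) e / \<eta> j" for j
  have bal: "(\<Sum>l\<in>L. fst l j * B (y j) (g (Inl l))) + (if j \<in> W then \<tau> j * \<beta> j else 0) = 0" if j: "j \<in> I" for j
  proof -
    \<comment> \<open>The total coefficient of the unknown j in the separating functional. It
      vanishes on \<open>E\<close> because vectors with one free entry b in place j are admissible,
      and then the pairing with y j vanishes as well.\<close>
    define h where "h b = (\<Sum>l\<in>L. fst l j * g (Inl l) b) + (if j \<in> W then \<tau> j else 0) * (if j \<in> W then \<psi> j else (\<lambda>_. 0)) b" for b
    have d1: "(\<lambda>b. \<Sum>l\<in>L. fst l j * g (Inl l) b) \<in> real_dual E"
      by (intro real_dual_sum real_dual_scale gE)
    have d3: "(if j \<in> W then \<psi> j else (\<lambda>_. 0)) \<in> real_dual E" by (simp add: \<psi>(1) real_dual_zero)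
    then have d2: "(\<lambda>b. (if j \<in> W then \<tau> j else 0) * (if j \<in> W then \<psi> j else (\<lambda>_. 0)) b) \<in> real_dual E"
      by (rule real_dual_scale)
    have hE: "h \<in> real_dual E" unfolding h_def[abs_def] by (rule real_dual_add[OF d1 d2])
    have "h b = 0" if b: "b \<in> E" for b
    proof -
      have "slot j b \<in> S" using b subspace_0[OF E] by (auto simp: slot_def S_def)
      then have "(\<Sum>l\<in>L <+> W. g l (\<Lambda> (slot j b) l)) = 0" using g(5) by blast
      moreover have "\<Lambda> (slot j b) (Inl l) = fst l j *\<^sub>R b" for l
        using fin j by (simp add: \<Lambda>_def slot_def if_distrib[of "(*\<^sub>R) _"] cong: if_cong)
      moreover have "\<Lambda> (slot j b) (Inr j') = (if j' = j then (\<psi> j b / \<eta> j) *\<^sub>R e else 0)" if "j' \<in> W" for j'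
        using that by (auto simp: \<Lambda>_def slot_def \<psi>0)
      ultimately have "(\<Sum>l\<in>L. fst l j * g (Inl l) b) + (\<Sum>j'\<in>W. if j' = j then \<psi> j b * \<tau> j else 0) = 0"
        using fin finW
        by (simp add: sum.Plus linear_cmul[OF g(1)] linear_0[OF g(1)] if_distrib[of "g _"] \<tau>_def cong: if_cong)
      then show ?thesis using finW by (cases "j \<in> W") (simp_all add: h_def mult.commute)
    qed
    then have "B (y j) h = 0" by (intro pair_vanishing[OF yF[OF j] hE])
    moreover have "B (y j) h = (\<Sum>l\<in>L. fst l j * B (y j) (g (Inl l))) +
        (if j \<in> W then \<tau> j else 0) * B (y j) (if j \<in> W then \<psi> j else (\<lambda>_. 0))"
      unfolding h_def[abs_def] pair_add[OF yF[OF j] d1 d2] pair_scale[OF yF[OF j] d3]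
      by (simp add: pair_sum yF j real_dual_scale gE pair_scale)
    ultimately show ?thesis by (auto simp: \<beta>_def)
  qed
  have "(\<Sum>j\<in>I. \<Sum>l\<in>L. fst l j * B (y j) (g (Inl l))) + (\<Sum>j\<in>I. if j \<in> W then \<tau> j * \<beta> j else 0) = 0"
    using bal by (simp add: sum.distrib[symmetric])
  moreover have "(\<Sum>j\<in>I. if j \<in> W then \<tau> j * \<beta> j else 0) = (\<Sum>j\<in>W. \<tau> j * \<beta> j)"
    using fin WI by (simp add: sum.If_cases Int_absorb1)
  ultimately have total: "(\<Sum>l\<in>L. \<Sum>j\<in>I. fst l j * B (y j) (g (Inl l))) = - (\<Sum>j\<in>W. \<tau> j * \<beta> j)"
    by (subst sum.swap) simp
  \<comment> \<open>The right coordinates of c contribute -\<tau> j \<beta> j, which by the summed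
    balance is exactly the contribution of the unknowns to the rows of \<open>L\<close>. What
    remains is the pairing of the rows evaluated at y.\<close>
  have "1 \<le> (\<Sum>l\<in>L. g (Inl l) (snd l)) - (\<Sum>j\<in>W. \<tau> j * \<beta> j)"
    using g(6) fin finW
    by (simp add: sum.Plus c_def linear_cmul[OF g(1)] linear_neg[OF g(1)] \<tau>_def sum_negf mult.commute)
  also have "\<dots> = (\<Sum>l\<in>L. g (Inl l) (snd l) + (\<Sum>j\<in>I. fst l j * B (y j) (g (Inl l))))"
    by (simp add: sum.distrib total)
  also have "\<dots> = (\<Sum>l\<in>L. B (snd l + (\<Sum>j\<in>I. fst l j *\<^sub>R y j)) (g (Inl l)))"
  proof (rule sum.cong[OF refl])
    fix l assume "l \<in> L"
    then have lE: "snd l \<in> E" using L by (metis prod.collapse)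
    then show "g (Inl l) (snd l) + (\<Sum>j\<in>I. fst l j * B (y j) (g (Inl l))) =
        B (snd l + (\<Sum>j\<in>I. fst l j *\<^sub>R y j)) (g (Inl l))"
      using pair_combination[OF gE, of I y "snd l"] yF EF pair_eval[OF lE gE] by auto
  qed
  also have "\<dots> \<le> (\<Sum>l\<in>L. C (Inl l) * norm (snd l + (\<Sum>j\<in>I. fst l j *\<^sub>R y j)))"
  proof (rule sum_mono)
    fix l assume "l \<in> L"
    then have lE: "snd l \<in> F" using L EF by (metis prod.collapse subsetD)
    show "B (snd l + (\<Sum>j\<in>I. fst l j *\<^sub>R y j)) (g (Inl l)) \<le> C (Inl l) * norm (snd l + (\<Sum>j\<in>I. fst l j *\<^sub>R y j))"
      by (rule pair_le) (use pair_combination[OF gE, of I y "snd l"] yF lE g(2,3) gE in auto)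
  qed
  finally have ge1: "1 \<le> (\<Sum>l\<in>L. C (Inl l) * norm (snd l + (\<Sum>j\<in>I. fst l j *\<^sub>R y j)))" .
  \<comment> \<open>A common bound below one for the finitely many rows, with 0 inserted in case
    there are none.\<close>
  define \<kappa> where "\<kappa> = Max (insert 0 ((\<lambda>l. norm (snd l + (\<Sum>j\<in>I. fst l j *\<^sub>R y j))) ` L))"
  have \<kappa>: "\<kappa> < 1" "0 \<le> \<kappa>" "\<And>l. l \<in> L \<Longrightarrow> norm (snd l + (\<Sum>j\<in>I. fst l j *\<^sub>R y j)) \<le> \<kappa>"
    unfolding \<kappa>_def using fin yL by (auto simp: Max_less_iff)
  have "(\<Sum>l\<in>L. C (Inl l) * norm (snd l + (\<Sum>j\<in>I. fst l j *\<^sub>R y j))) \<le> (\<Sum>l\<in>L. C (Inl l) * \<kappa>)"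
    by (intro sum_mono mult_left_mono \<kappa> g(3))
  also have "\<dots> = (\<Sum>l\<in>L. C (Inl l)) * \<kappa>" by (simp add: sum_distrib_right)
  also have "\<dots> \<le> 1 * \<kappa>"
  proof (rule mult_right_mono)
    have "(\<Sum>l\<in>L. C (Inl l)) \<le> (\<Sum>l\<in>L <+> W. C l)"
      using fin finW g(3) by (simp add: sum.Plus sum_nonneg)
    then show "(\<Sum>l\<in>L. C (Inl l)) \<le> 1" using g(4) by simp
  qed (rule \<kappa>)
  finally show False using ge1 \<kappa>(1) by simp
qed

end

section \<open>Perturbations in \<open>X\<close> from the centralizer of \<open>X\<^sup>(\<^sup>\<infinity>\<^sup>)\<close>\<close>

context K_banach
begin

lemma subspace_imp_real_subspace:
  assumes "subspace E" shows "real_vector.subspace E"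
  using assms subspace_scaleR[OF assms]
  by (auto simp: subspace_def real_vector.subspace_def)

text \<open>A real functional g is lifted to the scalar functional with real part g, the bidual
  element is evaluated there, and the real part is taken. Uniqueness of the lift makes this additive
  and real-homogeneous in g.\<close>

lemma bidual_pairing_canonical:
  assumes E: "subspace E" and F: "subspace F" and EF: "E \<subseteq> F"
    and iso: "isometric_iso (subsp s F) (dual (dual (subsp s E))) \<Phi>"
    and can: "\<And>x. x \<in> E \<Longrightarrow> \<Phi> x = canonical_embedding (subsp s E) x"
  shows "bidual_pairing E F (\<lambda>y g. scre (\<Phi> y (restrict (klift E g) E)))"
proof -
  define D where "D = dual (subsp s E)"
  define fg where "fg g = restrict (klift E g) E" for g
  have rl: "real_linear_on E g" if "g \<in> real_dual E" for g using that by (simp add: real_dual_def)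
  have fg_lin: "klinear_on E (fg g)" if "g \<in> real_dual E" for g
    using klinear_on_klift[OF E rl[OF that]] E
    by (simp add: klinear_on_def fg_def subspace_add subspace_scale)
  have fg_scre: "scre (fg g x) = g x" if "g \<in> real_dual E" "x \<in> E" for g x
    using scre_klift[OF E rl[OF that(1)] that(2)] that by (simp add: fg_def)
  have fg_le: "norm (fg g x) \<le> C * norm x"
    if "g \<in> real_dual E" "x \<in> E" "\<And>x. x \<in> E \<Longrightarrow> \<bar>g x\<bar> \<le> C * norm x" for g x C
  proof (rule klinear_on_norm_le[OF fg_lin[OF that(1)] E that(2)])
    fix x assume "x \<in> E"
    then show "scre (fg g x) \<le> C * norm x" using that(3)[of x] by (simp add: fg_scre that(1))
  qed
  have fg_eq: "fg g = f" if "g \<in> real_dual E" "f \<in> extensional E" "klinear_on E f"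
      "\<And>x. x \<in> E \<Longrightarrow> scre (f x) = g x" for g f
    unfolding fg_def
  proof (rule extensionalityI[OF restrict_extensional that(2)])
    fix x assume x: "x \<in> E"
    then show "restrict (klift E g) E x = f x"
      using klift_eqI[OF E rl[OF that(1)] that(3) x] that(4) by simp
  qed
  have fgD: "fg g \<in> carr D" if g: "g \<in> real_dual E" for g
  proof -
    obtain C where C: "\<And>x. x \<in> E \<Longrightarrow> \<bar>g x\<bar> \<le> C * norm x" using g by (auto simp: real_dual_def)
    have "fg g \<in> extensional E" by (simp add: fg_def)
    then show ?thesis using fg_lin[OF g] fg_le[OF g _ C] unfolding D_def dual_carr by blast
  qed
  have vaddD: "vadd D f h = (\<lambda>x\<in>E. f x + h x)" and vscaleD: "vscale D c f = (\<lambda>x\<in>E. c * f x)" for f h c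
    by (simp_all add: D_def dual_def subsp_def)
  have DD: "carr (dual D) = {\<phi> \<in> extensional (carr D). linear_map D (whole (*)) \<phi> \<and> (\<exists>B. \<forall>f\<in>carr D. norm (\<phi> f) \<le> B * vnorm D f)}"
    "vadd (dual D) \<phi> \<theta> = (\<lambda>f\<in>carr D. \<phi> f + \<theta> f)" "vscale (dual D) c \<phi> = (\<lambda>f\<in>carr D. c * \<phi> f)"
    "vnorm (dual D) \<phi> = (SUP f\<in>unit_ball D. norm (\<phi> f))" for \<phi> \<theta> c
    by (simp_all add: dual_def)
  have iso': "linear_map (subsp s F) (dual D) \<Phi>" "\<And>y. y \<in> F \<Longrightarrow> vnorm (dual D) (\<Phi> y) = norm y"
    using iso by (simp_all add: isometric_iso_def D_def subsp_def)
  have \<Phi>add: "\<Phi> (x + y) = vadd (dual D) (\<Phi> x) (\<Phi> y)" if "x \<in> F" "y \<in> F" for x y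
    using iso'(1) that by (simp add: linear_map_def subsp_def)
  have \<Phi>scale: "\<Phi> (s c x) = vscale (dual D) c (\<Phi> x)" if "x \<in> F" for c x
    using iso'(1) that by (simp add: linear_map_def subsp_def)
  have \<Phi>carr: "\<Phi> y \<in> carr (dual D)" if "y \<in> F" for y
    using iso'(1) that by (auto simp: linear_map_def subsp_def)
  have \<Phi>lin: "\<Phi> y (vadd D f h) = \<Phi> y f + \<Phi> y h" "\<Phi> y (vscale D c f) = c * \<Phi> y f"
    if "y \<in> F" "f \<in> carr D" "h \<in> carr D" for y f h c
    using \<Phi>carr[OF that(1)] that by (simp_all add: DD linear_map_def subsp_def)
  have bdd: "bdd_above ((\<lambda>f. norm (\<Phi> y f)) ` unit_ball D)" if y: "y \<in> F" for y
  proof -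
    obtain B where B: "\<And>f. f \<in> carr D \<Longrightarrow> norm (\<Phi> y f) \<le> B * vnorm D f"
      using \<Phi>carr[OF y] by (auto simp: DD)
    have 0: "0 \<le> vnorm D f" if "f \<in> carr D" for f
    proof -
      have f: "f \<in> carr (dual (subsp s E))" using that by (simp add: D_def)
      have "norm (f 0) \<le> vnorm (dual (subsp s E)) f"
        unfolding vnorm_dual by (rule cSUP_upper[OF _ vnorm_dual_bdd[OF f]]) (simp add: subspace_0[OF E])
      then show ?thesis unfolding D_def by (rule order_trans[OF norm_ge_zero])
    qed
    show ?thesis
    proof (rule bdd_aboveI2)
      fix f assume f: "f \<in> unit_ball D"
      then have "B * vnorm D f \<le> \<bar>B\<bar> * 1" using 0[of f]
        by (intro mult_mono) (auto simp: unit_ball_def)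
      then show "norm (\<Phi> y f) \<le> \<bar>B\<bar>" using B[of f] f by (simp add: unit_ball_def)
    qed
  qed
  have \<Phi>pos: "norm (\<Phi> y f) \<le> C * norm y"
    if y: "y \<in> F" and f: "f \<in> carr D" and C: "0 < C" "\<And>x. x \<in> E \<Longrightarrow> norm (f x) \<le> C * norm x" for y f C
  proof -
    have fl: "klinear_on E f" using f by (simp add: D_def dual_carr)
    have "vscale D (of_real (1 / C)) f \<in> unit_ball D"
      unfolding vscaleD unfolding D_def unit_ball_dual[OF E]
    proof (intro conjI ballI)
      show "klinear_on E (\<lambda>x\<in>E. of_real (1 / C) * f x)"
        using fl E by (simp add: klinear_on_def subspace_add subspace_scale add_divide_distrib)
      fix x assume x: "x \<in> E"
      show "norm ((\<lambda>x\<in>E. of_real (1 / C) * f x) x) \<le> norm x"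
        using C x by (simp add: norm_divide divide_le_eq mult.commute)
    qed simp
    then have "norm (\<Phi> y (vscale D (of_real (1 / C)) f)) \<le> norm y"
      unfolding iso'(2)[OF y, symmetric] DD by (rule cSUP_upper[OF _ bdd[OF y]])
    then have "norm (\<Phi> y f) / C \<le> norm y"
      using C by (simp add: \<Phi>lin(2)[OF y f f] norm_divide)
    then show ?thesis using C by (simp add: divide_le_eq mult.commute)
  qed
  \<comment> \<open>\<open>\<Phi>pos\<close> rescales f by 1 / C into the unit ball; enlarging C
    slightly reaches C = 0 too.\<close>
  have \<Phi>le: "norm (\<Phi> y f) \<le> C * norm y"
    if y: "y \<in> F" and f: "f \<in> carr D" and C: "0 \<le> C" "\<And>x. x \<in> E \<Longrightarrow> norm (f x) \<le> C * norm x" for y f C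
  proof (rule field_le_epsilon)
    fix e :: real assume e: "0 < e"
    define e' where "e' = e / (1 + norm y)"
    have "0 < 1 + norm y" using norm_ge_zero[of y] by linarith
    then have e': "0 < e'" "e' * norm y \<le> e" using e by (simp_all add: e'_def field_simps)
    have "norm (\<Phi> y f) \<le> (C + e') * norm y"
    proof (rule \<Phi>pos[OF y f])
      fix x assume "x \<in> E"
      then have "norm (f x) \<le> C * norm x" by (rule C(2))
      also have "\<dots> \<le> (C + e') * norm x" using e' by (intro mult_right_mono) auto
      finally show "norm (f x) \<le> (C + e') * norm x" .
    qed (use C e' in simp)
    then show "norm (\<Phi> y f) \<le> C * norm y + e" using e' by (simp add: distrib_right)
  qed
  have "bidual_pairing E F (\<lambda>y g. scre (\<Phi> y (fg g)))"
  proof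
    show "real_vector.subspace E" "real_vector.subspace F" using E F by (simp_all add: subspace_imp_real_subspace)
    show "E \<subseteq> F" by (rule EF)
  next
    fix g assume g: "g \<in> real_dual E"
    show "real_linear_on F (\<lambda>y. scre (\<Phi> y (fg g)))"
      unfolding real_linear_on_def
    proof (intro conjI ballI allI)
      fix x y assume "x \<in> F" "y \<in> F"
      then show "scre (\<Phi> (x + y) (fg g)) = scre (\<Phi> x (fg g)) + scre (\<Phi> y (fg g))"
        by (simp add: \<Phi>add DD fgD[OF g] scre_add)
    next
      fix r x assume "x \<in> F"
      then have "\<Phi> (r *\<^sub>R x) (fg g) = of_real r * \<Phi> x (fg g)"
        by (simp add: \<Phi>scale DD fgD[OF g] flip: scale_of_real)
      then show "scre (\<Phi> (r *\<^sub>R x) (fg g)) = r * scre (\<Phi> x (fg g))"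
        by (simp add: scre_of_real_mult)
    qed
  next
    fix y g h assume y: "y \<in> F" and g: "g \<in> real_dual E" and h: "h \<in> real_dual E"
    have "fg (\<lambda>x. g x + h x) = vadd D (fg g) (fg h)"
    proof (rule fg_eq[OF real_dual_add[OF g h]])
      show "klinear_on E (vadd D (fg g) (fg h))"
        using fg_lin[OF g] fg_lin[OF h] E
        by (simp add: vaddD klinear_on_def subspace_add subspace_scale distrib_left)
    qed (simp_all add: vaddD scre_add fg_scre g h)
    then show "scre (\<Phi> y (fg (\<lambda>x. g x + h x))) = scre (\<Phi> y (fg g)) + scre (\<Phi> y (fg h))"
      by (simp add: \<Phi>lin(1) y fgD g h scre_add)
  next
    fix y g r assume y: "y \<in> F" and g: "g \<in> real_dual E"
    have "fg (\<lambda>x. r * g x) = vscale D (of_real r) (fg g)"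
    proof (rule fg_eq[OF real_dual_scale[OF g]])
      show "klinear_on E (vscale D (of_real r) (fg g))"
        using fg_lin[OF g] E
        by (simp add: vscaleD klinear_on_def subspace_add subspace_scale distrib_left)
    qed (simp_all add: vscaleD scre_of_real_mult fg_scre g)
    then show "scre (\<Phi> y (fg (\<lambda>x. r * g x))) = r * scre (\<Phi> y (fg g))"
      by (simp add: \<Phi>lin(2)[OF y fgD[OF g] fgD[OF g]] scre_of_real_mult)
  next
    fix x g assume x: "x \<in> E" and g: "g \<in> real_dual E"
    have "\<Phi> x (fg g) = fg g x"
      using fgD[OF g] by (simp add: can[OF x] canonical_embedding_def D_def)
    then show "scre (\<Phi> x (fg g)) = g x" by (simp add: fg_scre g x)
  next
    fix y g C assume y: "y \<in> F" and g: "g \<in> real_dual E" and C: "0 \<le> C" "\<And>x. x \<in> E \<Longrightarrow> \<bar>g x\<bar> \<le> C * norm x"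
    have "norm (\<Phi> y (fg g)) \<le> C * norm y"
      by (rule \<Phi>le[OF y fgD[OF g] C(1)]) (rule fg_le[OF g _ C(2)])
    then show "scre (\<Phi> y (fg g)) \<le> C * norm y" using abs_scre_le[of "\<Phi> y (fg g)"] by linarith
  next
    fix y r assume y: "y \<in> F" and r: "r < norm y"
    have "(\<lambda>x\<in>E. 0) \<in> unit_ball D"
      unfolding D_def unit_ball_dual[OF E]
      using E by (simp add: klinear_on_def subspace_add subspace_scale)
    then have ne: "unit_ball D \<noteq> {}" by blast
    have "r < (SUP f\<in>unit_ball D. norm (\<Phi> y f))" using r unfolding iso'(2)[OF y, symmetric] DD .
    then obtain f where f: "f \<in> unit_ball D" "r < norm (\<Phi> y f)"
      using less_cSUP_iff[OF ne bdd[OF y], of r] by auto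
    then have fD: "f \<in> carr D" by (simp add: unit_ball_def)
    have f': "klinear_on E f" "\<And>x. x \<in> E \<Longrightarrow> norm (f x) \<le> norm x"
      using f(1) unfolding D_def unit_ball_dual[OF E] by auto
    \<comment> \<open>Rotating f makes its value under \<Phi> y real and positive, so nothing is
      lost on passing to real parts.\<close>
    obtain c :: 'k where c: "norm c = 1" "c * \<Phi> y f = of_real (norm (\<Phi> y f))"
      using unimodular_rotation .
    define h where "h = vscale D c f"
    define g where "g x = scre (h x)" for x
    have h_lin: "klinear_on E h"
      using f'(1) E by (simp add: h_def vscaleD klinear_on_def subspace_add subspace_scale distrib_left)
    have g_le: "\<bar>g x\<bar> \<le> norm x" if "x \<in> E" for x
      using abs_scre_le[of "h x"] f'(2)[OF that] that c(1) by (simp add: g_def h_def vscaleD norm_mult)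
    have g: "g \<in> real_dual E"
      by (rule real_dualI[of _ _ 1]) (use real_linear_on_scre[OF h_lin] g_le in \<open>simp_all add: g_def[abs_def]\<close>)
    have "fg g = h"
      by (rule fg_eq[OF g _ h_lin]) (simp_all add: h_def vscaleD g_def)
    then have "\<Phi> y (fg g) = of_real (norm (\<Phi> y f))"
      by (simp add: h_def \<Phi>lin(2)[OF y fD fD] c)
    then show "\<exists>g\<in>real_dual E. (\<forall>x\<in>E. \<bar>g x\<bar> \<le> norm x) \<and> r < scre (\<Phi> y (fg g))"
      using g g_le f(2) by (intro bexI[of _ g]) auto
  qed
  then show ?thesis by (simp add: fg_def)
qed

end

text \<open>The finitely many norm conditions that make an index \<open>j\<close> usable: row \<open>k\<close> is the common
  perturbation, row \<open>i < k\<close> is subtracted from \<open>x i\<close>. Since all signed sums of a row are bounded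
  by one, a functional can be large only on few columns.\<close>

definition perturbable :: "'b::real_normed_vector set \<Rightarrow> nat \<Rightarrow> nat \<Rightarrow> (nat \<Rightarrow> 'b) \<Rightarrow> real \<Rightarrow> bool" where
  "perturbable E k N x r \<longleftrightarrow>
     (\<exists>y. (\<forall>i\<le>k. \<forall>j<N. y i j \<in> E) \<and>
        (\<forall>i\<le>k. \<forall>S. norm (\<Sum>j<N. (if j \<in> S then 1 else -1) *\<^sub>R y i j) < 1) \<and>
        (\<forall>i<k. \<forall>j<N. \<forall>\<sigma>\<in>{1, -1}. norm (x i - y i j + \<sigma> *\<^sub>R y k j) < 1) \<and>
        (\<forall>j<N. r < norm (y k j)))"

text \<open>Unknowns are indexed by pairs of row and column. Sign patterns range over subsets of
  \<open>{..<N}\<close> only, which keeps the system finite; an arbitrary S acts through its trace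
  there. In the second family i < k, so the two indicators refer to different unknowns.\<close>

definition perturbation_system :: "nat \<Rightarrow> nat \<Rightarrow> (nat \<Rightarrow> 'b::real_normed_vector) \<Rightarrow> ((nat \<times> nat \<Rightarrow> real) \<times> 'b) set" where
  "perturbation_system k N x =
     (\<lambda>(i, S). (\<lambda>p. if fst p = i then (if snd p \<in> S then 1 else -1) else 0, 0)) ` ({..k} \<times> Pow {..<N}) \<union>
     (\<lambda>(i, j, \<sigma>). (\<lambda>p. (if p = (i, j) then -1 else 0) + (if p = (k, j) then \<sigma> else 0), x i)) ` ({..<k} \<times> {..<N} \<times> {1, -1})"

lemma finite_perturbation_system: "finite (perturbation_system k N x)"
  by (simp add: perturbation_system_def)

lemma perturbable_iff_solvable:
  fixes x :: "nat \<Rightarrow> 'a::real_normed_vector"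
  shows "perturbable E k N x r \<longleftrightarrow>
     solvable E ({..k} \<times> {..<N}) (perturbation_system k N x) ({k} \<times> {..<N}) r"
proof -
  have row: "(\<Sum>p\<in>{..k} \<times> {..<N}. (if fst p = i then (if snd p \<in> S then 1 else -1) else 0) *\<^sub>R y p)
      = (\<Sum>j<N. (if j \<in> S then 1 else -1) *\<^sub>R y (i, j))" if "i \<le> k" for i S and y :: "nat \<times> nat \<Rightarrow> 'a"
  proof -
    have "(\<Sum>p\<in>{..k} \<times> {..<N}. (if fst p = i then (if snd p \<in> S then 1 else -1) else 0) *\<^sub>R y p)
        = (\<Sum>i'\<le>k. \<Sum>j<N. (if i' = i then (if j \<in> S then 1 else -1) else 0) *\<^sub>R y (i', j))"
      by (simp add: sum.cartesian_product split_def)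
    also have "\<dots> = (\<Sum>i'\<le>k. if i' = i then \<Sum>j<N. (if j \<in> S then 1 else -1) *\<^sub>R y (i, j) else 0)"
      by (rule sum.cong) auto
    finally show ?thesis using that by simp
  qed
  have two: "(\<Sum>p\<in>{..k} \<times> {..<N}. ((if p = (i, j) then -1 else 0) + (if p = (k, j) then \<sigma> else 0)) *\<^sub>R y p)
      = - y (i, j) + \<sigma> *\<^sub>R y (k, j)" if "i < k" "j < N" for i j \<sigma> and y :: "nat \<times> nat \<Rightarrow> 'a"
  proof -
    have "(\<Sum>p\<in>{..k} \<times> {..<N}. (if p = q then c else 0) *\<^sub>R y p) = (if q \<in> {..k} \<times> {..<N} then c *\<^sub>R y q else 0)" for q and c :: real
    proof -
      have "(if p = q then c else 0) *\<^sub>R y p = (if p = q then c *\<^sub>R y q else 0)" for p by simp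
      then show ?thesis by simp
    qed
    then show ?thesis using that by (simp add: scaleR_add_left sum.distrib)
  qed
  have cut: "(\<Sum>j<N. (if j \<in> S then 1 else -1) *\<^sub>R z j) = (\<Sum>j<N. (if j \<in> S \<inter> {..<N} then 1 else -1) *\<^sub>R z j)"
    for S and z :: "nat \<Rightarrow> 'a"
    by (rule sum.cong) auto
  show ?thesis
  proof
    assume "perturbable E k N x r"
    then obtain y where y: "\<forall>i\<le>k. \<forall>j<N. y i j \<in> E"
        "\<forall>i\<le>k. \<forall>S. norm (\<Sum>j<N. (if j \<in> S then 1 else -1) *\<^sub>R y i j) < 1"
        "\<forall>i<k. \<forall>j<N. \<forall>\<sigma>\<in>{1, -1}. norm (x i - y i j + \<sigma> *\<^sub>R y k j) < 1" "\<forall>j<N. r < norm (y k j)"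
      unfolding perturbable_def by blast
    show "solvable E ({..k} \<times> {..<N}) (perturbation_system k N x) ({k} \<times> {..<N}) r"
      unfolding solvable_def
    proof (intro exI[of _ "\<lambda>(i, j). y i j"] conjI)
      show "\<forall>(a, b)\<in>perturbation_system k N x.
          norm (b + (\<Sum>p\<in>{..k} \<times> {..<N}. a p *\<^sub>R (case p of (i, j) \<Rightarrow> y i j))) < 1"
        unfolding perturbation_system_def ball_Un
      proof (intro conjI)
        show "\<forall>(a, b)\<in>(\<lambda>(i, S). (\<lambda>p. if fst p = i then if snd p \<in> S then 1 else - 1 else 0, 0)) ` ({..k} \<times> Pow {..<N}).
            norm (b + (\<Sum>p\<in>{..k} \<times> {..<N}. a p *\<^sub>R (case p of (i, j) \<Rightarrow> y i j))) < 1"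
          using y(2) by (auto simp: row)
        show "\<forall>(a, b)\<in>(\<lambda>(i, j, \<sigma>). (\<lambda>p. (if p = (i, j) then - 1 else 0) + (if p = (k, j) then \<sigma> else 0), x i)) ` ({..<k} \<times> {..<N} \<times> {1, - 1}).
            norm (b + (\<Sum>p\<in>{..k} \<times> {..<N}. a p *\<^sub>R (case p of (i, j) \<Rightarrow> y i j))) < 1"
        proof
          fix l assume "l \<in> (\<lambda>(i, j, \<sigma> :: real). (\<lambda>p. (if p = (i, j) then - 1 else 0) + (if p = (k, j) then \<sigma> else 0), x i)) ` ({..<k} \<times> {..<N} \<times> {1, - 1})"
          then obtain i j and \<sigma> :: real where l: "l = (\<lambda>p. (if p = (i, j) then - 1 else 0) + (if p = (k, j) then \<sigma> else 0), x i)"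
            and ij: "i < k" "j < N" and \<sigma>: "\<sigma> \<in> {1, -1}" by auto
          show "case l of (a, b) \<Rightarrow> norm (b + (\<Sum>p\<in>{..k} \<times> {..<N}. a p *\<^sub>R (case p of (i, j) \<Rightarrow> y i j))) < 1"
            unfolding l prod.case two[OF ij] using y(3)[rule_format, OF ij \<sigma>] by (simp add: algebra_simps)
        qed
      qed
    qed (use y in auto)
  next
    assume "solvable E ({..k} \<times> {..<N}) (perturbation_system k N x) ({k} \<times> {..<N}) r"
    then obtain y where y: "\<forall>p\<in>{..k} \<times> {..<N}. y p \<in> E"
      "\<And>a b. (a, b) \<in> perturbation_system k N x \<Longrightarrow> norm (b + (\<Sum>p\<in>{..k} \<times> {..<N}. a p *\<^sub>R y p)) < 1"
      "\<forall>p\<in>{k} \<times> {..<N}. r < norm (y p)"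
      unfolding solvable_def by blast
    show "perturbable E k N x r"
      unfolding perturbable_def
    proof (intro exI[of _ "\<lambda>i j. y (i, j)"] conjI allI impI ballI)
      fix i S assume i: "i \<le> k"
      have "(\<lambda>p. if fst p = i then (if snd p \<in> S \<inter> {..<N} then 1 else -1) else 0, 0) \<in> perturbation_system k N x"
        unfolding perturbation_system_def by (rule UnI1, rule image_eqI[of _ _ "(i, S \<inter> {..<N})"]) (use i in auto)
      from y(2)[OF this] show "norm (\<Sum>j<N. (if j \<in> S then 1 else - 1) *\<^sub>R y (i, j)) < 1"
        unfolding row[OF i] cut[of S] by simp
    next
      fix i j and \<sigma> :: real assume h: "i < k" "j < N" "\<sigma> \<in> {1, -1}"
      have "(\<lambda>p. (if p = (i, j) then -1 else 0) + (if p = (k, j) then \<sigma> else 0), x i) \<in> perturbation_system k N x"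
        unfolding perturbation_system_def by (rule UnI2, rule image_eqI[of _ _ "(i, j, \<sigma>)"]) (use h in auto)
      from y(2)[OF this] show "norm (x i - y (i, j) + \<sigma> *\<^sub>R y (k, j)) < 1"
        unfolding two[OF h(1,2)] by (simp add: algebra_simps)
    qed (use y in auto)
  qed
qed

text \<open>Take y i j = Q j (x i) for i < k and y k j = Q j ((1 - \<eta>) u j). At an extreme
  functional all conditions concern multiplication by the numbers b j \<omega>, and the slack in
  norm (x i) < 1 absorbs the errors.\<close>

lemma (in K_banach) perturbable_if_infinite_dim_centralizer:
  fixes x :: "nat \<Rightarrow> 'a"
  assumes inf: "infinite_dim_centralizer s" and x: "\<And>i. i < k \<Longrightarrow> norm (x i) < 1" and r: "r < 1"
  shows "perturbable UNIV k N x r"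
proof -
  \<comment> \<open>Three factors of size at least 1 - \<eta> enter the lower bound: b j (p j), the
    scaling of u j, and norm (p j (u j)). Their product is at least 1 - 3 \<eta>, which exceeds
    r.\<close>
  define \<eta> where "\<eta> = (1 - max r 0) / 4"
  have \<eta>: "0 < \<eta>" "\<eta> < 1" "r < 1 - 3 * \<eta>" using r by (auto simp: \<eta>_def max_def field_simps)
  define \<kappa> where "\<kappa> = Max (insert (1 - \<eta>) ((\<lambda>i. norm (x i)) ` {..<k}))"
  have \<kappa>: "\<kappa> < 1" "1 - \<eta> \<le> \<kappa>" "\<And>i. i < k \<Longrightarrow> norm (x i) \<le> \<kappa>"
    unfolding \<kappa>_def using x \<eta> by (auto simp: Max_less_iff)
  then have \<kappa>0: "0 < \<kappa>" using \<eta> by simp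
  \<comment> \<open>Both error factors 1 + N \<delta> and 1 + 2 \<delta> stay below 2 - \<kappa>.
    Multiplied by \<kappa> they are at most K = 1 - (1 - \<kappa>)^2 < 1.\<close>
  define \<delta> where "\<delta> = min \<eta> ((1 - \<kappa>) / (N + 2))"
  have \<delta>: "0 < \<delta>" "\<delta> \<le> \<eta>" using \<kappa> \<eta> by (auto simp: \<delta>_def)
  have "\<delta> \<le> (1 - \<kappa>) / (N + 2)" by (simp add: \<delta>_def)
  then have "(N + 2) * \<delta> \<le> 1 - \<kappa>" by (simp add: pos_le_divide_eq mult.commute)
  define K where "K = (2 - \<kappa>) * \<kappa>"
  have K: "K < 1"
  proof -
    have "0 < (1 - \<kappa>) * (1 - \<kappa>)" using \<kappa> by simp
    then show ?thesis by (simp add: K_def algebra_simps)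
  qed
  have KN: "(1 + N * \<delta>) * \<kappa> \<le> K" "(1 + 2 * \<delta>) * \<kappa> \<le> K"
    unfolding K_def
  proof -
    have "N * \<delta> + 2 * \<delta> \<le> 1 - \<kappa>" using \<open>(N + 2) * \<delta> \<le> 1 - \<kappa>\<close> by (simp add: algebra_simps)
    moreover have "0 \<le> N * \<delta>" using \<delta> by simp
    ultimately have "1 + N * \<delta> \<le> 2 - \<kappa>" "1 + 2 * \<delta> \<le> 2 - \<kappa>" using \<delta> by linarith+
    then show "(1 + N * \<delta>) * \<kappa> \<le> (2 - \<kappa>) * \<kappa>" "(1 + 2 * \<delta>) * \<kappa> \<le> (2 - \<kappa>) * \<kappa>"
      using \<kappa>0 by (simp_all add: mult_right_mono)
  qed
  obtain Q b p where Q: "\<And>j. j < N \<Longrightarrow> acts_by (Q j) (b j)" and p: "\<And>j. j < N \<Longrightarrow> p j \<in> ext_fun"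
    and bp: "\<And>j. j < N \<Longrightarrow> 1 - \<delta> \<le> b j (p j)"
    and bsum: "\<And>\<omega>. \<omega> \<in> ext_fun \<Longrightarrow> (\<Sum>j<N. \<bar>b j \<omega>\<bar>) \<le> 1 + N * \<delta>"
    and b2: "\<And>j \<omega>. j < N \<Longrightarrow> \<omega> \<in> ext_fun \<Longrightarrow> \<bar>1 - b j \<omega>\<bar> + \<bar>b j \<omega>\<bar> \<le> 1 + 2 * \<delta>"
    by (rule almost_partition_of_unity[OF inf \<delta>(1), of N]) (rule that)
  have "\<exists>u. norm u < 1 \<and> 1 - \<eta> < norm (p j u)" if "j < N" for j
    using ext_fun_norm[OF p[OF that], of "1 - \<eta>"] \<eta> by auto
  then obtain u where u: "\<And>j. j < N \<Longrightarrow> norm (u j) < 1" "\<And>j. j < N \<Longrightarrow> 1 - \<eta> < norm (p j (u j))" by metis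
  define v where "v i j = (if i < k then x i else (1 - \<eta>) *\<^sub>R u j)" for i j
  have v: "norm (v i j) \<le> \<kappa>" if "j < N" for i j
  proof (cases "i < k")
    case False
    have "norm ((1 - \<eta>) *\<^sub>R u j) \<le> (1 - \<eta>) * 1" using u(1)[OF that] \<eta> by (simp add: mult_left_le)
    then show ?thesis using False \<kappa>(2) by (simp add: v_def)
  qed (simp add: v_def \<kappa>)
  define y where "y i j = Q j (v i j)" for i j
  have y: "\<omega> (y i j) = of_real (b j \<omega>) * \<omega> (v i j)" if "j < N" "\<omega> \<in> ext_fun" for \<omega> i j
    using Q[OF that(1)] that(2) by (simp add: acts_by_def y_def)
  have \<omega>v: "norm (\<omega> (v i j)) \<le> \<kappa>" if "j < N" "\<omega> \<in> ext_fun" for \<omega> i j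
    using ext_fun_le[OF that(2), of "v i j"] v[OF that(1), of i] by simp
  have K0: "0 \<le> K" using \<kappa> \<kappa>0 by (simp add: K_def)
  show ?thesis
    unfolding perturbable_def
  proof (intro exI[of _ y] conjI allI impI ballI)
    fix i and S :: "nat set"
    have "norm (\<Sum>j<N. (if j \<in> S then 1 else - 1) *\<^sub>R y i j) \<le> K"
    proof (rule norm_le_ext_fun[OF K0])
      fix \<omega> assume \<omega>: "\<omega> \<in> ext_fun"
      have "norm (\<omega> (\<Sum>j<N. (if j \<in> S then 1 else - 1) *\<^sub>R y i j))
          = norm (\<Sum>j<N. of_real (if j \<in> S then 1 else - 1) * (of_real (b j \<omega>) * \<omega> (v i j)))"
        by (simp add: ext_fun_sum[OF \<omega>] ext_fun_scaleR[OF \<omega>] y \<omega>)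
      also have "\<dots> \<le> (\<Sum>j<N. \<bar>b j \<omega>\<bar> * \<kappa>)"
        by (rule sum_norm_le) (auto simp: norm_mult \<omega>v[OF _ \<omega>] mult_left_mono)
      also have "\<dots> = (\<Sum>j<N. \<bar>b j \<omega>\<bar>) * \<kappa>" by (simp add: sum_distrib_right)
      also have "\<dots> \<le> (1 + N * \<delta>) * \<kappa>" using bsum[OF \<omega>] \<kappa>0 by (intro mult_right_mono) auto
      finally show "norm (\<omega> (\<Sum>j<N. (if j \<in> S then 1 else - 1) *\<^sub>R y i j)) \<le> K" using KN by linarith
    qed
    then show "norm (\<Sum>j<N. (if j \<in> S then 1 else - 1) *\<^sub>R y i j) < 1" using K by simp
  next
    fix i j and \<sigma> :: real assume h: "i < k" "j < N" "\<sigma> \<in> {1, -1}"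
    have "norm (x i - y i j + \<sigma> *\<^sub>R y k j) \<le> K"
    proof (rule norm_le_ext_fun[OF K0])
      fix \<omega> assume \<omega>: "\<omega> \<in> ext_fun"
      \<comment> \<open>An almost convex combination: x i keeps the weight 1 - b j \<omega>, and the
        new vector enters with weight b j \<omega> up to sign.\<close>
      have "\<omega> (x i - y i j + \<sigma> *\<^sub>R y k j) = of_real (1 - b j \<omega>) * \<omega> (v i j) + of_real (\<sigma> * b j \<omega>) * \<omega> (v k j)"
        using h by (simp add: ext_fun_add[OF \<omega>] ext_fun_diff[OF \<omega>] ext_fun_scaleR[OF \<omega>] y \<omega> v_def[of i] left_diff_distrib)
      also have "norm \<dots> \<le> norm (of_real (1 - b j \<omega>) * \<omega> (v i j)) + norm (of_real (\<sigma> * b j \<omega>) * \<omega> (v k j))"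
        by (rule norm_triangle_ineq)
      also have "\<dots> = \<bar>1 - b j \<omega>\<bar> * norm (\<omega> (v i j)) + \<bar>b j \<omega>\<bar> * norm (\<omega> (v k j))"
        using h(3) by (auto simp: norm_mult simp del: of_real_diff of_real_mult)
      also have "\<dots> \<le> \<bar>1 - b j \<omega>\<bar> * \<kappa> + \<bar>b j \<omega>\<bar> * \<kappa>"
        by (intro add_mono mult_left_mono \<omega>v h \<omega>) auto
      also have "\<dots> = (\<bar>1 - b j \<omega>\<bar> + \<bar>b j \<omega>\<bar>) * \<kappa>" by (simp add: distrib_right)
      also have "\<dots> \<le> (1 + 2 * \<delta>) * \<kappa>" using b2[OF h(2) \<omega>] \<kappa>0 by (intro mult_right_mono) auto
      finally show "norm (\<omega> (x i - y i j + \<sigma> *\<^sub>R y k j)) \<le> K" using KN by linarith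
    qed
    then show "norm (x i - y i j + \<sigma> *\<^sub>R y k j) < 1" using K by simp
  next
    fix j assume j: "j < N"
    have "1 - 3 * \<eta> \<le> (1 - \<eta>) * ((1 - \<eta>) * (1 - \<eta>))"
    proof -
      have "(1 - \<eta>) * ((1 - \<eta>) * (1 - \<eta>)) = 1 - 3 * \<eta> + \<eta> * \<eta> * (3 - \<eta>)" by (simp add: algebra_simps)
      then show ?thesis using \<eta> by simp
    qed
    also have "\<dots> \<le> b j (p j) * ((1 - \<eta>) * norm (p j (u j)))"
      using bp[OF j] \<delta> \<eta> u(2)[OF j] by (intro mult_mono) auto
    also have "\<dots> = norm (p j (y k j))"
      using bp[OF j] \<delta> \<eta> by (simp add: y j p v_def ext_fun_scaleR norm_mult del: of_real_diff)
    also have "\<dots> \<le> norm (y k j)" by (rule ext_fun_le[OF p[OF j]])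
    finally show "r < norm (y k j)" using \<eta> by simp
  qed simp
qed

text \<open>The system is solved in the completion, moved to some \<open>E m\<close> by density, and
  lowered one bidual at a time to \<open>E 0\<close>, from which the isometry J returns the solution
  to the original space.\<close>

lemma perturbable_of_X_infinity:
  fixes sX :: "'k::real_or_complex \<Rightarrow> 'a::banach \<Rightarrow> 'a"
    and sY :: "'k \<Rightarrow> 'b::banach \<Rightarrow> 'b"
  assumes X: "K_banach sX" and Y: "K_banach sY" and XY: "is_X_infinity sX sY"
    and inf: "infinite_dim_centralizer sY"
    and x: "\<And>i. i < k \<Longrightarrow> norm (x i) < 1" and r: "0 \<le> r" "r < 1"
  shows "perturbable UNIV k N (x :: nat \<Rightarrow> 'a) r"
proof -
  interpret X: K_banach sX by (rule X)
  interpret Y: K_banach sY by (rule Y)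
  obtain J :: "'a \<Rightarrow> 'b" and E :: "nat \<Rightarrow> 'b set" and \<Phi> :: "nat \<Rightarrow> 'b \<Rightarrow> ('b \<Rightarrow> 'k) \<Rightarrow> 'k" where
    sub: "\<And>n. Y.subspace (E n)" and mono: "\<And>n. E n \<subseteq> E (Suc n)"
    and J: "isometric_iso (whole sX) (subsp sY (E 0)) J"
    and iso: "\<And>n. isometric_iso (subsp sY (E (Suc n))) (dual (dual (subsp sY (E n)))) (\<Phi> n)"
    and can: "\<And>n x. x \<in> E n \<Longrightarrow> \<Phi> n x = canonical_embedding (subsp sY (E n)) x"
    and dense: "closure (\<Union>n. E n) = UNIV"
    using XY unfolding is_X_infinity_def by blast
  have J': "J ` UNIV = E 0" "\<And>a b. J (a + b) = J a + J b" "\<And>c a. J (sX c a) = sY c (J a)"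
    "\<And>a. norm (J a) = norm a"
    using J by (auto simp: isometric_iso_def linear_map_def subsp_def)
  have J_scaleR: "J (t *\<^sub>R a) = t *\<^sub>R J a" for t a
    using J'(3)[of "of_real t" a] by (simp add: X.scale_of_real Y.scale_of_real)
  have Jlin: "linear J" by (rule linearI) (simp_all add: J' J_scaleR)
  define L where "L = perturbation_system k N (\<lambda>i. J (x i))"
  let ?I = "{..k} \<times> {..<N}" and ?W = "{k} \<times> {..<N}"
  have WI: "?W \<subseteq> ?I" by auto
  have "perturbable UNIV k N (\<lambda>i. J (x i)) r"
    by (rule Y.perturbable_if_infinite_dim_centralizer[OF inf]) (simp_all add: J' x r)
  then have "solvable UNIV ?I L ?W r" unfolding L_def perturbable_iff_solvable .
  then have "\<exists>m. solvable (E m) ?I L ?W r"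
    by (intro solvable_dense[OF _ _ _ WI mono dense]) (simp_all add: L_def finite_perturbation_system)
  then obtain m where m: "solvable (E m) ?I L ?W r" ..
  have E0: "E 0 \<subseteq> E n" for n using lift_Suc_mono_le[of E 0 n] mono by simp
  \<comment> \<open>The constants of the system are 0 or some J (x i), so they lie in every
    \<open>E n\<close>, as each step of the descent requires.\<close>
  have "J a \<in> E n" for a n using J'(1) E0[of n] by blast
  moreover have "0 \<in> E n" for n by (rule Y.subspace_0[OF sub])
  ultimately have L: "b \<in> E n" if "(a, b) \<in> L" for a b n
    using that by (auto simp: L_def perturbation_system_def)
  have "solvable (E 0) ?I L ?W r"
    using m
  proof (induction m)
    case (Suc m)
    have "bidual_pairing (E m) (E (Suc m)) (\<lambda>y g. scre (\<Phi> m y (restrict (Y.klift (E m) g) (E m))))"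
      by (rule Y.bidual_pairing_canonical[OF sub sub mono iso can])
    then have "solvable (E m) ?I L ?W r"
      by (rule bidual_pairing.solvable_descend) (use L Suc.prems WI r in \<open>auto simp: L_def finite_perturbation_system\<close>)
    then show ?case by (rule Suc.IH)
  qed
  then have "perturbable (E 0) k N (\<lambda>i. J (x i)) r" unfolding L_def perturbable_iff_solvable .
  then obtain y where y: "\<forall>i\<le>k. \<forall>j<N. y i j \<in> E 0"
      "\<forall>i\<le>k. \<forall>S. norm (\<Sum>j<N. (if j \<in> S then 1 else -1) *\<^sub>R y i j) < 1"
      "\<forall>i<k. \<forall>j<N. \<forall>\<sigma>\<in>{1, -1}. norm (J (x i) - y i j + \<sigma> *\<^sub>R y k j) < 1" "\<forall>j<N. r < norm (y k j)"
    unfolding perturbable_def by blast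
  have "\<exists>z. i \<le> k \<longrightarrow> j < N \<longrightarrow> y i j = J z" for i j using y(1) J'(1) by blast
  then obtain z where z: "\<And>i j. i \<le> k \<Longrightarrow> j < N \<Longrightarrow> y i j = J (z i j)" by metis
  show ?thesis
    unfolding perturbable_def
  proof (intro exI[of _ z] conjI allI impI ballI)
    fix i S assume i: "i \<le> k"
    have "J (\<Sum>j<N. (if j \<in> S then 1 else - 1) *\<^sub>R z i j) = (\<Sum>j<N. (if j \<in> S then 1 else - 1) *\<^sub>R y i j)"
      using i by (simp add: linear_sum[OF Jlin] J_scaleR z)
    then show "norm (\<Sum>j<N. (if j \<in> S then 1 else - 1) *\<^sub>R z i j) < 1"
      unfolding J'(4)[symmetric] using y(2) i by simp
  next
    fix i j and \<sigma> :: real assume h: "i < k" "j < N" "\<sigma> \<in> {1, -1}"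
    have "J (x i - z i j + \<sigma> *\<^sub>R z k j) = J (x i) - y i j + \<sigma> *\<^sub>R y k j"
      using h by (simp add: J'(2) J_scaleR linear_diff[OF Jlin] z)
    then show "norm (x i - z i j + \<sigma> *\<^sub>R z k j) < 1" 
      unfolding J'(4)[symmetric] using y(3)[rule_format, OF h] by simp
  next
    fix j assume "j < N"
    then show "r < norm (z k j)" using y(4)[rule_format, of j] z[of k j] J'(4) by simp
  qed simp
qed

section \<open>Slices of the ultrapower\<close>

context K_banach
begin

context
  fixes U :: "nat filter"
  assumes U: "U \<noteq> bot"
begin

section \<open>Representatives and the quotient norm\<close>

definition cls :: "(nat \<Rightarrow>\<^sub>C 'a) \<Rightarrow> (nat \<Rightarrow>\<^sub>C 'a) set" where
  "cls f = ultra_rel U `` {f}"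

abbreviation "UP \<equiv> restrict_scalars (ultrapower s U)"

lemma mem_cls: "g \<in> cls f \<longleftrightarrow> ((\<lambda>n. norm (apply_bcontfun f n - apply_bcontfun g n)) \<longlongrightarrow> 0) U"
  by (simp add: cls_def ultra_rel_def minus_bcontfun.rep_eq)

lemma self_mem_cls: "f \<in> cls f"
  by (simp add: mem_cls)

lemma cls_eqI:
  assumes "g \<in> cls f" shows "cls g = cls f"
proof -
  have fg: "((\<lambda>n. norm (apply_bcontfun f n - apply_bcontfun g n)) \<longlongrightarrow> 0) U"
    using assms by (simp add: mem_cls)
  have swap: "((\<lambda>n. norm (apply_bcontfun a n - apply_bcontfun b n)) \<longlongrightarrow> 0) U"
    if "((\<lambda>n. norm (apply_bcontfun c n - apply_bcontfun a n)) \<longlongrightarrow> 0) U"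
      "((\<lambda>n. norm (apply_bcontfun c n - apply_bcontfun b n)) \<longlongrightarrow> 0) U" for a b c :: "nat \<Rightarrow>\<^sub>C 'a"
  proof (rule tendsto_0_le[where K = 1, OF tendsto_add_zero[OF that]])
    show "\<forall>\<^sub>F n in U. norm (norm (apply_bcontfun a n - apply_bcontfun b n)) \<le>
        norm (norm (apply_bcontfun c n - apply_bcontfun a n) + norm (apply_bcontfun c n - apply_bcontfun b n)) * 1"
      by (simp add: norm_triangle_sub order_trans[OF norm_triangle_le_diff])
        (metis (no_types, lifting) always_eventually dist_commute dist_norm dist_triangle2)
  qed
  have gf: "((\<lambda>n. norm (apply_bcontfun g n - apply_bcontfun f n)) \<longlongrightarrow> 0) U"
    using fg by (simp add: norm_minus_commute)
  show ?thesis
    using swap[OF fg] swap[OF gf] by (auto simp: mem_cls)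
qed

lemma carr_UP: "carr UP = range cls"
  by (auto simp: restrict_scalars_def ultrapower_def quotient_def cls_def)

lemma vadd_UP: "vadd UP (cls f) (cls g) = cls (f + g)"
proof -
  have "cls (f' + g') = cls (f + g)" if "f' \<in> cls f" "g' \<in> cls g" for f' g'
  proof (rule cls_eqI, unfold mem_cls)
    show "((\<lambda>n. norm (apply_bcontfun (f + g) n - apply_bcontfun (f' + g') n)) \<longlongrightarrow> 0) U"
    proof (rule tendsto_0_le[where K = 1, OF tendsto_add_zero[OF that[unfolded mem_cls]]])
      have "norm (apply_bcontfun (f + g) n - apply_bcontfun (f' + g') n)
          \<le> norm (apply_bcontfun f n - apply_bcontfun f' n) + norm (apply_bcontfun g n - apply_bcontfun g' n)" for n
        using norm_triangle_ineq[of "apply_bcontfun f n - apply_bcontfun f' n" "apply_bcontfun g n - apply_bcontfun g' n"]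
        by (simp add: plus_bcontfun.rep_eq add_diff_add)
      then show "\<forall>\<^sub>F n in U. norm (norm (apply_bcontfun (f + g) n - apply_bcontfun (f' + g') n)) \<le>
          norm (norm (apply_bcontfun f n - apply_bcontfun f' n) + norm (apply_bcontfun g n - apply_bcontfun g' n)) * 1"
        by simp
    qed
  qed
  then have "(\<Union>f'\<in>cls f. \<Union>g'\<in>cls g. cls (f' + g')) = cls (f + g)"
    using self_mem_cls[of f] self_mem_cls[of g] by blast
  then show ?thesis by (simp add: restrict_scalars_def ultrapower_def cls_def)
qed

lemma seq_scale_of_real: "seq_scale s (of_real r) f = r *\<^sub>R f"
proof -
  have "seq_scale s (of_real r) f = Bcontfun (apply_bcontfun (r *\<^sub>R f))"
    by (simp add: seq_scale_def scale_of_real scaleR_bcontfun.rep_eq)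
  then show ?thesis by (simp only: apply_bcontfun_inverse)
qed

lemma vscale_UP: "vscale UP r (cls f) = cls (r *\<^sub>R f)"
proof -
  have "cls (r *\<^sub>R f') = cls (r *\<^sub>R f)" if "f' \<in> cls f" for f'
  proof (rule cls_eqI, unfold mem_cls)
    have "((\<lambda>n. \<bar>r\<bar> * norm (apply_bcontfun f n - apply_bcontfun f' n)) \<longlongrightarrow> 0) U"
      by (rule tendsto_mult_right_zero) (use that in \<open>simp add: mem_cls\<close>)
    then show "((\<lambda>n. norm (apply_bcontfun (r *\<^sub>R f) n - apply_bcontfun (r *\<^sub>R f') n)) \<longlongrightarrow> 0) U"
      by (simp add: scaleR_bcontfun.rep_eq scaleR_diff_right[symmetric])
  qed
  then have "(\<Union>f'\<in>cls f. cls (r *\<^sub>R f')) = cls (r *\<^sub>R f)" using self_mem_cls[of f] by blast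
  then show ?thesis by (simp add: restrict_scalars_def ultrapower_def seq_scale_of_real cls_def)
qed

lemma vnorm_UP: "vnorm UP A = (INF f\<in>A. norm f)"
  by (simp add: restrict_scalars_def ultrapower_def)

lemma vnorm_cls_le: "g \<in> cls f \<Longrightarrow> vnorm UP (cls f) \<le> norm g"
  unfolding vnorm_UP by (rule cINF_lower) (auto intro: bdd_belowI2[of _ 0])

text \<open>It turns a bound on the quotient norm into a bound on all coordinates of a suitable
  representative.\<close>

lemma vnorm_cls_less:
  assumes "vnorm UP (cls f) < t" obtains g where "cls g = cls f" "norm g < t"
proof -
  have "cls f \<noteq> {}" using self_mem_cls by blast
  moreover have "bdd_below (norm ` cls f)" by (auto intro: bdd_belowI2[of _ 0])
  ultimately obtain g where "g \<in> cls f" "norm g < t"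
    using assms unfolding vnorm_UP by (auto simp: cINF_less_iff)
  then show ?thesis using that cls_eqI by blast
qed

text \<open>Any other representative is arbitrarily close to f at some coordinate, so its supremum
  norm cannot drop below c.\<close>

lemma le_vnorm_cls:
  assumes "\<And>n. c \<le> norm (apply_bcontfun f n)" shows "c \<le> vnorm UP (cls f)"
  unfolding vnorm_UP
proof (rule cINF_greatest)
  show "cls f \<noteq> {}" using self_mem_cls by blast
  fix g assume "g \<in> cls f"
  then have lim: "((\<lambda>n. norm (apply_bcontfun f n - apply_bcontfun g n)) \<longlongrightarrow> 0) U" by (simp add: mem_cls)
  show "c \<le> norm g"
  proof (rule field_le_epsilon)
    fix e :: real assume "0 < e"
    then have "\<forall>\<^sub>F n in U. norm (apply_bcontfun f n - apply_bcontfun g n) < e" by (rule order_tendstoD(2)[OF lim])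
    then obtain n where n: "norm (apply_bcontfun f n - apply_bcontfun g n) < e"
      using eventually_happens'[OF U] by blast
    have "norm (apply_bcontfun f n) \<le> norm (apply_bcontfun g n) + norm (apply_bcontfun f n - apply_bcontfun g n)"
      by (rule norm_triangle_sub)
    then show "c \<le> norm g + e" using n assms[of n] norm_bounded[of g n] by linarith
  qed
qed

lemma vsum_UP: "vsum UP (\<lambda>i. vscale UP (c i) (cls (f i))) n = cls (\<Sum>i<n. c i *\<^sub>R f i)"
proof (induction n)
  case 0
  show ?case by (simp add: restrict_scalars_def ultrapower_def cls_def)
next
  case (Suc n)
  then show ?case by (simp add: vscale_UP vadd_UP)
qed

lemma vsum_cong: "(\<And>i. i < n \<Longrightarrow> x i = y i) \<Longrightarrow> vsum V x n = vsum V y n"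
  by (induction n) simp_all

lemma set_combination_UP:
  assumes "\<And>i. i < n \<Longrightarrow> S i \<subseteq> carr UP"
  shows "set_combination UP n c S = {cls (\<Sum>i<n. c i *\<^sub>R f i) | f. \<forall>i<n. cls (f i) \<in> S i}"
proof (intro set_eqI iffI)
  fix A assume "A \<in> set_combination UP n c S"
  then obtain x where x: "A = vsum UP (\<lambda>i. vscale UP (c i) (x i)) n" "\<forall>i<n. x i \<in> S i"
    by (auto simp: set_combination_def)
  have "\<forall>i. \<exists>f. i < n \<longrightarrow> x i = cls f" using x(2) assms carr_UP by blast
  then obtain f where f: "\<And>i. i < n \<Longrightarrow> x i = cls (f i)" by metis
  have "A = vsum UP (\<lambda>i. vscale UP (c i) (cls (f i))) n"
    unfolding x(1) by (rule vsum_cong) (simp add: f)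
  then show "A \<in> {cls (\<Sum>i<n. c i *\<^sub>R f i) | f. \<forall>i<n. cls (f i) \<in> S i}"
    using f x(2) by (auto simp: vsum_UP)
next
  fix A assume "A \<in> {cls (\<Sum>i<n. c i *\<^sub>R f i) | f. \<forall>i<n. cls (f i) \<in> S i}"
  then obtain f where "A = cls (\<Sum>i<n. c i *\<^sub>R f i)" "\<forall>i<n. cls (f i) \<in> S i" by auto
  then show "A \<in> set_combination UP n c S"
    unfolding set_combination_def by (auto simp: vsum_UP[symmetric])
qed

lemma vdiff_UP: "vadd UP (cls f) (vscale UP (-1) (cls g)) = cls (f - g)"
  by (simp add: vscale_UP vadd_UP)

text \<open>The upper bound for the diameter, computed with representatives of supremum norm at most
  1 + e/2.\<close>

lemma vnorm_convex_combination_le: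
  fixes n :: nat
  assumes c: "\<And>i. i < n \<Longrightarrow> 0 \<le> c i" "(\<Sum>i<n. c i) = 1"
    and f: "\<And>i. i < n \<Longrightarrow> vnorm UP (cls (f i)) \<le> 1" and g: "\<And>i. i < n \<Longrightarrow> vnorm UP (cls (g i)) \<le> 1"
  shows "vnorm UP (cls ((\<Sum>i<n. c i *\<^sub>R f i) - (\<Sum>i<n. c i *\<^sub>R g i))) \<le> 2"
proof (rule field_le_epsilon)
  fix e :: real assume e: "0 < e"
  have ex: "\<exists>h'. \<forall>i<n. cls (h' i) = cls (h i) \<and> norm (h' i) \<le> 1 + e / 2"
    if "\<And>i. i < n \<Longrightarrow> vnorm UP (cls (h i)) \<le> 1" for h
  proof -
    have "\<forall>i. \<exists>h'. i < n \<longrightarrow> cls h' = cls (h i) \<and> norm h' \<le> 1 + e / 2"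
    proof
      fix i
      show "\<exists>h'. i < n \<longrightarrow> cls h' = cls (h i) \<and> norm h' \<le> 1 + e / 2"
      proof (cases "i < n")
        case True
        then have "vnorm UP (cls (h i)) < 1 + e / 2" using that[of i] e by simp
        then obtain h' where "cls h' = cls (h i)" "norm h' < 1 + e / 2" by (rule vnorm_cls_less)
        then show ?thesis by (auto intro: exI[of _ h'])
      qed simp
    qed
    then show ?thesis by metis
  qed
  obtain f' where f': "\<And>i. i < n \<Longrightarrow> cls (f' i) = cls (f i)" "\<And>i. i < n \<Longrightarrow> norm (f' i) \<le> 1 + e / 2"
    using ex[of f, OF f] by auto
  obtain g' where g': "\<And>i. i < n \<Longrightarrow> cls (g' i) = cls (g i)" "\<And>i. i < n \<Longrightarrow> norm (g' i) \<le> 1 + e / 2"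
    using ex[of g, OF g] by auto
  have comb: "cls (\<Sum>i<n. c i *\<^sub>R h' i) = cls (\<Sum>i<n. c i *\<^sub>R h i)"
    if "\<And>i. i < n \<Longrightarrow> cls (h' i) = cls (h i)" for h h'
    unfolding vsum_UP[symmetric] by (rule vsum_cong) (simp add: that)
  have "cls ((\<Sum>i<n. c i *\<^sub>R f i) - (\<Sum>i<n. c i *\<^sub>R g i)) = cls ((\<Sum>i<n. c i *\<^sub>R f' i) - (\<Sum>i<n. c i *\<^sub>R g' i))"
    using comb[OF f'(1)] comb[OF g'(1)] by (simp add: vdiff_UP[symmetric])
  then have "vnorm UP (cls ((\<Sum>i<n. c i *\<^sub>R f i) - (\<Sum>i<n. c i *\<^sub>R g i))) \<le>
      norm ((\<Sum>i<n. c i *\<^sub>R f' i) - (\<Sum>i<n. c i *\<^sub>R g' i))"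
    by (simp add: vnorm_cls_le self_mem_cls)
  also have "\<dots> \<le> norm (\<Sum>i<n. c i *\<^sub>R f' i) + norm (\<Sum>i<n. c i *\<^sub>R g' i)" by (rule norm_triangle_ineq4)
  also have "\<dots> \<le> (1 + e / 2) + (1 + e / 2)"
  proof (rule add_mono)
    have *: "norm (\<Sum>i<n. c i *\<^sub>R h i) \<le> 1 + e / 2" if "\<And>i. i < n \<Longrightarrow> norm (h i) \<le> 1 + e / 2" for h :: "nat \<Rightarrow> nat \<Rightarrow>\<^sub>C 'a"
    proof -
      have "norm (\<Sum>i<n. c i *\<^sub>R h i) \<le> (\<Sum>i<n. c i * (1 + e / 2))"
        by (rule sum_norm_le) (use that c(1) in \<open>auto intro: mult_left_mono\<close>)
      also have "\<dots> = 1 + e / 2" by (simp add: sum_distrib_right[symmetric] c(2))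
      finally show ?thesis .
    qed
    show "norm (\<Sum>i<n. c i *\<^sub>R f' i) \<le> 1 + e / 2" "norm (\<Sum>i<n. c i *\<^sub>R g' i) \<le> 1 + e / 2"
      using * f'(2) g'(2) by blast+
  qed
  finally show "vnorm UP (cls ((\<Sum>i<n. c i *\<^sub>R f i) - (\<Sum>i<n. c i *\<^sub>R g i))) \<le> 2 + e" by simp
qed

section \<open>Real functionals and slices of the ultrapower\<close>

context
  fixes F assumes F: "F \<in> carr (dual UP)"
begin

lemma dual_UP_add: "F (cls (f + g)) = F (cls f) + F (cls g)"
proof -
  have "F (vadd UP (cls f) (cls g)) = F (cls f) + F (cls g)"
    using F carr_UP by (auto simp: dual_def linear_map_def subsp_def)
  then show ?thesis by (simp add: vadd_UP)
qed

lemma dual_UP_scale: "F (cls (r *\<^sub>R f)) = r * F (cls f)"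
proof -
  have "F (vscale UP r (cls f)) = r * F (cls f)"
    using F carr_UP by (auto simp: dual_def linear_map_def subsp_def)
  then show ?thesis by (simp add: vscale_UP)
qed

lemma dual_UP_linear: "linear (\<lambda>f. F (cls f))"
  by (rule linearI) (simp_all add: dual_UP_add dual_UP_scale)

lemma dual_UP_bdd: "bdd_above (F ` unit_ball UP)"
proof -
  obtain B where B: "\<And>A. A \<in> carr UP \<Longrightarrow> norm (F A) \<le> B * vnorm UP A"
    using F by (auto simp: dual_def)
  show ?thesis
  proof (rule bdd_aboveI2)
    fix A assume A: "A \<in> unit_ball UP"
    then obtain f where f: "A = cls f" by (auto simp: unit_ball_def carr_UP)
    have "0 \<le> vnorm UP A" unfolding f by (rule le_vnorm_cls) simp
    then have "B * vnorm UP A \<le> \<bar>B\<bar> * 1" using A by (intro mult_mono) (auto simp: unit_ball_def)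
    then show "F A \<le> \<bar>B\<bar>" using B[of A] A by (auto simp: unit_ball_def)
  qed
qed

lemma dual_UP_le_SUP: "vnorm UP (cls f) \<le> 1 \<Longrightarrow> F (cls f) \<le> (SUP A\<in>unit_ball UP. F A)"
  by (rule cSUP_upper[OF _ dual_UP_bdd]) (simp add: unit_ball_def carr_UP)

lemma mem_slice_UP:
  "cls f \<in> slice UP F \<alpha> \<longleftrightarrow> vnorm UP (cls f) \<le> 1 \<and> (SUP A\<in>unit_ball UP. F A) - \<alpha> < F (cls f)"
  by (auto simp: slice_def unit_ball_def carr_UP)

text \<open>A point of the slice is scaled by t slightly below 1, so that it stays in the slice, and
  represented by t g with norm g < 1/t. Perturbing coordinatewise needs every coordinate in the open
  unit ball.\<close>

lemma slice_UP_interior: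
  assumes "0 < \<alpha>"
  obtains f where "norm f < 1" "(SUP A\<in>unit_ball UP. F A) - \<alpha> < F (cls f)"
proof -
  let ?M = "SUP A\<in>unit_ball UP. F A"
  have "cls 0 \<in> unit_ball UP"
    using vnorm_cls_le[OF self_mem_cls, of 0] by (simp add: unit_ball_def carr_UP)
  then have ne: "unit_ball UP \<noteq> {}" by blast
  have "?M - \<alpha> < ?M" using assms by simp
  then obtain A where A: "A \<in> unit_ball UP" "?M - \<alpha> < F A"
    using less_cSUP_iff[OF ne dual_UP_bdd, of "?M - \<alpha>"] by blast
  then obtain f where f: "A = cls f" by (auto simp: unit_ball_def carr_UP)
  have "((\<lambda>t. t * F A) \<longlongrightarrow> 1 * F A) (at_left 1)" by (intro tendsto_intros)
  then have "\<forall>\<^sub>F t in at_left 1. ?M - \<alpha> < t * F A" by (rule order_tendstoD) (use A in simp)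
  moreover have "\<forall>\<^sub>F t in at_left 1. t \<in> {0<..<1::real}" by (rule eventually_at_left_real) simp
  ultimately have "\<forall>\<^sub>F t in at_left 1. ?M - \<alpha> < t * F A \<and> t \<in> {0<..<1::real}" by (rule eventually_conj)
  then obtain t where t: "?M - \<alpha> < t * F A" "0 < t" "t < 1"
    using eventually_happens'[OF trivial_limit_at_left_real] by fastforce
  have "vnorm UP (cls f) < 1 / t" using A(1) t by (auto simp: f unit_ball_def intro: le_less_trans)
  then obtain g where g: "cls g = cls f" "norm g < 1 / t" by (rule vnorm_cls_less)
  show ?thesis
  proof (rule that[of "t *\<^sub>R g"])
    show "norm (t *\<^sub>R g) < 1" using g t by (simp add: field_simps)
    show "?M - \<alpha> < F (cls (t *\<^sub>R g))" using t by (simp add: dual_UP_scale g f)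
  qed
qed

text \<open>Giving z j the sign of F (cls (z j)) turns the sum of moduli into one value of F on the
  ball. Hence F can be large on only a few z j.\<close>

lemma sum_abs_le_SUP:
  assumes "\<And>S. vnorm UP (cls (\<Sum>j<N. (if j \<in> S then 1 else -1) *\<^sub>R z j)) \<le> 1"
  shows "(\<Sum>j<N. \<bar>F (cls (z j))\<bar>) \<le> (SUP A\<in>unit_ball UP. F A)"
proof -
  define S where "S = {j. 0 \<le> F (cls (z j))}"
  have "(\<Sum>j<N. \<bar>F (cls (z j))\<bar>) = (\<Sum>j<N. (if j \<in> S then 1 else -1) * F (cls (z j)))"
    by (rule sum.cong) (auto simp: S_def)
  also have "\<dots> = F (cls (\<Sum>j<N. (if j \<in> S then 1 else -1) *\<^sub>R z j))"
    by (simp add: linear_sum[OF dual_UP_linear] dual_UP_scale)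
  also have "\<dots> \<le> (SUP A\<in>unit_ball UP. F A)" by (rule dual_UP_le_SUP[OF assms])
  finally show ?thesis .
qed

end

text \<open>The perturbations are solved in each coordinate and assembled into sequences. For large
  N some column j is nearly invisible to all F i, so the perturbed points with either sign remain in
  the slices.\<close>

lemma slice_combination_far_points:
  fixes n :: nat
  assumes pert: "\<And>k N x r. (\<And>i. i < k \<Longrightarrow> norm (x i :: 'a) < 1) \<Longrightarrow> 0 \<le> r \<Longrightarrow> r < 1 \<Longrightarrow> perturbable UNIV k N x r"
    and F: "\<And>i. i < n \<Longrightarrow> F i \<in> carr (dual UP)" and \<alpha>: "\<And>i. i < n \<Longrightarrow> 0 < \<alpha> i"
    and c: "(\<Sum>i<n. c i) = 1" and r: "0 \<le> r" "r < 1"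
  obtains g h where "\<And>i. i < n \<Longrightarrow> cls (g i) \<in> slice UP (F i) (\<alpha> i)" "\<And>i. i < n \<Longrightarrow> cls (h i) \<in> slice UP (F i) (\<alpha> i)"
    "2 * r \<le> vnorm UP (cls ((\<Sum>i<n. c i *\<^sub>R g i) - (\<Sum>i<n. c i *\<^sub>R h i)))"
proof -
  define M where "M i = (SUP A\<in>unit_ball UP. F i A)" for i
  have "\<forall>i. \<exists>f. i < n \<longrightarrow> norm f < 1 \<and> M i - \<alpha> i < F i (cls f)"
    using slice_UP_interior[OF F \<alpha>] unfolding M_def by metis
  then obtain f where f: "\<And>i. i < n \<Longrightarrow> norm (f i) < 1" "\<And>i. i < n \<Longrightarrow> M i - \<alpha> i < F i (cls (f i))"
    by metis
  define gap where "gap i = F i (cls (f i)) - (M i - \<alpha> i)" for i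
  have gap: "0 < gap i" if "i < n" for i using f(2)[OF that] by (simp add: gap_def)
  \<comment> \<open>If every column j spoiled some slice, the sums of w i j / gap i over i would
    each be at least 1, giving a total of at least N. Row summability bounds this total by the
    left-hand side.\<close>
  obtain N :: nat where N: "(\<Sum>i<n. 2 * M i / gap i) < N" using reals_Archimedean2 by blast
  have "perturbable UNIV n N (\<lambda>i. apply_bcontfun (f i) m) r" for m
  proof (rule pert[OF _ r])
    fix i assume "i < n"
    then show "norm (apply_bcontfun (f i) m) < 1" using norm_bounded[of "f i" m] f(1)[of i] by linarith
  qed
  then have "\<forall>m. \<exists>y. (\<forall>i\<le>n. \<forall>S. norm (\<Sum>j<N. (if j \<in> S then 1 else -1) *\<^sub>R y i j) < 1) \<and>
        (\<forall>i<n. \<forall>j<N. \<forall>\<sigma>\<in>{1, -1}. norm (apply_bcontfun (f i) m - y i j + \<sigma> *\<^sub>R y n j) < 1) \<and>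
        (\<forall>j<N. r < norm (y n j))"
    unfolding perturbable_def by blast
  from choice[OF this] obtain y where yy: "\<forall>m. (\<forall>i\<le>n. \<forall>S. norm (\<Sum>j<N. (if j \<in> S then 1 else -1) *\<^sub>R y m i j) < 1) \<and>
        (\<forall>i<n. \<forall>j<N. \<forall>\<sigma>\<in>{1, -1}. norm (apply_bcontfun (f i) m - y m i j + \<sigma> *\<^sub>R y m n j) < 1) \<and>
        (\<forall>j<N. r < norm (y m n j))" ..
  have y: "\<And>m i S. i \<le> n \<Longrightarrow> norm (\<Sum>j<N. (if j \<in> S then 1 else -1) *\<^sub>R y m i j) < 1"
    "\<And>m i j \<sigma>. i < n \<Longrightarrow> j < N \<Longrightarrow> \<sigma> \<in> {1, -1} \<Longrightarrow> norm (apply_bcontfun (f i) m - y m i j + \<sigma> *\<^sub>R y m n j) < 1"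
    "\<And>m j. j < N \<Longrightarrow> r < norm (y m n j)"
    using yy[THEN spec, THEN conjunct1, rule_format] yy[THEN spec, THEN conjunct2, THEN conjunct1, rule_format]
      yy[THEN spec, THEN conjunct2, THEN conjunct2, rule_format] by blast+
  have y1: "norm (y m i j) \<le> 1" if "i \<le> n" "j < N" for m i j
  proof -
    define a where "a S = (\<Sum>j'<N. (if j' \<in> S then 1 else -1) *\<^sub>R y m i j')" for S :: "nat set"
    \<comment> \<open>Two sign patterns that differ only at j isolate 2 y m i j. Thus the entries
      are bounded uniformly in m and form elements of
      \<open>nat \<Rightarrow>\<^sub>C 'a\<close>.\<close>
    have "a UNIV - a (- {j}) = (\<Sum>j'<N. if j' = j then 2 *\<^sub>R y m i j' else 0)"
      unfolding a_def sum_subtractf[symmetric] by (rule sum.cong) (auto simp: scaleR_2)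
    also have "\<dots> = 2 *\<^sub>R y m i j" using that by simp
    finally have eq: "a UNIV - a (- {j}) = 2 *\<^sub>R y m i j" .
    have "norm (a S) < 1" for S unfolding a_def by (rule y(1)[OF that(1)])
    from this[of UNIV] this[of "- {j}"] have "norm (a UNIV - a (- {j})) \<le> 1 + 1"
      by (intro norm_triangle_le_diff) linarith
    then have "norm (2 *\<^sub>R y m i j) \<le> 1 + 1" unfolding eq .
    then show ?thesis by simp
  qed
  define z where "z i j = Bcontfun (\<lambda>m. y m i j)" for i j
  have z: "apply_bcontfun (z i j) m = y m i j" if "i \<le> n" "j < N" for i j m
  proof -
    have "(\<lambda>m. y m i j) \<in> bcontfun"
      unfolding bcontfun_def by (auto intro!: boundedI[of _ 1] y1 that continuous_on_discrete)
    then show ?thesis by (simp add: z_def Bcontfun_inverse)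
  qed
  have sum_apply: "apply_bcontfun (\<Sum>j<N. a j *\<^sub>R w j) m = (\<Sum>j<N. a j *\<^sub>R apply_bcontfun (w j) m)" for a w m and N :: nat
    by (induction N) (simp_all add: plus_bcontfun.rep_eq scaleR_bcontfun.rep_eq)
  have row: "vnorm UP (cls (\<Sum>j<N. (if j \<in> S then 1 else -1) *\<^sub>R z i j)) \<le> 1" if "i \<le> n" for i S
  proof (rule order_trans[OF vnorm_cls_le[OF self_mem_cls] norm_bound])
    fix m
    have "apply_bcontfun (\<Sum>j<N. (if j \<in> S then 1 else -1) *\<^sub>R z i j) m = (\<Sum>j<N. (if j \<in> S then 1 else -1) *\<^sub>R y m i j)"
      unfolding sum_apply by (rule sum.cong) (simp_all add: z that)
    then show "norm (apply_bcontfun (\<Sum>j<N. (if j \<in> S then 1 else -1) *\<^sub>R z i j) m) \<le> 1"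
      using y(1)[OF that, of S m] by simp
  qed
  have ball: "vnorm UP (cls (f i - z i j + \<sigma> *\<^sub>R z n j)) \<le> 1" if "i < n" "j < N" "\<sigma> \<in> {1, -1}" for i j \<sigma>
  proof (rule order_trans[OF vnorm_cls_le[OF self_mem_cls] norm_bound])
    fix m
    have eq: "apply_bcontfun (f i - z i j + \<sigma> *\<^sub>R z n j) m = apply_bcontfun (f i) m - y m i j + \<sigma> *\<^sub>R y m n j"
      using that by (simp add: plus_bcontfun.rep_eq minus_bcontfun.rep_eq scaleR_bcontfun.rep_eq z)
    show "norm (apply_bcontfun (f i - z i j + \<sigma> *\<^sub>R z n j) m) \<le> 1"
      unfolding eq by (rule less_imp_le[OF y(2)[OF that]])
  qed
  \<comment> \<open>The largest change that column j can cause in the value of F i, for either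
    sign.\<close>
  define w where "w i j = \<bar>F i (cls (z i j))\<bar> + \<bar>F i (cls (z n j))\<bar>" for i j
  have "\<exists>j<N. \<forall>i<n. w i j < gap i"
  proof (rule ccontr)
    assume "\<not> (\<exists>j<N. \<forall>i<n. w i j < gap i)"
    then have no: "\<exists>i<n. gap i \<le> w i j" if "j < N" for j using that by (meson not_le)
    have w0: "0 \<le> w i j / gap i" if "i < n" for i j using gap[OF that] by (simp add: w_def)
    have "1 \<le> (\<Sum>i<n. w i j / gap i)" if j: "j < N" for j
    proof -
      obtain i where i: "i < n" "gap i \<le> w i j" using no[OF j] by blast
      have "1 \<le> w i j / gap i" using i gap[OF i(1)] by simp
      also have "\<dots> \<le> (\<Sum>i<n. w i j / gap i)" using i w0 by (intro member_le_sum) auto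
      finally show ?thesis .
    qed
    then have "(\<Sum>j<N. 1) \<le> (\<Sum>j<N. \<Sum>i<n. w i j / gap i)" by (intro sum_mono) auto
    also have "\<dots> = (\<Sum>i<n. (\<Sum>j<N. w i j) / gap i)" by (subst sum.swap) (simp add: sum_divide_distrib)
    also have "\<dots> \<le> (\<Sum>i<n. 2 * M i / gap i)"
    proof (rule sum_mono)
      fix i assume "i \<in> {..<n}"
      then have i: "i < n" by simp
      have "(\<Sum>j<N. w i j) \<le> M i + M i"
        unfolding w_def sum.distrib M_def
        by (intro add_mono sum_abs_le_SUP[OF F[OF i]] row) (use i in auto)
      then show "(\<Sum>j<N. w i j) / gap i \<le> 2 * M i / gap i"
        using gap[OF i] by (intro divide_right_mono) auto
    qed
    finally show False using N by simp
  qed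
  then obtain j where j: "j < N" and wj: "\<And>i. i < n \<Longrightarrow> w i j < gap i" by blast
  have slice: "cls (f i - z i j + \<sigma> *\<^sub>R z n j) \<in> slice UP (F i) (\<alpha> i)" if i: "i < n" and \<sigma>: "\<sigma> \<in> {1, -1}" for i \<sigma>
    unfolding mem_slice_UP[OF F[OF i]]
  proof
    show "vnorm UP (cls (f i - z i j + \<sigma> *\<^sub>R z n j)) \<le> 1" by (rule ball[OF i j \<sigma>])
    note lin = dual_UP_linear[OF F[OF i]]
    have "F i (cls (f i - z i j + \<sigma> *\<^sub>R z n j)) = F i (cls (f i)) - F i (cls (z i j)) + \<sigma> * F i (cls (z n j))"
      using linear_add[OF lin] linear_diff[OF lin] linear_cmul[OF lin] by simp
    moreover have "\<bar>\<sigma> * F i (cls (z n j))\<bar> = \<bar>F i (cls (z n j))\<bar>" using \<sigma> by auto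
    moreover have "\<bar>F i (cls (z i j))\<bar> + \<bar>F i (cls (z n j))\<bar> < F i (cls (f i)) - (M i - \<alpha> i)"
      using wj[OF i] by (simp add: w_def gap_def)
    ultimately show "(SUP A\<in>unit_ball UP. F i A) - \<alpha> i < F i (cls (f i - z i j + \<sigma> *\<^sub>R z n j))"
      unfolding M_def[symmetric] by linarith
  qed
  \<comment> \<open>The vector z n j is common to all summands and the weights add up to one, so
    taking the combination does not diminish it.\<close>
  have "(\<Sum>i<n. c i *\<^sub>R (f i - z i j + 1 *\<^sub>R z n j)) - (\<Sum>i<n. c i *\<^sub>R (f i - z i j + (-1) *\<^sub>R z n j))
      = (\<Sum>i<n. c i *\<^sub>R (2 *\<^sub>R z n j))"
    unfolding sum_subtractf[symmetric] scaleR_diff_right[symmetric] by (simp add: scaleR_2)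
  also have "\<dots> = 2 *\<^sub>R z n j" by (simp only: scaleR_sum_left[symmetric] c scaleR_one)
  finally have diff: "(\<Sum>i<n. c i *\<^sub>R (f i - z i j + 1 *\<^sub>R z n j)) - (\<Sum>i<n. c i *\<^sub>R (f i - z i j + (-1) *\<^sub>R z n j)) = 2 *\<^sub>R z n j" .
  show ?thesis
  proof (rule that[of "\<lambda>i. f i - z i j + 1 *\<^sub>R z n j" "\<lambda>i. f i - z i j + (-1) *\<^sub>R z n j"])
    show "cls (f i - z i j + 1 *\<^sub>R z n j) \<in> slice UP (F i) (\<alpha> i)" "cls (f i - z i j + (-1) *\<^sub>R z n j) \<in> slice UP (F i) (\<alpha> i)"
      if "i < n" for i
      using slice[OF that] by blast+
    show "2 * r \<le> vnorm UP (cls ((\<Sum>i<n. c i *\<^sub>R (f i - z i j + 1 *\<^sub>R z n j)) - (\<Sum>i<n. c i *\<^sub>R (f i - z i j + (-1) *\<^sub>R z n j))))"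
      unfolding diff
    proof (rule le_vnorm_cls)
      show "2 * r \<le> norm (apply_bcontfun (2 *\<^sub>R z n j) m)" for m
        using y(3)[OF j, of m] z[OF order_refl j, of m] by (simp add: scaleR_bcontfun.rep_eq)
    qed
  qed
qed

lemma SD2P_UP:
  assumes pert: "\<And>k N x r. (\<And>i. i < k \<Longrightarrow> norm (x i :: 'a) < 1) \<Longrightarrow> 0 \<le> r \<Longrightarrow> r < 1 \<Longrightarrow> perturbable UNIV k N x r"
  shows "SD2P UP"
  unfolding SD2P_def
proof (intro allI impI)
  fix n and c :: "nat \<Rightarrow> real" and F and \<alpha> :: "nat \<Rightarrow> real"
  assume h: "(\<forall>i<n. 0 < c i \<and> F i \<in> carr (dual UP) \<and> 0 < \<alpha> i) \<and> (\<Sum>i<n. c i) = 1"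
  define A where "A = set_combination UP n c (\<lambda>i. slice UP (F i) (\<alpha> i))"
  have A: "A = {cls (\<Sum>i<n. c i *\<^sub>R f i) | f. \<forall>i<n. cls (f i) \<in> slice UP (F i) (\<alpha> i)}"
    unfolding A_def by (rule set_combination_UP) (auto simp: slice_def unit_ball_def)
  let ?d = "\<lambda>(x, y). vnorm UP (vadd UP x (vscale UP (-1) y))"
  have le: "?d p \<le> 2" if pA: "p \<in> A \<times> A" for p
  proof -
    obtain f g where fg: "p = (cls (\<Sum>i<n. c i *\<^sub>R f i), cls (\<Sum>i<n. c i *\<^sub>R g i))"
      "\<forall>i<n. cls (f i) \<in> slice UP (F i) (\<alpha> i)" "\<forall>i<n. cls (g i) \<in> slice UP (F i) (\<alpha> i)"
      using pA by (auto simp: A)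
    have "vnorm UP (cls ((\<Sum>i<n. c i *\<^sub>R f i) - (\<Sum>i<n. c i *\<^sub>R g i))) \<le> 2"
    proof (rule vnorm_convex_combination_le)
      fix i assume "i < n"
      then show "0 \<le> c i" "vnorm UP (cls (f i)) \<le> 1" "vnorm UP (cls (g i)) \<le> 1"
        using h fg by (auto simp: slice_def unit_ball_def less_imp_le)
    qed (use h in simp)
    then show ?thesis by (simp add: fg vdiff_UP)
  qed
  have ge: "\<exists>p\<in>A \<times> A. 2 * r \<le> ?d p" if r: "0 \<le> r" "r < 1" for r
  proof -
    obtain g k where gk: "\<And>i. i < n \<Longrightarrow> cls (g i) \<in> slice UP (F i) (\<alpha> i)" "\<And>i. i < n \<Longrightarrow> cls (k i) \<in> slice UP (F i) (\<alpha> i)"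
      "2 * r \<le> vnorm UP (cls ((\<Sum>i<n. c i *\<^sub>R g i) - (\<Sum>i<n. c i *\<^sub>R k i)))"
      by (rule slice_combination_far_points[OF pert, of n F \<alpha> c r]) (use h r that in auto)
    then show ?thesis
      by (intro bexI[of _ "(cls (\<Sum>i<n. c i *\<^sub>R g i), cls (\<Sum>i<n. c i *\<^sub>R k i))"]) (auto simp: A vdiff_UP)
  qed
  have bdd: "bdd_above (?d ` (A \<times> A))" by (rule bdd_aboveI2[OF le])
  have "(SUP p\<in>A \<times> A. ?d p) = 2"
  proof (rule antisym)
    show "(SUP p\<in>A \<times> A. ?d p) \<le> 2"
      by (rule cSUP_least[OF _ le]) (use ge[of 0] in auto)
    show "2 \<le> (SUP p\<in>A \<times> A. ?d p)"
    proof (rule field_le_epsilon)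
      fix e :: real assume e: "0 < e"
      \<comment> \<open>Chosen so that 2 r + e is at least 2; the maximum with 0 keeps r admissible
        for large e.\<close>
      define r where "r = max 0 (1 - e / 2)"
      have r: "0 \<le> r" "r < 1" "2 \<le> 2 * r + e" using e by (auto simp: r_def max_def)
      obtain p where p: "p \<in> A \<times> A" "2 * r \<le> ?d p" using ge[OF r(1,2)] by blast
      then have "2 * r \<le> (SUP p\<in>A \<times> A. ?d p)" using cSUP_upper[OF p(1) bdd] by linarith
      then show "2 \<le> (SUP p\<in>A \<times> A. ?d p) + e" using r by linarith
    qed
  qed
  then show "vdiameter UP (set_combination UP n c (\<lambda>i. slice UP (F i) (\<alpha> i))) = 2"
    unfolding vdiameter_def A_def .
qed

end

end

theorem theorem4p5:
  fixes sX :: "'k::real_or_complex \<Rightarrow> 'a::banach \<Rightarrow> 'a"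
    and sY :: "'k \<Rightarrow> 'b::banach \<Rightarrow> 'b"
  assumes "K_banach sX"
    and "K_banach sY"
    and "is_X_infinity sX sY"
    and "infinite_dim_centralizer sY"
  shows "USD2P sX"
  unfolding USD2P_def
proof (intro allI impI)
  interpret K_banach sX by fact
  fix U :: "nat filter" assume "free_ultrafilter U"
  then have "U \<noteq> bot" by (simp add: free_ultrafilter_def)
  then show "SD2P (restrict_scalars (ultrapower sX U))"
    by (rule SD2P_UP) (rule perturbable_of_X_infinity[OF assms])
qed

end
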